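(* Let $X$ be a nonempty set, let $s$ be a normalized complete Pick kernel on $X$, and let $\ell=g s$ where $g$ is a positive semi-definite kernel on $X$ (assume $\ell_z\neq 0$ for all $z\in X$). Then a sequence $\{\lambda_i\}\subset X$ is interpolating for $\mathrm{Mult}(\mathcal{H}_s,\mathcal{H}_\ell)$ if and only if it satisfies the Carleson measure condition for $\mathcal{H}_s$ and is $n$-weakly separated by $\ell$ for every $n\ge 2$.
   Context: A kernel on a nonempty set $X$ is a positive semi-definite function $k:X\times X\to\mathbb{C}$; $\mathcal{H}_k$ is its reproducing kernel Hilbert space, $k_w=k(\cdot,w)$ (so $\langle k_w,k_z\rangle=k(z,w)$ and $\|k_w\|^2=k(w,w)$), and $\hat k_w=k_w/\|k_w\|$ when $k_w\ne 0$. A normalized complete Pick kernel is a kernel of the form $s(z,w)=\frac{1}{1-\langle b(z),b(w)\rangle_{\mathcal K}}$, where $b$ maps $X$ into the open unit ball of an auxiliary Hilbert space $\mathcal K$ and $b(w_0)=0$ for some $w_0\in X$. For kernels $k,\ell$ on $X$, $\mathrm{Mult}(\mathcal{H}_k,\mathcal{H}_\ell)$ is the set of functions $\phi:X\to\mathbb{C}$ such that $f\mapsto\phi f$ is a bounded operator $\mathcal{H}_k\to\mathcal{H}_\ell$, normed by the operator norm. A sequence $\{\lambda_i\}\subset X$ is interpolating for $\mathrm{Mult}(\mathcal{H}_k,\mathcal{H}_\ell)$ if for every bounded sequence $\{w_i\}$ of complex numbers there is $\phi\in\mathrm{Mult}(\mathcal{H}_k,\mathcal{H}_\ell)$ with $\phi(\lambda_i)=w_i\frac{\|\ell_{\lambda_i}\|}{\|k_{\lambda_i}\|}$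 for all $i$. A sequence $\{\lambda_i\}$ satisfies the Carleson measure condition for $\mathcal{H}_k$ if there is $C>0$ with $\sum_i \frac{|f(\lambda_i)|^2}{\|k_{\lambda_i}\|^2}\le C\|f\|^2_{\mathcal{H}_k}$ for all $f\in\mathcal{H}_k$. For $n\ge 2$, a sequence $\{\lambda_i\}$ (of distinct points) is $n$-weakly separated by $k$ if there is $\epsilon>0$ such that for every $n$-point subset $\{\mu_1,\dots,\mu_n\}$ of $\{\lambda_i\}$, $\mathrm{dist}\big(\hat k_{\mu_1},\mathrm{span}\{\hat k_{\mu_2},\dots,\hat k_{\mu_n}\}\big)\ge\epsilon$ (distance in $\mathcal{H}_k$). *)

theory Defs
  imports "HOL-Analysis.Analysis"
begin

text \<open>The nonempty set X is modelled by the type 'a (types are nonempty).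
  A kernel is a function k :: 'a => 'a => complex, with the convention
  k z w = <k_w, k_z>.\<close>

text \<open>Squared norm of the finite combination sum_i a_i k_{x_i} in H_k:
  sum_{i,j} a_i conj(a_j) <k_{x_i}, k_{x_j}> = sum_{i,j} a_i conj(a_j) k(x_j, x_i).\<close>
definition gram_form :: "('a \<Rightarrow> 'a \<Rightarrow> complex) \<Rightarrow> nat \<Rightarrow> (nat \<Rightarrow> 'a) \<Rightarrow> (nat \<Rightarrow> complex) \<Rightarrow> complex" where
  "gram_form k n x a = (\<Sum>i<n. \<Sum>j<n. a i * cnj (a j) * k (x j) (x i))"

definition psd_kernel :: "('a \<Rightarrow> 'a \<Rightarrow> complex) \<Rightarrow> bool" where
  "psd_kernel k \<longleftrightarrow> (\<forall>n x a. Im (gram_form k n x a) = 0 \<and> 0 \<le> Re (gram_form k n x a))"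

text \<open>Reproducing kernel Hilbert space H_k (Aronszajn): f is in H_k with norm^2 <= C
  iff |<f, g>|^2 <= C ||g||^2 for every g = sum_j a_j k_{x_j}, where
  <f, g> = sum_j conj(a_j) f(x_j).\<close>
definition rkhs_bound :: "('a \<Rightarrow> 'a \<Rightarrow> complex) \<Rightarrow> ('a \<Rightarrow> complex) \<Rightarrow> real \<Rightarrow> bool" where
  "rkhs_bound k f C \<longleftrightarrow> 0 \<le> C \<and>
     (\<forall>n x a. (cmod (\<Sum>j<n. cnj (a j) * f (x j)))\<^sup>2 \<le> C * Re (gram_form k n x a))"

definition in_rkhs :: "('a \<Rightarrow> 'a \<Rightarrow> complex) \<Rightarrow> ('a \<Rightarrow> complex) \<Rightarrow> bool" where
  "in_rkhs k f \<longleftrightarrow> (\<exists>C. rkhs_bound k f C)"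

definition rkhs_norm :: "('a \<Rightarrow> 'a \<Rightarrow> complex) \<Rightarrow> ('a \<Rightarrow> complex) \<Rightarrow> real" where
  "rkhs_norm k f = sqrt (Inf {C. rkhs_bound k f C})"

definition kvec :: "('a \<Rightarrow> 'a \<Rightarrow> complex) \<Rightarrow> 'a \<Rightarrow> ('a \<Rightarrow> complex)" where
  "kvec k w = (\<lambda>z. k z w)"

definition kvec_norm :: "('a \<Rightarrow> 'a \<Rightarrow> complex) \<Rightarrow> 'a \<Rightarrow> real" where
  "kvec_norm k w = rkhs_norm k (kvec k w)"

definition khat :: "('a \<Rightarrow> 'a \<Rightarrow> complex) \<Rightarrow> 'a \<Rightarrow> ('a \<Rightarrow> complex)" where
  "khat k w = (\<lambda>z. kvec k w z / complex_of_real (kvec_norm k w))"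

text \<open>The auxiliary Hilbert space K is represented as l^2('k) (every Hilbert space is
  isometrically isomorphic to some l^2(I)).\<close>
definition is_l2 :: "('k \<Rightarrow> complex) \<Rightarrow> bool" where
  "is_l2 u \<longleftrightarrow> (\<lambda>i. (cmod (u i))\<^sup>2) summable_on UNIV"

definition l2_inner :: "('k \<Rightarrow> complex) \<Rightarrow> ('k \<Rightarrow> complex) \<Rightarrow> complex" where
  "l2_inner u v = infsum (\<lambda>i. u i * cnj (v i)) UNIV"

definition l2_norm :: "('k \<Rightarrow> complex) \<Rightarrow> real" where
  "l2_norm u = sqrt (infsum (\<lambda>i. (cmod (u i))\<^sup>2) UNIV)"

definition ncp_kernel :: "('a \<Rightarrow> 'k \<Rightarrow> complex) \<Rightarrow> ('a \<Rightarrow> 'a \<Rightarrow> complex) \<Rightarrow> bool" where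
  "ncp_kernel b s \<longleftrightarrow>
     (\<forall>z. is_l2 (b z) \<and> l2_norm (b z) < 1) \<and>
     (\<exists>w0. b w0 = (\<lambda>i. 0)) \<and>
     (\<forall>z w. s z w = 1 / (1 - l2_inner (b z) (b w)))"

definition is_mult :: "('a \<Rightarrow> 'a \<Rightarrow> complex) \<Rightarrow> ('a \<Rightarrow> 'a \<Rightarrow> complex) \<Rightarrow> ('a \<Rightarrow> complex) \<Rightarrow> bool" where
  "is_mult k l \<phi> \<longleftrightarrow> (\<exists>M. \<forall>f. in_rkhs k f \<longrightarrow>
      in_rkhs l (\<lambda>z. \<phi> z * f z) \<and> rkhs_norm l (\<lambda>z. \<phi> z * f z) \<le> M * rkhs_norm k f)"

definition interpolating :: "('a \<Rightarrow> 'a \<Rightarrow> complex) \<Rightarrow> ('a \<Rightarrow> 'a \<Rightarrow> complex) \<Rightarrow> (nat \<Rightarrow> 'a) \<Rightarrow> bool" where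
  "interpolating k l lam \<longleftrightarrow>
     (\<forall>w :: nat \<Rightarrow> complex. (\<exists>B. \<forall>i. cmod (w i) \<le> B) \<longrightarrow>
        (\<exists>\<phi>. is_mult k l \<phi> \<and>
           (\<forall>i. \<phi> (lam i) = w i * complex_of_real (kvec_norm l (lam i) / kvec_norm k (lam i)))))"

definition carleson :: "('a \<Rightarrow> 'a \<Rightarrow> complex) \<Rightarrow> (nat \<Rightarrow> 'a) \<Rightarrow> bool" where
  "carleson k lam \<longleftrightarrow> (\<exists>C>0. \<forall>f. in_rkhs k f \<longrightarrow>
      summable (\<lambda>i. (cmod (f (lam i)))\<^sup>2 / (kvec_norm k (lam i))\<^sup>2) \<and>
      (\<Sum>i. (cmod (f (lam i)))\<^sup>2 / (kvec_norm k (lam i))\<^sup>2) \<le> C * (rkhs_norm k f)\<^sup>2)"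

definition span_dist :: "('a \<Rightarrow> 'a \<Rightarrow> complex) \<Rightarrow> nat \<Rightarrow> (nat \<Rightarrow> 'a) \<Rightarrow> real" where
  "span_dist k n \<mu> = (INF a :: nat \<Rightarrow> complex.
      rkhs_norm k (\<lambda>z. khat k (\<mu> 0) z - (\<Sum>j\<in>{1..<n}. a j * khat k (\<mu> j) z)))"

definition weakly_separated :: "nat \<Rightarrow> ('a \<Rightarrow> 'a \<Rightarrow> complex) \<Rightarrow> (nat \<Rightarrow> 'a) \<Rightarrow> bool" where
  "weakly_separated n k lam \<longleftrightarrow> (\<exists>\<epsilon>>0. \<forall>\<mu> :: nat \<Rightarrow> 'a.
      inj_on \<mu> {..<n} \<and> \<mu> ` {..<n} \<subseteq> range lam \<longrightarrow> \<epsilon> \<le> span_dist k n \<mu>)"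

end

theory Submission
  imports Defs
begin

text \<open>All conditions are turned into positivity of finite matrices. Write \<open>s = 1 / (1 - \<beta>)\<close>, and let \<open>H\<close> be the
  Gram matrix of the normalized kernels \<open>s\<^sub>z / \<parallel>s\<^sub>z\<parallel>\<close>, so that the Carleson condition says \<open>H \<le> C\<close>.

  Suppose \<open>H \<le> C\<close> and \<open>l\<close> is \<open>n\<close>-weakly separated for all \<open>n\<close>. A point has at most \<open>2C\<close> points near to it, in the
  sense \<open>\<bar>H\<^sub>i\<^sub>j\<bar>\<^sup>2 > 1/2\<close>; weak separation handles these, while the far ones are removed by the product of the
  contractive kernels \<open>\<kappa>\<^sub>y\<close> that vanish there, whose value at the point is at least \<open>exp (-2C)\<close>.
  So every \<open>l\<^sub>z / \<parallel>l\<^sub>z\<parallel>\<close> has a uniformly positive distance from the span of all the others. To get from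
  this to a Riesz lower bound one needs a row contraction over \<open>s\<close> whose \<open>k\<close>-th entry is bounded
  below at the \<open>k\<close>-th point. It is given by an explicit formula: \<open>z \<mapsto> \<surd>(2 \<alpha>\<^sub>k) exp (- t f(z)) s(z, k) / \<parallel>s\<^sub>k\<parallel>\<close> for
  \<open>t > 0\<close>, with \<open>f = \<Sum> \<alpha>\<^sub>k (2 s(\<cdot>, k) - 1)\<close>. This avoids both the solution of the Kadison--Singer problem and the
  column-row property of complete Pick spaces. The Riesz lower bound of \<open>l\<close> and \<open>H \<le> C\<close> give
  the Pick condition for every bounded target, and Pick interpolation for the pair \<open>(s, l)\<close> extends the
  target to a multiplier.

  Conversely, interpolation holds with a uniform constant by the Baire category theorem, and suitable
  choices of signs give \<open>H \<le> C\<close> and the Riesz lower bound for \<open>l\<close>, hence weak separation.\<close>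

section \<open>Positive semi-definite kernels on finite sets\<close>

definition qform :: "'i set \<Rightarrow> ('i \<Rightarrow> 'i \<Rightarrow> complex) \<Rightarrow> ('i \<Rightarrow> complex) \<Rightarrow> complex" where
  "qform F K c = (\<Sum>i\<in>F. \<Sum>j\<in>F. cnj (c i) * c j * K i j)"

text \<open>The order on the complex numbers compares real parts and demands equal imaginary parts,
  so the condition includes that the form is real; Hermitian symmetry of the matrix then
  follows.\<close>

definition psd_on :: "'i set \<Rightarrow> ('i \<Rightarrow> 'i \<Rightarrow> complex) \<Rightarrow> bool" where
  "psd_on F K \<longleftrightarrow> (\<forall>c. 0 \<le> qform F K c)"

lemma psd_onI: "(\<And>c. 0 \<le> qform F K c) \<Longrightarrow> psd_on F K"
  by (simp add: psd_on_def)

lemma psd_onD: "psd_on F K \<Longrightarrow> 0 \<le> qform F K c"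
  by (simp add: psd_on_def)

lemma qform_cong:
  assumes "\<And>i j. i \<in> F \<Longrightarrow> j \<in> F \<Longrightarrow> K i j = K' i j" "\<And>i. i \<in> F \<Longrightarrow> c i = c' i"
  shows "qform F K c = qform F K' c'"
  unfolding qform_def using assms by (intro sum.cong refl) auto

lemma psd_on_cong:
  assumes "\<And>i j. i \<in> F \<Longrightarrow> j \<in> F \<Longrightarrow> K i j = K' i j"
  shows "psd_on F K \<longleftrightarrow> psd_on F K'"
  unfolding psd_on_def using qform_cong[of F K K'] assms by metis

lemma qform_add: "qform F (\<lambda>i j. K i j + K' i j) c = qform F K c + qform F K' c"
  by (simp add: qform_def algebra_simps sum.distrib)

lemma qform_diff: "qform F (\<lambda>i j. K i j - K' i j) c = qform F K c - qform F K' c"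
  by (simp add: qform_def algebra_simps sum_subtractf)

lemma qform_scale: "qform F (\<lambda>i j. r * K i j) c = r * qform F K c"
  by (simp add: qform_def sum_distrib_left mult_ac)

lemma qform_sum: "qform F (\<lambda>i j. \<Sum>m\<in>A. K m i j) c = (\<Sum>m\<in>A. qform F (K m) c)"
proof (induction A rule: infinite_finite_induct)
  case (insert m A)
  then show ?case by (simp add: qform_add)
qed (simp_all add: qform_def)

lemma qform_rank1: "qform F (\<lambda>i j. f i * cnj (f j)) c = of_real ((cmod (\<Sum>i\<in>F. cnj (c i) * f i))\<^sup>2)"
proof -
  have "qform F (\<lambda>i j. f i * cnj (f j)) c = (\<Sum>i\<in>F. cnj (c i) * f i) * cnj (\<Sum>i\<in>F. cnj (c i) * f i)"
    unfolding qform_def cnj_sum sum_product by (intro sum.cong refl) (simp add: mult_ac)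
  then show ?thesis by (simp only: complex_norm_square)
qed

lemma qform_congruence:
  "qform F (\<lambda>i j. f i * cnj (f j) * K i j) c = qform F K (\<lambda>i. cnj (f i) * c i)"
  by (simp add: qform_def mult_ac)

lemma qform_diag:
  assumes "finite F"
  shows "qform F (\<lambda>i j. if i = j then d i else 0) c = (\<Sum>i\<in>F. of_real ((cmod (c i))\<^sup>2) * d i)"
proof -
  have "qform F (\<lambda>i j. if i = j then d i else 0) c = (\<Sum>i\<in>F. c i * cnj (c i) * d i)"
    using assms by (simp add: qform_def if_distrib mult_ac cong: if_cong)
  then show ?thesis by (simp only: complex_norm_square)
qed

lemma qform_insert:
  assumes "finite F" "y \<notin> F"
  shows "qform (insert y F) K c = cnj (c y) * c y * K y y + (\<Sum>j\<in>F. cnj (c y) * c j * K y j)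
           + (\<Sum>i\<in>F. cnj (c i) * c y * K i y) + qform F K c"
  using assms by (simp add: qform_def sum.distrib algebra_simps)

lemma psd_on_add: "psd_on F K \<Longrightarrow> psd_on F K' \<Longrightarrow> psd_on F (\<lambda>i j. K i j + K' i j)"
  by (simp add: psd_on_def qform_add)

lemma psd_on_sum: "(\<And>m. m \<in> A \<Longrightarrow> psd_on F (K m)) \<Longrightarrow> psd_on F (\<lambda>i j. \<Sum>m\<in>A. K m i j)"
  by (simp add: psd_on_def qform_sum sum_nonneg)

lemma psd_on_scale: "0 \<le> r \<Longrightarrow> psd_on F K \<Longrightarrow> psd_on F (\<lambda>i j. r * K i j)"
  by (simp add: psd_on_def qform_scale)

lemma psd_on_rank1: "psd_on F (\<lambda>i j. f i * cnj (f j))"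
  by (simp add: psd_on_def qform_rank1 less_eq_complex_def del: of_real_power)

lemma psd_on_zero: "psd_on F (\<lambda>i j. 0)"
  by (simp add: psd_on_def qform_def)

lemma psd_on_congruence: "psd_on F K \<Longrightarrow> psd_on F (\<lambda>i j. f i * cnj (f j) * K i j)"
  by (simp add: psd_on_def qform_congruence)

lemma psd_on_diag:
  assumes "finite F" "\<And>i. i \<in> F \<Longrightarrow> 0 \<le> d i"
  shows "psd_on F (\<lambda>i j. if i = j then d i else 0)"
  unfolding psd_on_def qform_diag[OF assms(1)]
  by (intro allI sum_nonneg mult_nonneg_nonneg) (use assms in \<open>auto simp: less_eq_complex_def\<close>)

lemma qform_extend_zero:
  assumes "finite F" "G \<subseteq> F"
  shows "qform F K (\<lambda>i. if i \<in> G then c i else 0) = qform G K c"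
proof -
  have "qform F K (\<lambda>i. if i \<in> G then c i else 0)
      = (\<Sum>i\<in>F. if i \<in> G then (\<Sum>j\<in>F. if j \<in> G then cnj (c i) * c j * K i j else 0) else 0)"
    unfolding qform_def by (intro sum.cong refl) (auto intro!: sum.cong sum.neutral)
  also have "\<dots> = qform G K c"
    unfolding qform_def
    using assms by (simp add: sum.inter_restrict[symmetric] Int_absorb1)
  finally show ?thesis .
qed

lemma psd_on_subset: "psd_on F K \<Longrightarrow> finite F \<Longrightarrow> G \<subseteq> F \<Longrightarrow> psd_on G K"
  unfolding psd_on_def by (metis qform_extend_zero)

lemma qform_restrict_support:
  assumes "finite F" "G \<subseteq> F" "\<And>i j. i \<in> F \<Longrightarrow> j \<in> F \<Longrightarrow> i \<notin> G \<or> j \<notin> G \<Longrightarrow> K i j = 0"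
  shows "qform F K c = qform G K c"
proof -
  have "qform F K c = (\<Sum>i\<in>F. \<Sum>j\<in>G. cnj (c i) * c j * K i j)"
    unfolding qform_def using assms by (intro sum.cong refl sum.mono_neutral_right) auto
  also have "\<dots> = qform G K c"
    unfolding qform_def
    by (rule sum.mono_neutral_right) (use assms in \<open>auto intro!: sum.neutral\<close>)
  finally show ?thesis .
qed

lemma psd_on_support:
  assumes "psd_on G K" "finite F" "G \<subseteq> F"
    "\<And>i j. i \<in> F \<Longrightarrow> j \<in> F \<Longrightarrow> i \<notin> G \<or> j \<notin> G \<Longrightarrow> K i j = 0"
  shows "psd_on F K"
  using assms(1) qform_restrict_support[OF assms(2-4)] by (simp add: psd_on_def)

lemma psd_on_diag_nonneg:
  assumes "psd_on F K" "finite F" "i \<in> F"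
  shows "0 \<le> K i i"
proof -
  have "psd_on {i} K" using assms psd_on_subset by blast
  from psd_onD[OF this, of "\<lambda>_. 1"] show ?thesis by (simp add: qform_def)
qed

lemma psd_on_hermitian:
  assumes "psd_on F K" "finite F" "i \<in> F" "j \<in> F"
  shows "K j i = cnj (K i j)"
proof (cases "i = j")
  case True
  then show ?thesis using psd_on_diag_nonneg[OF assms(1-3)] by (simp add: less_eq_complex_def complex_eq_iff)
next
  case False
  have P: "psd_on {i, j} K" using assms psd_on_subset[of F K "{i, j}"] by blast
  have d: "Im (K i i) = 0" "Im (K j j) = 0"
    using psd_on_diag_nonneg[OF assms(1,2)] assms by (auto simp: less_eq_complex_def)
  \<comment> \<open>The vector (1, 1) compares the imaginary parts of the two off-diagonal entries,
    the vector (1, \<open>\<i>\<close>) below compares their real parts.\<close>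
  have "0 \<le> qform {i, j} K (\<lambda>_. 1)" by (rule psd_onD[OF P])
  then have 1: "Im (K i j) + Im (K j i) = 0"
    using False d by (auto simp: qform_def less_eq_complex_def)
  have "0 \<le> qform {i, j} K (\<lambda>x. if x = i then 1 else \<i>)" by (rule psd_onD[OF P])
  then have 2: "Re (K i j) - Re (K j i) = 0"
    using False d by (auto simp: qform_def less_eq_complex_def)
  show ?thesis using 1 2 by (simp add: complex_eq_iff)
qed

subsection \<open>Schur complements\<close>

text \<open>Completing the square in the variable \<open>c y\<close>.\<close>

lemma qform_schur_complement:
  assumes F: "finite F" "y \<notin> F" and h: "\<And>i. i \<in> F \<Longrightarrow> K y i = cnj (K i y)"
    and y: "K y y = of_real d" "d \<noteq> 0"
  shows "qform (insert y F) K c =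
    of_real ((cmod (of_real d * c y + (\<Sum>j\<in>F. K y j * c j)))\<^sup>2 / d)
      + qform F (\<lambda>i j. K i j - K i y * K y j / K y y) c"
proof -
  define S where "S = (\<Sum>j\<in>F. K y j * c j)"
  have cS: "cnj S = (\<Sum>i\<in>F. cnj (c i) * K i y)"
    unfolding S_def using h by (simp add: cnj_sum mult.commute)
  have eq1: "qform F (\<lambda>i j. K i j - K i y * K y j / K y y) c = qform F K c - cnj S * S / d"
  proof -
    have "qform F (\<lambda>i j. K i y * K y j / K y y) c = cnj S * S / d"
      unfolding cS unfolding S_def qform_def sum_product sum_divide_distrib y(1)
      by (intro sum.cong refl) (simp add: mult_ac)
    then show ?thesis by (simp add: qform_diff)
  qed
  have eq2: "complex_of_real ((cmod (of_real d * c y + S))\<^sup>2 / d)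
      = (of_real d * c y + S) * cnj (of_real d * c y + S) / d"
    by (simp only: of_real_divide complex_norm_square)
  have "qform (insert y F) K c = cnj (c y) * c y * of_real d + cnj (c y) * S + cnj S * c y + qform F K c"
    unfolding qform_insert[OF F] y(1) cS unfolding S_def
    by (simp add: sum_distrib_left sum_distrib_right mult_ac)
  then show ?thesis
    unfolding S_def[symmetric] eq1 eq2 using y(2) by (simp add: field_simps)
qed

lemma psd_on_schur_complement:
  assumes F: "finite F" "y \<notin> F" and P: "psd_on (insert y F) K" and "K y y \<noteq> 0"
  shows "psd_on F (\<lambda>i j. K i j - K i y * K y j / K y y)"
proof (rule psd_onI)
  fix c
  have d: "0 \<le> K y y" using psd_on_diag_nonneg[OF P] F by simp
  define d where "d = Re (K y y)"
  have yd: "K y y = of_real d" "d \<noteq> 0"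
    using d assms(4) by (auto simp: d_def less_eq_complex_def complex_eq_iff)
  have h: "K y i = cnj (K i y)" if "i \<in> F" for i
    using psd_on_hermitian[OF P, of i y] F that by simp
  \<comment> \<open>This entry at \<open>y\<close> makes the completed square vanish, so the form of
    \<open>K\<close> at \<open>c'\<close> is exactly the form of the Schur complement at
    \<open>c\<close>.\<close>
  define c' where "c' = c(y := - (\<Sum>j\<in>F. K y j * c j) / d)"
  have c': "\<And>j. j \<in> F \<Longrightarrow> c' j = c j" using F by (auto simp: c'_def)
  have "(\<Sum>j\<in>F. K y j * c' j) = (\<Sum>j\<in>F. K y j * c j)" using c' by (intro sum.cong) auto
  then have "of_real d * c' y + (\<Sum>j\<in>F. K y j * c' j) = 0"
    using yd(2) by (simp add: c'_def)
  then have "qform (insert y F) K c' = qform F (\<lambda>i j. K i j - K i y * K y j / K y y) c'"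
    using qform_schur_complement[where K = K, OF F h yd, of c'] by simp
  also have "\<dots> = qform F (\<lambda>i j. K i j - K i y * K y j / K y y) c"
    using c' by (intro qform_cong) auto
  finally show "0 \<le> qform F (\<lambda>i j. K i j - K i y * K y j / K y y) c"
    using psd_onD[OF P, of c'] by simp
qed

lemma psd_on_insertI:
  assumes F: "finite F" "y \<notin> F" and h: "\<And>i. i \<in> F \<Longrightarrow> K y i = cnj (K i y)"
    and y: "0 < K y y" and P: "psd_on F (\<lambda>i j. K i j - K i y * K y j / K y y)"
  shows "psd_on (insert y F) K"
proof (rule psd_onI)
  fix c
  define d where "d = Re (K y y)"
  have yd: "K y y = of_real d" "d > 0"
    using y by (auto simp: d_def less_complex_def complex_eq_iff)
  show "0 \<le> qform (insert y F) K c"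
    using qform_schur_complement[where K = K, OF F h yd(1), of c] psd_onD[OF P, of c] yd(2)
    by (simp add: less_eq_complex_def)
qed

lemma psd_on_zero_diag:
  assumes P: "psd_on F K" and F: "finite F" and y: "y \<in> F" "K y y = 0" and i: "i \<in> F"
  shows "K i y = 0"
proof (cases "i = y")
  case False
  have P2: "psd_on {i, y} K" using assms psd_on_subset[of F K "{i, y}"] by blast
  define r where "r = Re (K i i)"
  have r: "K i i = of_real r" using psd_on_diag_nonneg[OF P F i] by (simp add: r_def less_eq_complex_def complex_eq_iff)
  have h: "K y i = cnj (K i y)" using psd_on_hermitian[OF P F i y(1)] .
  define t where "t = (r + 1) "
  have r0: "r \<ge> 0" using psd_on_diag_nonneg[OF P F i] r by (simp add: less_eq_complex_def)
  \<comment> \<open>At this vector the form is |K i y|^2 (r - 2 t), and \<open>t = r + 1\<close>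
    makes the second factor negative, which forces \<open>K i y = 0\<close>.\<close>
  have "0 \<le> qform {i, y} K (\<lambda>x. if x = i then - K i y else of_real t)" by (rule psd_onD[OF P2])
  also have "qform {i, y} K (\<lambda>x. if x = i then - K i y else of_real t)
     = K i y * cnj (K i y) * of_real (r - 2 * t)"
    using False by (simp add: qform_def y(2) r h algebra_simps)
  also have "\<dots> = of_real ((cmod (K i y))\<^sup>2 * (r - 2 * t))"
    by (simp only: of_real_mult complex_norm_square)
  finally have "0 \<le> (cmod (K i y))\<^sup>2 * (r - 2 * t)" by (simp add: less_eq_complex_def)
  moreover have "r - 2 * t < 0" using r0 by (simp add: t_def)
  ultimately show ?thesis by (simp add: zero_le_mult_iff)
qed (use y in simp)

subsection \<open>Gram decomposition and the Schur product\<close>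

text \<open>Cholesky factorization. A nonzero pivot splits off a rank-one matrix and leaves the
  Schur complement; a zero pivot has a zero row and column and contributes the zero vector.\<close>

lemma psd_on_gram:
  assumes "finite F" "psd_on F K"
  shows "\<exists>v :: 'i \<Rightarrow> 'i \<Rightarrow> complex. \<forall>i\<in>F. \<forall>j\<in>F. K i j = (\<Sum>m\<in>F. v m i * cnj (v m j))"
  using assms
proof (induction F arbitrary: K rule: finite_induct)
  case empty
  then show ?case by simp
next
  case (insert y F)
  have nn: "0 \<le> K y y" using psd_on_diag_nonneg[OF insert.prems] insert.hyps by simp
  have herm: "\<And>i. i \<in> insert y F \<Longrightarrow> K y i = cnj (K i y)"
    by (rule psd_on_hermitian[OF insert.prems]) (use insert.hyps in auto)
  show ?case
  proof (cases "K y y = 0")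
    case True
    have z: "K i y = 0" "K y i = 0" if "i \<in> insert y F" for i
      using psd_on_zero_diag[OF insert.prems _ _ True, of i] herm[OF that] that insert.hyps by auto
    have "psd_on F K" using insert.prems insert.hyps psd_on_subset by blast
    from insert.IH[OF this] obtain v where v: "\<forall>i\<in>F. \<forall>j\<in>F. K i j = (\<Sum>m\<in>F. v m i * cnj (v m j))" by blast
    define w where "w = (\<lambda>m i. if m = y \<or> i = y then 0 else v m i)"
    have "K i j = (\<Sum>m\<in>insert y F. w m i * cnj (w m j))" if "i \<in> insert y F" "j \<in> insert y F" for i j
    proof (cases "i = y \<or> j = y")
      case True
      then show ?thesis using z that by (auto simp: w_def intro!: sum.neutral)
    next
      case False
      then have "K i j = (\<Sum>m\<in>F. v m i * cnj (v m j))" using v that by auto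
      also have "\<dots> = (\<Sum>m\<in>insert y F. w m i * cnj (w m j))"
        using insert.hyps False by (auto simp: w_def intro!: sum.cong)
      finally show ?thesis .
    qed
    then show ?thesis by blast
  next
    case False
    define d where "d = Re (K y y)"
    have d: "K y y = of_real d" "d > 0"
      using nn False by (auto simp: d_def less_eq_complex_def complex_eq_iff)
    from insert.IH[OF psd_on_schur_complement[OF insert.hyps insert.prems False]]
    obtain v where v: "\<forall>i\<in>F. \<forall>j\<in>F. K i j - K i y * K y j / K y y = (\<Sum>m\<in>F. v m i * cnj (v m j))" by blast
    define w where "w = (\<lambda>m i. if m = y then K i y / of_real (sqrt d) else if i = y then 0 else v m i)"
    have "K i j = (\<Sum>m\<in>insert y F. w m i * cnj (w m j))" if "i \<in> insert y F" "j \<in> insert y F" for i j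
    proof -
      have sq: "complex_of_real (sqrt d) * of_real (sqrt d) = of_real d"
        using d(2) by (simp flip: of_real_mult)
      have a: "w y i * cnj (w y j) = K i y * K y j / K y y"
        using herm[OF that(2)] by (simp add: w_def sq d(1))
      have b: "(\<Sum>m\<in>F. w m i * cnj (w m j)) = K i j - K i y * K y j / K y y"
      proof (cases "i = y \<or> j = y")
        case True
        then have "(\<Sum>m\<in>F. w m i * cnj (w m j)) = 0"
          using insert.hyps by (auto simp: w_def intro!: sum.neutral)
        then show ?thesis using True False by auto
      next
        case F: False
        then have "(\<Sum>m\<in>F. w m i * cnj (w m j)) = (\<Sum>m\<in>F. v m i * cnj (v m j))"
          using insert.hyps by (auto simp: w_def intro!: sum.cong)
        then show ?thesis using v F that by auto
      qed
      show ?thesis using insert.hyps a b by simp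
    qed
    then show ?thesis by blast
  qed
qed

text \<open>Writing \<open>A\<close> as a sum of rank-one matrices turns the product into a sum of
  congruences of \<open>B\<close>.\<close>

lemma psd_on_schur_product:
  assumes F: "finite F" and A: "psd_on F A" and B: "psd_on F B"
  shows "psd_on F (\<lambda>i j. A i j * B i j)"
proof -
  obtain v where v: "\<forall>i\<in>F. \<forall>j\<in>F. A i j = (\<Sum>m\<in>F. v m i * cnj (v m j))"
    using psd_on_gram[OF F A] by blast
  have "psd_on F (\<lambda>i j. \<Sum>m\<in>F. v m i * cnj (v m j) * B i j)"
    by (intro psd_on_sum psd_on_congruence B)
  then show ?thesis
    by (rule iffD1[OF psd_on_cong, rotated]) (use v in \<open>simp add: sum_distrib_right\<close>)
qed

lemma psd_on_limit:
  assumes F: "finite F" and P: "\<And>n. psd_on F (A n)"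
    and lim: "\<And>i j. i \<in> F \<Longrightarrow> j \<in> F \<Longrightarrow> (\<lambda>n::nat. A n i j) \<longlonglongrightarrow> K i j"
  shows "psd_on F K"
proof (rule psd_onI)
  fix c
  have "(\<lambda>n. qform F (A n) c) \<longlonglongrightarrow> qform F K c"
    unfolding qform_def by (intro tendsto_intros lim) auto
  then have "(\<lambda>n. Re (qform F (A n) c)) \<longlonglongrightarrow> Re (qform F K c)"
      "(\<lambda>n. Im (qform F (A n) c)) \<longlonglongrightarrow> Im (qform F K c)"
    by (auto intro: tendsto_intros)
  moreover have "0 \<le> Re (qform F (A n) c)" "Im (qform F (A n) c) = 0" for n
    using psd_onD[OF P, of n c] by (auto simp: less_eq_complex_def)
  ultimately have "0 \<le> Re (qform F K c)" "Im (qform F K c) = 0"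
    by (auto intro: LIMSEQ_le_const simp: LIMSEQ_const_iff)
  then show "0 \<le> qform F K c" by (simp add: less_eq_complex_def)
qed

text \<open>Geometric series: the entrywise powers are positive by the Schur product theorem, and
  positivity survives the entrywise limit.\<close>

lemma psd_on_inverse_one_minus:
  assumes F: "finite F" and P: "psd_on F \<kappa>" and lt: "\<And>i j. i \<in> F \<Longrightarrow> j \<in> F \<Longrightarrow> cmod (\<kappa> i j) < 1"
  shows "psd_on F (\<lambda>i j. 1 / (1 - \<kappa> i j))"
proof (rule psd_on_limit[OF F])
  fix n :: nat
  have "psd_on F (\<lambda>i j. \<kappa> i j ^ m)" for m :: nat
  proof (induction m)
    case 0
    show ?case using psd_on_rank1[of F "\<lambda>_. 1"] by simp
  next
    case (Suc m)
    show ?case using psd_on_schur_product[OF F P Suc] by simp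
  qed
  then show "psd_on F (\<lambda>i j. \<Sum>m<n. \<kappa> i j ^ m)" by (intro psd_on_sum)
next
  fix i j assume "i \<in> F" "j \<in> F"
  then show "(\<lambda>n. \<Sum>m<n. \<kappa> i j ^ m) \<longlonglongrightarrow> 1 / (1 - \<kappa> i j)"
    using geometric_sums[OF lt] by (simp add: sums_def)
qed

subsection \<open>The Cauchy--Schwarz inequality\<close>

definition sform :: "'i set \<Rightarrow> ('i \<Rightarrow> 'i \<Rightarrow> complex) \<Rightarrow> ('i \<Rightarrow> complex) \<Rightarrow> ('i \<Rightarrow> complex) \<Rightarrow> complex" where
  "sform F K d c = (\<Sum>i\<in>F. \<Sum>j\<in>F. cnj (d i) * c j * K i j)"

text \<open>The Gram decomposition turns the form into the inner product of the vectors
  \<open>T d\<close> and \<open>T c\<close>, which reduces the claim to the inequality for finite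
  sums.\<close>

lemma cauchy_schwarz_psd_on:
  assumes F: "finite F" and P: "psd_on F K"
  shows "(cmod (sform F K d c))\<^sup>2 \<le> Re (qform F K d) * Re (qform F K c)"
proof -
  obtain v where v: "\<forall>i\<in>F. \<forall>j\<in>F. K i j = (\<Sum>m\<in>F. v m i * cnj (v m j))"
    using psd_on_gram[OF F P] by blast
  define T where "T e m = (\<Sum>i\<in>F. cnj (e i) * v m i)" for e m
  have s: "sform F K e c = (\<Sum>m\<in>F. T e m * cnj (T c m))" for e c
  proof -
    have "sform F K e c = (\<Sum>i\<in>F. \<Sum>j\<in>F. \<Sum>m\<in>F. cnj (e i) * v m i * (c j * cnj (v m j)))"
      unfolding sform_def using v by (intro sum.cong refl) (simp add: sum_distrib_left mult_ac)
    also have "\<dots> = (\<Sum>i\<in>F. \<Sum>m\<in>F. \<Sum>j\<in>F. cnj (e i) * v m i * (c j * cnj (v m j)))"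
      by (intro sum.cong refl sum.swap)
    also have "\<dots> = (\<Sum>m\<in>F. \<Sum>i\<in>F. \<Sum>j\<in>F. cnj (e i) * v m i * (c j * cnj (v m j)))"
      by (rule sum.swap)
    also have "\<dots> = (\<Sum>m\<in>F. T e m * cnj (T c m))"
      unfolding T_def by (simp add: sum_product cnj_sum)
    finally show ?thesis .
  qed
  have q: "Re (qform F K e) = (\<Sum>m\<in>F. (cmod (T e m))\<^sup>2)" for e
  proof -
    have "qform F K e = (\<Sum>m\<in>F. T e m * cnj (T e m))" using s[of e e] by (simp add: qform_def sform_def)
    also have "\<dots> = of_real (\<Sum>m\<in>F. (cmod (T e m))\<^sup>2)" by (simp only: complex_norm_square of_real_sum)
    finally show ?thesis by simp
  qed
  have "cmod (sform F K d c) \<le> (\<Sum>m\<in>F. cmod (T d m) * cmod (T c m))"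
    unfolding s by (rule order_trans[OF norm_sum]) (simp add: norm_mult)
  then have "(cmod (sform F K d c))\<^sup>2 \<le> (\<Sum>m\<in>F. cmod (T d m) * cmod (T c m))\<^sup>2"
    by (rule power_mono) simp
  also have "\<dots> \<le> (\<Sum>m\<in>F. (cmod (T d m))\<^sup>2) * (\<Sum>m\<in>F. (cmod (T c m))\<^sup>2)"
    by (rule Cauchy_Schwarz_ineq_sum)
  finally show ?thesis by (simp add: q)
qed

lemma cauchy_schwarz_entries:
  assumes F: "finite F" and P: "psd_on F K" and "i \<in> F" "j \<in> F"
  shows "(cmod (K i j))\<^sup>2 \<le> Re (K i i) * Re (K j j)"
proof -
  have *: "sform F K (\<lambda>x. if x = a then 1 else 0) (\<lambda>x. if x = b then 1 else 0) = K a b"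
    if "a \<in> F" "b \<in> F" for a b
    using F that by (simp add: sform_def if_distrib[of cnj] if_distrib[of "\<lambda>x. x * _"] if_distrib[of "\<lambda>x. _ * x"] cong: if_cong)
  have "qform F K (\<lambda>x. if x = a then 1 else 0) = K a a" if "a \<in> F" for a
    using *[OF that that] by (simp add: sform_def qform_def)
  then show ?thesis
    using cauchy_schwarz_psd_on[OF F P, of "\<lambda>x. if x = i then 1 else 0" "\<lambda>x. if x = j then 1 else 0"] * assms
    by simp
qed

text \<open>The Schur complement with the pivot multiplied in. It makes sense for a zero pivot and
  on a set containing \<open>y\<close>, where the row and the column of \<open>y\<close> become
  zero.\<close>

lemma psd_on_schur_complement_kernel:
  assumes F: "finite F" and P: "psd_on F K" and y: "y \<in> F"
  shows "psd_on F (\<lambda>i j. K y y * K i j - K i y * K y j)"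
proof (cases "K y y = 0")
  case True
  have "K i y = 0" if "i \<in> F" for i using psd_on_zero_diag[OF P F y True that] .
  then have "psd_on F (\<lambda>i j. K y y * K i j - K i y * K y j) \<longleftrightarrow> psd_on F (\<lambda>i j. 0)"
    by (intro psd_on_cong) (simp add: True)
  then show ?thesis by (simp add: psd_on_zero)
next
  case False
  have nn: "0 \<le> K y y" by (rule psd_on_diag_nonneg[OF P F y])
  have "psd_on (F - {y}) (\<lambda>i j. K i j - K i y * K y j / K y y)"
    using psd_on_schur_complement[of "F - {y}" y K] F P False y by (simp add: insert_absorb)
  then have "psd_on F (\<lambda>i j. K i j - K i y * K y j / K y y)"
    by (rule psd_on_support[OF _ F]) (use False in auto)
  then have "psd_on F (\<lambda>i j. K y y * (K i j - K i y * K y j / K y y))"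
    by (rule psd_on_scale[OF nn])
  then show ?thesis using False by (simp add: algebra_simps)
qed

text \<open>In operator terms, H <= C implies H^2 <= C H. Cauchy-Schwarz for the form of
  \<open>H\<close> is applied to the vectors H x and x; then H <= C is used at H x, and one factor,
  the squared norm of H x, is cancelled.\<close>

lemma psd_on_column_bound:
  assumes F: "finite F" and P: "psd_on F H" and C: "psd_on F (\<lambda>i j. (if i = j then of_real C else 0) - H i j)"
  shows "(\<Sum>i\<in>F. (cmod (\<Sum>j\<in>F. H i j * x j))\<^sup>2) \<le> C * Re (qform F H x)"
proof -
  define y where "y i = (\<Sum>j\<in>F. H i j * x j)" for i
  define T where "T = (\<Sum>i\<in>F. (cmod (y i))\<^sup>2)"
  have T0: "T \<ge> 0" by (simp add: T_def sum_nonneg)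
  have q0: "Re (qform F H x) \<ge> 0" using psd_onD[OF P, of x] by (simp add: less_eq_complex_def)
  have "sform F H y x = (\<Sum>i\<in>F. cnj (y i) * y i)"
    unfolding sform_def by (intro sum.cong refl, subst (2) y_def) (simp add: sum_distrib_left mult_ac)
  also have "\<dots> = of_real T" by (simp only: T_def complex_norm_square of_real_sum mult.commute)
  finally have "T\<^sup>2 \<le> Re (qform F H y) * Re (qform F H x)"
    using cauchy_schwarz_psd_on[OF F P, of y x] T0 by simp
  also have "Re (qform F H y) \<le> C * T"
  proof -
    have "0 \<le> (\<Sum>i\<in>F. of_real ((cmod (y i))\<^sup>2) * of_real C) - qform F H y"
      using psd_onD[OF C, of y] by (simp add: qform_diff qform_diag[OF F])
    also have "(\<Sum>i\<in>F. of_real ((cmod (y i))\<^sup>2) * of_real C) = complex_of_real (C * T)"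
      by (simp add: T_def sum_distrib_left mult_ac)
    finally show ?thesis by (simp add: less_eq_complex_def)
  qed
  then have "Re (qform F H y) * Re (qform F H x) \<le> C * T * Re (qform F H x)"
    using q0 by (rule mult_right_mono)
  finally have "T * T \<le> T * (C * Re (qform F H x))" by (simp add: power2_eq_square mult_ac)
  show ?thesis
  proof (cases "T = 0")
    case False
    then have "T > 0" using T0 by simp
    then show ?thesis using \<open>T * T \<le> _\<close> by (simp add: T_def y_def)
  next
    case True
    have "0 \<le> C * Re (qform F H x)"
    proof (cases "F = {}")
      case True then show ?thesis by (simp add: qform_def)
    next
      case False
      then obtain i where "i \<in> F" by blast
      then have "0 \<le> H i i" "0 \<le> of_real C - H i i"
        using psd_on_diag_nonneg[OF P F] psd_on_diag_nonneg[OF C F] by auto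
      then have "C \<ge> 0" by (simp add: less_eq_complex_def)
      then show ?thesis using q0 by simp
    qed
    then show ?thesis using True by (simp add: T_def y_def)
  qed
qed

subsection \<open>Change of index set\<close>

lemma sum_aggregate:
  fixes a h :: "_ \<Rightarrow> complex"
  assumes "finite I"
  shows "(\<Sum>i\<in>I. a i * h (x i)) = (\<Sum>y\<in>x ` I. (\<Sum>i\<in>{i\<in>I. x i = y}. a i) * h y)"
  using sum.image_gen[OF assms, of "\<lambda>i. a i * h (x i)" x]
  by (simp add: sum_distrib_right)

lemma qform_pullback:
  assumes "finite I"
  shows "qform I (\<lambda>i j. K (x i) (x j)) c = qform (x ` I) K (\<lambda>y. \<Sum>i\<in>{i\<in>I. x i = y}. c i)"
proof -
  let ?C = "\<lambda>y. \<Sum>i\<in>{i\<in>I. x i = y}. c i"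
  have "qform I (\<lambda>i j. K (x i) (x j)) c = (\<Sum>i\<in>I. cnj (c i) * (\<Sum>j\<in>I. c j * K (x i) (x j)))"
    by (simp add: qform_def sum_distrib_left mult_ac)
  also have "\<dots> = (\<Sum>i\<in>I. cnj (c i) * (\<Sum>y\<in>x`I. ?C y * K (x i) y))"
    by (simp only: sum_aggregate[OF assms])
  also have "\<dots> = (\<Sum>z\<in>x`I. (\<Sum>i\<in>{i\<in>I. x i = z}. cnj (c i)) * (\<Sum>y\<in>x`I. ?C y * K z y))"
    by (rule sum_aggregate[OF assms, of "\<lambda>i. cnj (c i)" "\<lambda>z. (\<Sum>y\<in>x`I. ?C y * K z y)" x])
  also have "\<dots> = qform (x ` I) K ?C"
    unfolding qform_def cnj_sum by (intro sum.cong refl) (simp only: sum_distrib_left[of _ _ "x ` I"] mult.assoc)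
  finally show ?thesis .
qed

lemma psd_on_pullback: "finite I \<Longrightarrow> psd_on (x ` I) K \<Longrightarrow> psd_on I (\<lambda>i j. K (x i) (x j))"
  by (simp add: psd_on_def qform_pullback)

lemma qform_reindex:
  assumes "inj_on x I"
  shows "qform (x ` I) K c = qform I (\<lambda>i j. K (x i) (x j)) (c \<circ> x)"
  by (simp add: qform_def sum.reindex[OF assms])

subsection \<open>Completing one missing entry\<close>

text \<open>Induction on the common part \<open>Y\<close>: a Schur complement at one common point
  removes that point and leaves the missing entry free. Once no common point remains, the entry 0
  works.\<close>

lemma psd_on_completion:
  assumes "finite Y" "a \<noteq> b" "a \<notin> Y" "b \<notin> Y"
    and "psd_on (insert a Y) K" "psd_on (insert b Y) K"
  shows "\<exists>z. psd_on (insert a (insert b Y)) (\<lambda>i j. if i = a \<and> j = b then z else if i = b \<and> j = a then cnj z else K i j)"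
  using assms
proof (induction Y arbitrary: K rule: finite_induct)
  case empty
  let ?K = "\<lambda>i j. if i = a \<and> j = b then 0 else if i = b \<and> j = a then cnj 0 else K i j"
  have d: "0 \<le> K a a" "0 \<le> K b b" using psd_on_diag_nonneg[OF empty.prems(4)] psd_on_diag_nonneg[OF empty.prems(5)] by auto
  have "psd_on {a, b} (\<lambda>i j. if i = j then K i i else 0)"
    by (rule psd_on_diag) (use d in auto)
  then have "psd_on {a, b} ?K"
    by (rule iffD1[OF psd_on_cong, rotated]) (use empty.prems in auto)
  then show ?case by blast
next
  case (insert y Y)
  let ?A = "insert a (insert y Y)" and ?B = "insert b (insert y Y)"
  have y: "y \<noteq> a" "y \<noteq> b" "y \<notin> insert a (insert b Y)" using insert by auto
  have nn: "0 \<le> K y y" using psd_on_diag_nonneg[OF insert.prems(4)] insert.hyps by simp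
  have herm: "K y i = cnj (K i y)" if "i \<in> insert a (insert b Y)" for i
    using psd_on_hermitian[OF insert.prems(4), of i y] psd_on_hermitian[OF insert.prems(5), of i y] that insert.hyps by auto
  have PA: "psd_on (insert y (insert a Y)) K" and PB: "psd_on (insert y (insert b Y)) K"
    using insert.prems(4,5) by (simp_all add: insert_commute)
  have comp: "insert a (insert b (insert y Y)) = insert y (insert a (insert b Y))" by blast
  show ?case
  proof (cases "K y y = 0")
    case True
    have z: "K i y = 0" if "i \<in> insert y (insert a (insert b Y))" for i
      using psd_on_zero_diag[OF PA _ _ True, of i] psd_on_zero_diag[OF PB _ _ True, of i] that insert.hyps by auto
    have "psd_on (insert a Y) K" "psd_on (insert b Y) K"
      using psd_on_subset[OF PA] psd_on_subset[OF PB] insert.hyps by blast+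
    from insert.IH[OF insert.prems(1) _ _ this] insert.prems obtain z where
      P: "psd_on (insert a (insert b Y)) (\<lambda>i j. if i = a \<and> j = b then z else if i = b \<and> j = a then cnj z else K i j)"
      by auto
    have "psd_on (insert a (insert b (insert y Y))) (\<lambda>i j. if i = a \<and> j = b then z else if i = b \<and> j = a then cnj z else K i j)"
      by (rule psd_on_support[OF P])
         (use y insert.hyps z herm True in auto)
    then show ?thesis by blast
  next
    case False
    then have pos: "0 < K y y" using nn by (simp add: less_eq_complex_def less_complex_def complex_eq_iff)
    define S where "S = (\<lambda>i j. K i j - K i y * K y j / K y y)"
    have "psd_on (insert a Y) S" "psd_on (insert b Y) S"
      unfolding S_def
      using psd_on_schur_complement[OF _ _ PA False] psd_on_schur_complement[OF _ _ PB False] y insert.hyps by auto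
    from insert.IH[OF insert.prems(1) _ _ this] insert.prems obtain z where
      P: "psd_on (insert a (insert b Y)) (\<lambda>i j. if i = a \<and> j = b then z else if i = b \<and> j = a then cnj z else S i j)"
      by auto
    \<comment> \<open>The entry found for the Schur complement is carried back by adding the
      rank-one term that was subtracted.\<close>
    define z' where "z' = z + K a y * K y b / K y y"
    have cz: "cnj z' = cnj z + K b y * K y a / K y y"
    proof -
      have "cnj (K y y) = K y y" using nn by (simp add: less_eq_complex_def complex_eq_iff)
      then show ?thesis using herm by (simp add: z'_def mult.commute)
    qed
    define K' where "K' = (\<lambda>i j. if i = a \<and> j = b then z' else if i = b \<and> j = a then cnj z' else K i j)"
    have "psd_on (insert y (insert a (insert b Y))) K'"
    proof (rule psd_on_insertI)
      show "K' y i = cnj (K' i y)" if "i \<in> insert a (insert b Y)" for i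
        using herm[OF that] y by (simp add: K'_def)
      show "psd_on (insert a (insert b Y)) (\<lambda>i j. K' i j - K' i y * K' y j / K' y y)"
        by (rule iffD1[OF psd_on_cong P]) (use y cz in \<open>auto simp: K'_def S_def z'_def\<close>)
    qed (use y insert.hyps pos in \<open>auto simp: K'_def\<close>)
    then show ?thesis unfolding K'_def comp by blast
  qed
qed

section \<open>Complete Pick kernels\<close>

text \<open>The map z -> 1 / (1 - z) sends the unit disc into the half-plane Re > 1/2. This is the
  source of the positive real parts of \<open>2 * s i k - 1\<close> and of the positive entries of
  Re H.\<close>

lemma Re_inverse_one_minus:
  assumes "cmod z < 1"
  shows "Re (1 / (1 - z)) > 1 / 2"
proof -
  have z: "z \<noteq> 1" using assms by auto
  have n: "(cmod z)\<^sup>2 < 1" using assms by (simp add: power_less_one_iff)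
  define N where "N = (1 - Re z)\<^sup>2 + (Im z)\<^sup>2"
  have N: "N > 0" using z unfolding N_def by (auto simp: complex_eq_iff sum_power2_gt_zero_iff)
  have "Re (1 / (1 - z)) = (1 - Re z) / N"
    by (simp add: Re_divide N_def)
  moreover
  have "N < 2 * (1 - Re z)"
    using n unfolding N_def cmod_power2 by (simp add: power2_eq_square algebra_simps)
  then have "1 / 2 < (1 - Re z) / N" using N by (simp add: field_simps)
  ultimately show ?thesis by simp
qed

text \<open>Here \<open>\<beta>\<close> stands for the Gram kernel of the map into the ball; the
  auxiliary Hilbert space enters only through the positivity of this kernel and its
  diagonal.\<close>

locale pick_kernel =
  fixes \<beta> s :: "'a \<Rightarrow> 'a \<Rightarrow> complex"
  assumes psd_\<beta>: "finite F \<Longrightarrow> psd_on F \<beta>"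
    and \<beta>_diag: "Re (\<beta> z z) < 1"
    and s_eq: "s z w = 1 / (1 - \<beta> z w)"
begin

lemma norm_\<beta>: "cmod (\<beta> z w) < 1"
proof -
  have nn: "0 \<le> Re (\<beta> z z)" for z
    using psd_on_diag_nonneg[OF psd_\<beta>[of "{z}"]] by (simp add: less_eq_complex_def)
  have "(cmod (\<beta> z w))\<^sup>2 \<le> Re (\<beta> z z) * Re (\<beta> w w)"
    using cauchy_schwarz_entries[OF _ psd_\<beta>, of "{z, w}" z w] by simp
  also have "\<dots> < 1" using nn \<beta>_diag by (metis mult.right_neutral mult_le_less_imp_less
    less_eq_real_def mult_less_cancel_left_disj mult_zero_left zero_less_one le_less_trans mult_left_mono)
  finally show ?thesis by (simp add: power_less_one_iff)
qed

lemma \<beta>_neq_1: "\<beta> z w \<noteq> 1"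
  using norm_\<beta>[of z w] by auto

lemma s_nonzero: "s z w \<noteq> 0"
  using \<beta>_neq_1[of z w] by (simp add: s_eq)

lemma Re_s: "Re (s z w) > 1 / 2"
  using Re_inverse_one_minus[OF norm_\<beta>] by (simp add: s_eq)

lemma psd_s: "finite F \<Longrightarrow> psd_on F s"
  using psd_on_inverse_one_minus[OF _ psd_\<beta>, of F] norm_\<beta> by (simp add: s_eq[abs_def])

lemma s_cnj: "cnj (s z w) = s w z"
  using psd_on_hermitian[OF psd_s[of "{z, w}"], of z w] by simp

lemma \<beta>_cnj: "cnj (\<beta> z w) = \<beta> w z"
  using psd_on_hermitian[OF psd_\<beta>[of "{z, w}"], of z w] by simp

lemma s_diag: "s z z = of_real (Re (s z z))"
  using psd_on_diag_nonneg[OF psd_s[of "{z}"]] by (simp add: less_eq_complex_def complex_eq_iff)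

lemma s_diag_pos: "Re (s z z) > 0"
  using Re_s[of z z] by simp

lemma \<beta>_diag_real: "\<beta> z z = of_real (Re (\<beta> z z))"
  using psd_on_diag_nonneg[OF psd_\<beta>[of "{z}"]] by (simp add: less_eq_complex_def complex_eq_iff)

text \<open>The kernel of the row multiplier given by a ball automorphism that moves \<open>y\<close> to the origin.\<close>

definition \<kappa> :: "'a \<Rightarrow> 'a \<Rightarrow> 'a \<Rightarrow> complex" where
  "\<kappa> y i j = 1 - s i y * s y j / (s y y * s i j)"

lemma \<kappa>_left [simp]: "\<kappa> y y j = 0" and \<kappa>_right [simp]: "\<kappa> y i y = 0"
  using s_nonzero by (simp_all add: \<kappa>_def)

lemma psd_\<kappa>:
  assumes F: "finite F"
  shows "psd_on F (\<kappa> y)"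
proof -
  define t where "t = Re (\<beta> y y)"
  have t: "\<beta> y y = of_real t" "t < 1" "t \<ge> 0"
    using \<beta>_diag_real[of y] \<beta>_diag[of y] psd_on_diag_nonneg[OF psd_\<beta>[of "{y}"], of y]
    by (auto simp: t_def less_eq_complex_def)
  obtain v where v: "\<forall>i\<in>insert y F. \<forall>j\<in>insert y F. \<beta> i j = (\<Sum>m\<in>insert y F. v m i * cnj (v m j))"
    using psd_on_gram[OF _ psd_\<beta>, of "insert y F"] F by auto
  \<comment> \<open>Gram matrix of the differences between the vectors representing
    \<open>\<beta>\<close> and the one at \<open>y\<close>. Together with the rank-one term below it
    yields the inner products of the images under the ball automorphism, without the projection onto
    the vector at \<open>y\<close>, which would require dividing by \<open>t\<close>.\<close>
  define D where "D = (\<lambda>i j. \<Sum>m\<in>insert y F. (v m i - v m y) * cnj (v m j - v m y))"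
  have D: "D i j = \<beta> i j - \<beta> i y - \<beta> y j + \<beta> y y" if "i \<in> F" "j \<in> F" for i j
    using v that by (simp add: D_def algebra_simps sum.distrib sum_subtractf)
  have "psd_on F (\<lambda>i j. of_real (1 - t) * D i j + (\<beta> i y - of_real t) * cnj (\<beta> j y - of_real t))"
    unfolding D_def using t
    by (intro psd_on_add psd_on_rank1 psd_on_scale psd_on_sum) (auto simp: less_eq_complex_def)
  then have P: "psd_on F (\<lambda>i j. s i y * cnj (s j y) *
      (of_real (1 - t) * D i j + (\<beta> i y - of_real t) * cnj (\<beta> j y - of_real t)))"
    by (rule psd_on_congruence)
  show ?thesis
  proof (rule iffD1[OF psd_on_cong P])
    fix i j assume ij: "i \<in> F" "j \<in> F"
    have nz: "1 - \<beta> i y \<noteq> 0" "1 - \<beta> y j \<noteq> 0" "1 - \<beta> i j \<noteq> 0" "1 - complex_of_real t \<noteq> 0"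
      using \<beta>_neq_1[of i y] \<beta>_neq_1[of y j] \<beta>_neq_1[of i j] \<beta>_neq_1[of y y] t(1) by auto
    have identity: "1 / a * (1 / b) * (d * ((1 - c) - (1 - a) - (1 - b) + (1 - d)) + ((1 - a) - (1 - d)) * ((1 - b) - (1 - d)))
        = 1 - 1 / a * (1 / b) / (1 / d * (1 / c))"
      if "a \<noteq> 0" "b \<noteq> 0" "c \<noteq> 0" "d \<noteq> 0" for a b c d :: complex
      using that by (simp add: field_simps)
    show "s i y * cnj (s j y) *
      (of_real (1 - t) * D i j + (\<beta> i y - of_real t) * cnj (\<beta> j y - of_real t)) = \<kappa> y i j"
      unfolding D[OF ij] \<kappa>_def s_cnj unfolding s_eq t(1) using identity[OF nz]
      by (simp add: \<beta>_cnj)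
  qed
qed

text \<open>Think of \<open>Q i j\<close> as Phi(i) Phi(j)* for an operator-valued function Phi. The
  first condition provides such a factorization, the second says that Phi acts as a contractive
  multiplier over \<open>s\<close> on \<open>F\<close>.\<close>

definition contractive :: "'a set \<Rightarrow> ('a \<Rightarrow> 'a \<Rightarrow> complex) \<Rightarrow> bool" where
  "contractive F Q \<longleftrightarrow> psd_on F Q \<and> psd_on F (\<lambda>i j. (1 - Q i j) * s i j)"

lemma contractive_one: "contractive F (\<lambda>i j. 1)"
  using psd_on_rank1[of F "\<lambda>_. 1"] psd_on_zero[of F] by (simp add: contractive_def)

lemma contractive_mult:
  assumes F: "finite F" and "contractive F Q" "contractive F R"
  shows "contractive F (\<lambda>i j. Q i j * R i j)"
proof -
  have Q: "psd_on F Q" "psd_on F (\<lambda>i j. (1 - Q i j) * s i j)"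
    and R: "psd_on F R" "psd_on F (\<lambda>i j. (1 - R i j) * s i j)"
    using assms by (auto simp: contractive_def)
  \<comment> \<open>Telescoping: (1 - Q R) s = (1 - Q) s + Q (1 - R) s.\<close>
  have "psd_on F (\<lambda>i j. (1 - Q i j) * s i j + Q i j * ((1 - R i j) * s i j))"
    by (rule psd_on_add[OF Q(2) psd_on_schur_product[OF F Q(1) R(2)]])
  moreover have "psd_on F (\<lambda>i j. Q i j * R i j)"
    by (rule psd_on_schur_product[OF F Q(1) R(1)])
  ultimately show ?thesis by (simp add: contractive_def algebra_simps)
qed

lemma contractive_prod:
  assumes F: "finite F" and "finite A" and "\<And>y. y \<in> A \<Longrightarrow> contractive F (Q y)"
  shows "contractive F (\<lambda>i j. \<Prod>y\<in>A. Q y i j)"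
  using assms(2,3)
  by (induction A rule: finite_induct) (simp_all add: contractive_one contractive_mult[OF F])

text \<open>The defect (1 - \<open>\<kappa> y\<close>) s is the rank-one kernel
  \<open>s i y * s y j / s y y\<close>.\<close>

lemma contractive_\<kappa>: 
  assumes F: "finite F"
  shows "contractive F (\<kappa> y)"
proof -
  have "psd_on F (\<lambda>i j. 1 / s y y * (s i y * cnj (s j y)))"
    using s_diag_pos[of y] by (subst s_diag) (intro psd_on_scale psd_on_rank1, simp add: less_eq_complex_def)
  then have "psd_on F (\<lambda>i j. (1 - \<kappa> y i j) * s i j)"
    by (rule iffD1[OF psd_on_cong, rotated]) (use s_nonzero in \<open>simp add: \<kappa>_def s_cnj\<close>)
  then show ?thesis using psd_\<kappa>[OF F] by (simp add: contractive_def)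
qed

subsection \<open>Rows of multipliers from a Carleson condition\<close>

definition nrm :: "'a \<Rightarrow> real" where "nrm z = sqrt (Re (s z z))"

lemma nrm_pos: "nrm z > 0" using s_diag_pos by (simp add: nrm_def)

lemma nrm_square: "complex_of_real (nrm z) * of_real (nrm z) = s z z"
  using s_diag_pos[of z] by (subst s_diag) (simp add: nrm_def flip: of_real_mult)

definition H :: "'a \<Rightarrow> 'a \<Rightarrow> complex" where
  "H i j = s i j / (of_real (nrm i) * of_real (nrm j))"

lemma H_diag: "H i i = 1"
  using s_nonzero by (simp add: H_def nrm_square)

lemma H_cnj: "cnj (H i j) = H j i"
  by (simp add: H_def s_cnj mult.commute)

lemma psd_H: "finite F \<Longrightarrow> psd_on F H"
proof -
  assume F: "finite F"
  have "psd_on F (\<lambda>i j. (1 / of_real (nrm i)) * cnj (1 / of_real (nrm j)) * s i j)"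
    by (intro psd_on_congruence psd_s F)
  then show ?thesis
    by (rule iffD1[OF psd_on_cong, rotated]) (simp add: H_def)
qed

text \<open>The diagonal value is the squared pseudo-hyperbolic distance between \<open>i\<close>
  and \<open>y\<close>; products of these kernels at a point are thereby controlled by a row of
  \<open>H\<close>.\<close>

lemma \<kappa>_diag: "\<kappa> y i i = of_real (1 - (cmod (H i y))\<^sup>2)"
proof -
  have "complex_of_real ((cmod (H i y))\<^sup>2) = H i y * H y i"
    by (simp only: complex_norm_square H_cnj)
  also have "\<dots> = s i y * s y i / (s y y * s i i)"
    unfolding H_def nrm_square[symmetric] by (simp add: mult_ac)
  finally show ?thesis by (simp add: \<kappa>_def)
qed

end

text \<open>Truncating the Neumann series of \<open>(2C - K)\<close> at a late stage gives a Schur test vector.\<close>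

lemma schur_test_vector:
  fixes K :: "'i \<Rightarrow> 'i \<Rightarrow> real"
  assumes F: "finite F" and C: "C > 0" and K: "\<And>i j. i \<in> F \<Longrightarrow> j \<in> F \<Longrightarrow> K i j \<ge> 0"
    and bd: "\<And>x. (\<Sum>i\<in>F. (\<Sum>j\<in>F. K i j * x j)\<^sup>2) \<le> C\<^sup>2 * (\<Sum>i\<in>F. (x i)\<^sup>2)"
  shows "\<exists>v. (\<forall>i\<in>F. v i \<ge> 1) \<and> (\<forall>i\<in>F. (\<Sum>j\<in>F. K i j * v j) \<le> 2 * C * v i)"
proof -
  define T where "T x = (\<lambda>i. (\<Sum>j\<in>F. K i j * x j) / (2 * C))" for x
  define u where "u m = (T ^^ m) (\<lambda>_. 1)" for m
  have u0: "u 0 i = 1" for i by (simp add: u_def)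
  have uS: "u (Suc m) i = (\<Sum>j\<in>F. K i j * u m j) / (2 * C)" for m i by (simp add: u_def T_def)
  have nn: "i \<in> F \<Longrightarrow> u m i \<ge> 0" for m i
  proof (induction m arbitrary: i)
    case (Suc m)
    then show ?case unfolding uS using C K by (intro divide_nonneg_nonneg sum_nonneg mult_nonneg_nonneg) auto
  qed (simp add: u0)
  have sq: "(\<Sum>i\<in>F. (u m i)\<^sup>2) \<le> (1 / 4) ^ m * card F" for m
  proof (induction m)
    case (Suc m)
    have "(\<Sum>i\<in>F. (u (Suc m) i)\<^sup>2) = (\<Sum>i\<in>F. (\<Sum>j\<in>F. K i j * u m j)\<^sup>2) / (2 * C)\<^sup>2"
      by (simp add: uS power_divide flip: sum_divide_distrib)
    also have "\<dots> \<le> (C\<^sup>2 * (\<Sum>i\<in>F. (u m i)\<^sup>2)) / (2 * C)\<^sup>2"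
      by (intro divide_right_mono bd) simp
    also have "\<dots> = (\<Sum>i\<in>F. (u m i)\<^sup>2) / 4" using C by (simp add: power_mult_distrib)
    also have "\<dots> \<le> (1 / 4) ^ Suc m * card F" using Suc by simp
    finally show ?case .
  qed (simp add: u0)
  \<comment> \<open>The map \<open>T\<close> has Euclidean norm at most 1/2, so the iterates tend to
    zero. The truncation stops where the next iterate is at most 1 at every point.\<close>
  have "(\<lambda>m. (1 / 4 :: real) ^ m * card F) \<longlonglongrightarrow> 0"
    by (intro tendsto_mult_left_zero LIMSEQ_power_zero) simp
  then obtain M0 where "\<forall>m\<ge>M0. norm ((1 / 4 :: real) ^ m * card F - 0) < 1"
    using LIMSEQ_D zero_less_one by blast
  then have M0: "(1 / 4 :: real) ^ Suc M0 * card F < 1" by (metis abs_le_D1 diff_zero le_SucI le_less_trans order_refl real_norm_def)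
  have small: "u (Suc M0) i \<le> 1" if "i \<in> F" for i
  proof -
    have "(u (Suc M0) i)\<^sup>2 \<le> (\<Sum>i\<in>F. (u (Suc M0) i)\<^sup>2)"
      using that F by (intro member_le_sum) auto
    also have "\<dots> \<le> 1" using sq[of "Suc M0"] M0 by simp
    finally show ?thesis using nn[OF that] by (simp add: power_le_one_iff)
  qed
  define v where "v i = (\<Sum>m\<le>M0. u m i)" for i
  have "v i \<ge> 1" if "i \<in> F" for i
  proof -
    have "u 0 i \<le> v i" unfolding v_def using nn that by (intro member_le_sum) auto
    then show ?thesis by (simp add: u0)
  qed
  moreover have "(\<Sum>j\<in>F. K i j * v j) \<le> 2 * C * v i" if "i \<in> F" for i
  proof -
    have "(\<Sum>j\<in>F. K i j * v j) = (\<Sum>m\<le>M0. \<Sum>j\<in>F. K i j * u m j)"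
      unfolding v_def sum_distrib_left by (rule sum.swap)
    also have "\<dots> = (\<Sum>m\<le>M0. 2 * C * u (Suc m) i)" using C by (simp add: uS)
    also have "\<dots> = 2 * C * (\<Sum>m\<le>M0. u (Suc m) i)" by (simp add: sum_distrib_left)
    \<comment> \<open>The shift drops \<open>u 0\<close>, which is 1, and gains an iterate that is
      at most 1, so truncation does not spoil the inequality.\<close>
    also have "(\<Sum>m\<le>M0. u (Suc m) i) = v i + u (Suc M0) i - 1"
      using sum.atMost_Suc_shift[of "\<lambda>m. u m i" M0] by (simp add: v_def u0)
    also have "2 * C * (v i + u (Suc M0) i - 1) \<le> 2 * C * v i"
      using small[OF that] C by simp
    finally show ?thesis .
  qed
  ultimately show ?thesis by blast
qed

text \<open>The Cayley transform \<open>\<theta>\<close> maps the right half-plane to the disc and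
  turns this kernel into a congruence of the Szego kernel
  \<open>1 / (1 - \<theta> i * cnj (\<theta> j))\<close>.\<close>

lemma psd_on_inverse_add_cnj:
  assumes F: "finite F" and pos: "\<And>i. i \<in> F \<Longrightarrow> Re (f i) > 0"
  shows "psd_on F (\<lambda>i j. 1 / (f i + cnj (f j)))"
proof -
  define \<theta> where "\<theta> i = (f i - 1) / (f i + 1)" for i
  have nz: "f i + 1 \<noteq> 0" if "i \<in> F" for i using pos[OF that] by (auto simp: complex_eq_iff)
  have nz2: "f i + cnj (f j) \<noteq> 0" if "i \<in> F" "j \<in> F" for i j
    using pos[OF that(1)] pos[OF that(2)] by (auto simp: complex_eq_iff)
  have lt: "cmod (\<theta> i) < 1" if "i \<in> F" for i
  proof -
    have "(cmod (f i - 1))\<^sup>2 < (cmod (f i + 1))\<^sup>2"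
      using pos[OF that] unfolding cmod_power2 by (simp add: power2_eq_square algebra_simps)
    then have "cmod (f i - 1) < cmod (f i + 1)" by (simp add: power_less_imp_less_base)
    then show ?thesis using nz[OF that] by (simp add: \<theta>_def norm_divide)
  qed
  have "cmod (\<theta> i * cnj (\<theta> j)) < 1" if "i \<in> F" "j \<in> F" for i j
    using lt[OF that(1)] lt[OF that(2)] mult_strict_mono'[of "cmod (\<theta> i)" 1 "cmod (\<theta> j)" 1] by (simp add: norm_mult)
  then have "psd_on F (\<lambda>i j. 1 / (1 - \<theta> i * cnj (\<theta> j)))"
    by (intro psd_on_inverse_one_minus F psd_on_rank1)
  then have P: "psd_on F (\<lambda>i j. 2 * (1 / (f i + 1) * cnj (1 / (f j + 1)) * (1 / (1 - \<theta> i * cnj (\<theta> j)))))"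
    by (intro psd_on_scale psd_on_congruence) (simp add: less_eq_complex_def)
  show ?thesis
  proof (rule iffD1[OF psd_on_cong P])
    fix i j assume ij: "i \<in> F" "j \<in> F"
    have n: "cnj (f j) + 1 \<noteq> 0" using nz[OF ij(2)] by (metis complex_cnj_add complex_cnj_cancel_iff complex_cnj_one complex_cnj_zero)
    have identity: "1 - (a - 2) / a * ((b - 2) / b) = 2 * (a + b - 2) / (a * b)"
      if "a \<noteq> 0" "b \<noteq> 0" for a b :: complex
      using that by (simp add: field_simps)
    define q where "q = f i + cnj (f j)"
    have "1 - \<theta> i * cnj (\<theta> j) = 2 * q / ((f i + 1) * (cnj (f j) + 1))"
      using identity[OF nz[OF ij(1)] n] by (simp add: \<theta>_def q_def)
    then show "2 * (1 / (f i + 1) * cnj (1 / (f j + 1)) * (1 / (1 - \<theta> i * cnj (\<theta> j)))) = 1 / (f i + cnj (f j))"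
      using nz[OF ij(1)] n nz2[OF ij] unfolding q_def[symmetric] by simp
  qed
qed

context pick_kernel
begin

text \<open>This inequality makes the exponential row below contractive. Taking out the factor
  \<open>s i k * s k j\<close> leaves \<open>\<beta> k k + (\<beta> k k * \<beta> i j - \<beta> i k
  * \<beta> k j) * s i j\<close>, whose bracket is a Schur complement of
  \<open>\<beta>\<close>.\<close>

lemma psd_row_defect:
  assumes F: "finite F"
  shows "psd_on F (\<lambda>i j. (s i k + s k j - 1 - s i k * s k j / s k k) * s i j)"
proof -
  have A: "psd_on F (\<lambda>i j. \<beta> k k * \<beta> i j - \<beta> i k * \<beta> k j)"
    using psd_on_schur_complement_kernel[OF _ psd_\<beta>, of "insert k F" k] F psd_on_subset[of "insert k F" _ F] by blast
  have t: "0 \<le> \<beta> k k" using psd_on_diag_nonneg[OF psd_\<beta>[of "{k}"]] by simp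
  have one: "psd_on F (\<lambda>i j. 1)" using psd_on_rank1[of F "\<lambda>_. 1"] by simp
  have "psd_on F (\<lambda>i j. s i k * cnj (s j k) * (\<beta> k k * 1 + (\<beta> k k * \<beta> i j - \<beta> i k * \<beta> k j) * s i j))"
    by (intro psd_on_congruence psd_on_add psd_on_schur_product F A psd_s psd_on_scale t one)
  then show ?thesis
  proof (rule iffD1[OF psd_on_cong, rotated])
    fix i j
    have nz: "1 - \<beta> i k \<noteq> 0" "1 - \<beta> k j \<noteq> 0" "1 - \<beta> i j \<noteq> 0" "1 - \<beta> k k \<noteq> 0"
      using \<beta>_neq_1[of i k] \<beta>_neq_1[of k j] \<beta>_neq_1[of i j] \<beta>_neq_1[of k k] by auto
    have identity: "1 / a * (1 / b) * ((1 - d) * 1 + ((1 - d) * (1 - c) - (1 - a) * (1 - b)) * (1 / c))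
        = (1 / a + 1 / b - 1 - 1 / a * (1 / b) / (1 / d)) * (1 / c)"
      if "a \<noteq> 0" "b \<noteq> 0" "c \<noteq> 0" "d \<noteq> 0" for a b c d :: complex
      using that by (simp add: field_simps)
    show "s i k * cnj (s j k) * (\<beta> k k * 1 + (\<beta> k k * \<beta> i j - \<beta> i k * \<beta> k j) * s i j)
      = (s i k + s k j - 1 - s i k * s k j / s k k) * s i j"
      unfolding s_cnj unfolding s_eq using identity[OF nz] by simp
  qed
qed

text \<open>The kernels \<open>W k\<close> belong to the row with entries \<open>z \<mapsto> \<surd>(2 \<alpha>\<^sub>k) exp (- t f(z)) s(z, k) / \<parallel>s\<^sub>k\<parallel>\<close>; the integral
  over \<open>t > 0\<close> produces the denominators \<open>f i + cnj (f j)\<close>. Since the real part of \<open>s\<close> is positive, the Carleson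
  condition bounds the matrix \<open>Re H\<close>, which has positive entries; a Schur test vector for it provides
  weights \<open>\<alpha>\<close> for which \<open>Re f\<close> is not too large on the diagonal.\<close>

lemma carleson_rows:
  assumes F: "finite F" and C: "C > 0"
    and carl: "psd_on F (\<lambda>i j. (if i = j then of_real C else 0) - H i j)"
  shows "\<exists>W. (\<forall>k\<in>F. psd_on F (W k) \<and> 1 / (4 * C) \<le> Re (W k k k))
     \<and> psd_on F (\<lambda>i j. (1 - (\<Sum>k\<in>F. W k i j)) * s i j)"
proof -
  define K where "K i j = Re (H i j)" for i j
  have Kpos: "K i j > 0" for i j
  proof -
    have "K i j = Re (s i j) / (nrm i * nrm j)"
      by (simp add: K_def H_def flip: of_real_mult)
    then show ?thesis using Re_s[of i j] nrm_pos[of i] nrm_pos[of j] by simp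
  qed
  have bd: "(\<Sum>i\<in>F. (\<Sum>j\<in>F. K i j * x j)\<^sup>2) \<le> C\<^sup>2 * (\<Sum>i\<in>F. (x i)\<^sup>2)" for x
  proof -
    let ?x = "\<lambda>j. complex_of_real (x j)"
    \<comment> \<open>On real vectors \<open>K\<close> acts as the real part of \<open>H\<close>, so
      it inherits the norm bound \<open>C\<close>.\<close>
    have "(\<Sum>i\<in>F. (\<Sum>j\<in>F. K i j * x j)\<^sup>2) \<le> (\<Sum>i\<in>F. (cmod (\<Sum>j\<in>F. H i j * ?x j))\<^sup>2)"
    proof (rule sum_mono)
      fix i
      have "(\<Sum>j\<in>F. K i j * x j) = Re (\<Sum>j\<in>F. H i j * ?x j)" by (simp add: K_def)
      then show "(\<Sum>j\<in>F. K i j * x j)\<^sup>2 \<le> (cmod (\<Sum>j\<in>F. H i j * ?x j))\<^sup>2"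
        by (simp add: cmod_power2)
    qed
    also have "\<dots> \<le> C * Re (qform F H ?x)"
      by (rule psd_on_column_bound[OF F psd_H[OF F] carl])
    also have "Re (qform F H ?x) \<le> C * (\<Sum>i\<in>F. (x i)\<^sup>2)"
    proof -
      have "0 \<le> (\<Sum>i\<in>F. of_real ((x i)\<^sup>2) * of_real C) - qform F H ?x"
        using psd_onD[OF carl, of ?x] by (simp add: qform_diff qform_diag[OF F])
      then have "0 \<le> (\<Sum>i\<in>F. (x i)\<^sup>2 * C) - Re (qform F H ?x)"
        by (simp add: less_eq_complex_def flip: of_real_mult of_real_power)
      then show ?thesis by (simp add: sum_distrib_left mult.commute)
    qed
    then have "C * Re (qform F H ?x) \<le> C * (C * (\<Sum>i\<in>F. (x i)\<^sup>2))" using C by simp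
    finally show ?thesis by (simp add: power2_eq_square mult_ac)
  qed
  obtain v where v1: "\<And>i. i \<in> F \<Longrightarrow> v i \<ge> 1"
    and v2: "\<And>i. i \<in> F \<Longrightarrow> (\<Sum>j\<in>F. K i j * v j) \<le> 2 * C * v i"
    using schur_test_vector[OF F C _ bd] Kpos by (metis less_imp_le)
  \<comment> \<open>Dividing by \<open>nrm k\<close> turns
    \<open>\<alpha> k * (2 * Re (s i k))\<close> into \<open>2 * nrm i * (K i k * v k)\<close>, so
    the test vector inequality becomes the bound \<open>fup\<close>.\<close>
  define \<alpha> where "\<alpha> k = v k / nrm k" for k
  have \<alpha>: "\<alpha> k > 0" if "k \<in> F" for k using v1[OF that] nrm_pos[of k] by (simp add: \<alpha>_def)
  define f where "f i = (\<Sum>k\<in>F. of_real (\<alpha> k) * (2 * s i k - 1))" for i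
  have Ref: "Re (f i) = (\<Sum>k\<in>F. \<alpha> k * (2 * Re (s i k) - 1))" for i by (simp add: f_def)
  have fpos: "Re (f i) > 0" if "i \<in> F" for i
    unfolding Ref using that F \<alpha> Re_s[of i] by (intro sum_pos) (auto simp: field_simps)
  have fup: "Re (f i) \<le> 4 * C * v i * nrm i" if "i \<in> F" for i
  proof -
    have "Re (f i) \<le> (\<Sum>k\<in>F. 2 * nrm i * (K i k * v k))"
      unfolding Ref
    proof (rule sum_mono)
      fix k assume k: "k \<in> F"
      have "K i k = Re (s i k) / (nrm i * nrm k)" by (simp add: K_def H_def flip: of_real_mult)
      then have "2 * nrm i * (K i k * v k) = \<alpha> k * (2 * Re (s i k))"
        using nrm_pos[of i] by (simp add: \<alpha>_def)
      then show "\<alpha> k * (2 * Re (s i k) - 1) \<le> 2 * nrm i * (K i k * v k)"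
        using \<alpha>[OF k] by (simp add: algebra_simps)
    qed
    also have "\<dots> = 2 * nrm i * (\<Sum>k\<in>F. K i k * v k)" by (simp add: sum_distrib_left)
    also have "\<dots> \<le> 2 * nrm i * (2 * C * v i)" using v2[OF that] nrm_pos[of i] by simp
    finally show ?thesis by (simp add: mult_ac)
  qed
  define q where "q i j = 1 / (f i + cnj (f j))" for i j
  have pq: "psd_on F q" unfolding q_def[abs_def] by (rule psd_on_inverse_add_cnj[OF F fpos])
  have fsum: "f i + cnj (f j) = (\<Sum>k\<in>F. 2 * of_real (\<alpha> k) * (s i k + s k j - 1))" for i j
    by (simp add: f_def cnj_sum s_cnj algebra_simps flip: sum.distrib)
  define W where "W k i j = 2 * of_real (\<alpha> k) / s k k * (s i k * cnj (s j k) * q i j)" for k i j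
  have "psd_on F (W k)" if "k \<in> F" for k
  proof -
    have "0 \<le> 2 * of_real (\<alpha> k) / s k k"
      using \<alpha>[OF that] s_diag_pos[of k] by (subst s_diag) (simp add: less_eq_complex_def)
    then show ?thesis unfolding W_def[abs_def] by (intro psd_on_scale psd_on_congruence pq)
  qed
  moreover have "1 / (4 * C) \<le> Re (W k k k)" if "k \<in> F" for k
  proof -
    have ff: "f k + cnj (f k) = of_real (2 * Re (f k))" by (simp add: complex_eq_iff)
    have "W k k k = 2 * of_real (\<alpha> k) * s k k * q k k"
      using s_nonzero[of k k] by (simp add: W_def s_cnj)
    also have "\<dots> = of_real (\<alpha> k * (nrm k * nrm k) / Re (f k))"
      unfolding q_def ff of_real_mult of_real_divide nrm_square by simp
    also have "\<alpha> k * (nrm k * nrm k) = v k * nrm k" using nrm_pos[of k] by (simp add: \<alpha>_def)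
    finally have W: "Re (W k k k) = v k * nrm k / Re (f k)" by simp
    have "v k * nrm k / (4 * C * v k * nrm k) \<le> v k * nrm k / Re (f k)"
      using fup[OF that] fpos[OF that] v1[OF that] nrm_pos[of k] by (intro divide_left_mono mult_nonneg_nonneg) auto
    also have "v k * nrm k / (4 * C * v k * nrm k) = 1 / (4 * C)"
      using C v1[OF that] nrm_pos[of k] by simp
    finally show ?thesis by (simp add: W)
  qed
  moreover have "psd_on F (\<lambda>i j. (1 - (\<Sum>k\<in>F. W k i j)) * s i j)"
  proof -
    \<comment> \<open>Since \<open>q\<close> inverts \<open>f i + cnj (f j)\<close>, which is the
      sum of the terms \<open>2 * \<alpha> k * (s i k + s k j - 1)\<close>, the difference of 1 and
      the sum of all \<open>W k\<close> equals \<open>q\<close> times the weighted sum of the row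
      defects, with \<open>s\<close> factored out.\<close>
    have P: "psd_on F (\<lambda>i j. q i j * (\<Sum>k\<in>F. of_real (2 * \<alpha> k) * ((s i k + s k j - 1 - s i k * s k j / s k k) * s i j)))"
      by (intro psd_on_schur_product F pq psd_on_sum psd_on_scale psd_row_defect)
         (simp add: less_eq_complex_def \<alpha> less_imp_le)
    show ?thesis
    proof (rule iffD1[OF psd_on_cong P])
      fix i j assume ij: "i \<in> F" "j \<in> F"
      have nz: "f i + cnj (f j) \<noteq> 0"
        using fpos[OF ij(1)] fpos[OF ij(2)] by (auto simp: complex_eq_iff)
      have "(\<Sum>k\<in>F. of_real (2 * \<alpha> k) * ((s i k + s k j - 1 - s i k * s k j / s k k) * s i j))
        = (f i + cnj (f j)) * s i j - (\<Sum>k\<in>F. 2 * of_real (\<alpha> k) * (s i k * s k j / s k k)) * s i j"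
        unfolding fsum sum_distrib_right sum_subtractf[symmetric]
        by (intro sum.cong refl) (simp add: algebra_simps)
      moreover have "(\<Sum>k\<in>F. W k i j) = (\<Sum>k\<in>F. 2 * of_real (\<alpha> k) * (s i k * s k j / s k k)) * q i j"
        unfolding W_def sum_distrib_right by (intro sum.cong refl) (simp add: s_cnj)
      ultimately show "q i j * (\<Sum>k\<in>F. of_real (2 * \<alpha> k) * ((s i k + s k j - 1 - s i k * s k j / s k k) * s i j))
        = (1 - (\<Sum>k\<in>F. W k i j)) * s i j"
        using nz by (simp add: q_def field_simps)
    qed
  qed
  ultimately show ?thesis by blast
qed

end

abbreviation unit_entry :: "'i \<Rightarrow> complex \<Rightarrow> 'i \<Rightarrow> 'i \<Rightarrow> complex" where
  "unit_entry k x \<equiv> (\<lambda>i j. if i = k \<and> j = k then x else 0)"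

lemma psd_on_unit_entry:
  assumes "finite F" "0 \<le> x"
  shows "psd_on F (unit_entry k x)"
proof -
  have "psd_on F (\<lambda>i j. if i = j then (if i = k then x else 0) else 0)"
    using assms by (intro psd_on_diag) auto
  then show ?thesis by (rule iffD1[OF psd_on_cong, rotated]) auto
qed

context pick_kernel
begin

subsection \<open>Separation from far points\<close>

text \<open>The threshold 1/2 serves twice: it bounds the number of near points by 2 C, and it gives
  ln (1 - x) >= -2 x at the far ones.\<close>

definition near :: "'a set \<Rightarrow> 'a \<Rightarrow> 'a set" where
  "near F i = {y \<in> F. (cmod (H i y))\<^sup>2 > 1 / 2}"

lemma self_in_near: "i \<in> F \<Longrightarrow> i \<in> near F i"
  by (simp add: near_def H_diag)

text \<open>The column bound at a unit vector: a column of \<open>H\<close> has squared norm at most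
  C times its diagonal entry, which is 1.\<close>

lemma H_square_sum:
  assumes F: "finite F" and carl: "psd_on F (\<lambda>i j. (if i = j then of_real C else 0) - H i j)"
    and i: "i \<in> F"
  shows "(\<Sum>y\<in>F. (cmod (H i y))\<^sup>2) \<le> C"
proof -
  let ?e = "\<lambda>j. if j = i then 1 else 0 :: complex"
  have "(\<Sum>y\<in>F. (cmod (\<Sum>j\<in>F. H y j * ?e j))\<^sup>2) \<le> C * Re (qform F H ?e)"
    by (rule psd_on_column_bound[OF F psd_H[OF F] carl])
  moreover have "(\<Sum>j\<in>F. H y j * ?e j) = H y i" for y
    using F i by (simp add: if_distrib cong: if_cong)
  moreover have "qform F H ?e = 1"
    using F i by (simp add: qform_def if_distrib[of cnj] if_distrib[of "\<lambda>x. x * _"] if_distrib[of "\<lambda>x. _ * x"] H_diag cong: if_cong)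
  moreover have "cmod (H y i) = cmod (H i y)" for y
    by (metis H_cnj complex_mod_cnj)
  ultimately show ?thesis by simp
qed

lemma card_near:
  assumes F: "finite F" and carl: "psd_on F (\<lambda>i j. (if i = j then of_real C else 0) - H i j)"
    and i: "i \<in> F"
  shows "real (card (near F i)) \<le> 2 * C"
proof -
  have sub: "near F i \<subseteq> F" by (auto simp: near_def)
  have "real (card (near F i)) * (1 / 2) = (\<Sum>y\<in>near F i. 1 / 2)" by simp
  also have "\<dots> \<le> (\<Sum>y\<in>near F i. (cmod (H i y))\<^sup>2)"
    by (rule sum_mono) (simp add: near_def)
  also have "\<dots> \<le> (\<Sum>y\<in>F. (cmod (H i y))\<^sup>2)"
    using F sub by (intro sum_mono2) auto
  also have "\<dots> \<le> C" by (rule H_square_sum[OF assms])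
  finally show ?thesis by simp
qed

text \<open>The product of \<open>\<kappa> y\<close> over the far points \<open>y\<close>. Each
  factor kills the row and the column of its own point, while at \<open>i\<close> the factors 1 - |H
  i y|^2 are at least exp (-2 |H i y|^2), and the exponents sum up to at least -2 C.\<close>

lemma far_product:
  assumes F: "finite F" and carl: "psd_on F (\<lambda>i j. (if i = j then of_real C else 0) - H i j)"
    and i: "i \<in> F"
  shows "\<exists>Q. contractive F Q \<and> (\<forall>m\<in>F. \<forall>n\<in>F. m \<notin> near F i \<or> n \<notin> near F i \<longrightarrow> Q m n = 0)
    \<and> of_real (exp (- 2 * C)) \<le> Q i i"
proof -
  define A where "A = F - near F i"
  define Q where "Q m n = (\<Prod>y\<in>A. \<kappa> y m n)" for m n
  have A: "finite A" using F by (simp add: A_def)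
  have half: "(cmod (H i y))\<^sup>2 \<le> 1 / 2" if "y \<in> A" for y
    using that by (auto simp: A_def near_def)
  have "contractive F Q"
    unfolding Q_def[abs_def] by (intro contractive_prod contractive_\<kappa> F A)
  moreover have "Q m n = 0" if "m \<in> F" "n \<in> F" "m \<notin> near F i \<or> n \<notin> near F i" for m n
  proof -
    have "m \<in> A \<or> n \<in> A" using that by (auto simp: A_def)
    then obtain y where y: "y \<in> A" "\<kappa> y m n = 0" using \<kappa>_left \<kappa>_right by blast
    then show ?thesis unfolding Q_def by (rule prod_zero[OF A, OF bexI, rotated])
  qed
  moreover have "of_real (exp (- 2 * C)) \<le> Q i i"
  proof -
    have "exp (- 2 * C) \<le> exp (\<Sum>y\<in>A. - 2 * (cmod (H i y))\<^sup>2)"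
    proof -
      have "(\<Sum>y\<in>A. (cmod (H i y))\<^sup>2) \<le> (\<Sum>y\<in>F. (cmod (H i y))\<^sup>2)"
        using F by (intro sum_mono2) (auto simp: A_def)
      then have "(\<Sum>y\<in>A. (cmod (H i y))\<^sup>2) \<le> C" using H_square_sum[OF assms] by simp
      then show ?thesis by (simp add: sum_distrib_left[symmetric] sum_negf)
    qed
    also have "\<dots> = (\<Prod>y\<in>A. exp (- 2 * (cmod (H i y))\<^sup>2))" by (rule exp_sum[OF A])
    also have "\<dots> \<le> (\<Prod>y\<in>A. 1 - (cmod (H i y))\<^sup>2)"
    proof (rule prod_mono, intro conjI)
      fix y assume y: "y \<in> A"
      define x where "x = (cmod (H i y))\<^sup>2"
      have x: "0 \<le> x" "x \<le> 1 / 2" using half[OF y] by (auto simp: x_def)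
      have "- x - 2 * x\<^sup>2 \<le> ln (1 - x)" by (rule ln_one_minus_pos_lower_bound[OF x])
      moreover have "2 * x\<^sup>2 \<le> x" using mult_left_mono[OF x(2), of "2 * x"] x by (simp add: power2_eq_square)
      ultimately have "- 2 * x \<le> ln (1 - x)" by simp
      then have "exp (- 2 * x) \<le> exp (ln (1 - x))" by simp
      also have "exp (ln (1 - x)) = 1 - x" using x by simp
      finally show "exp (- 2 * (cmod (H i y))\<^sup>2) \<le> 1 - (cmod (H i y))\<^sup>2" by (simp only: x_def)
    qed simp
    finally have "exp (- 2 * C) \<le> (\<Prod>y\<in>A. 1 - (cmod (H i y))\<^sup>2)" .
    moreover have "Q i i = of_real (\<Prod>y\<in>A. 1 - (cmod (H i y))\<^sup>2)"
      by (simp add: Q_def \<kappa>_diag)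
    ultimately show ?thesis by (simp only: less_eq_complex_def Re_complex_of_real Im_complex_of_real)
  qed
  ultimately show ?thesis by blast
qed

text \<open>With \<open>Q\<close> from \<open>far_product\<close>, the matrix is the sum of g (1 -
  Q) s, of \<open>Q\<close> times the separation matrix, and of a nonnegative entry at
  \<open>i\<close>. The middle term needs positivity only on the near points because
  \<open>Q\<close> vanishes elsewhere.\<close>

lemma strongly_separated:
  assumes F: "finite F" and carl: "psd_on F (\<lambda>i j. (if i = j then of_real C else 0) - H i j)"
    and i: "i \<in> F" and g: "psd_on F g" and e: "0 \<le> e"
    and sep: "psd_on (near F i) (\<lambda>m n. g m n * s m n - unit_entry i (of_real e * (g i i * s i i)) m n)"
  shows "psd_on F (\<lambda>m n. g m n * s m n - unit_entry i (of_real (exp (- 2 * C) * e) * (g i i * s i i)) m n)"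
proof -
  obtain Q where Q: "contractive F Q" and Q0: "\<And>m n. m \<in> F \<Longrightarrow> n \<in> F \<Longrightarrow> m \<notin> near F i \<or> n \<notin> near F i \<Longrightarrow> Q m n = 0"
    and Qi: "of_real (exp (- 2 * C)) \<le> Q i i"
    using far_product[OF F carl i] by blast
  have sub: "near F i \<subseteq> F" by (auto simp: near_def)
  have l: "0 \<le> g i i * s i i"
    using psd_on_diag_nonneg[OF g F i] psd_on_diag_nonneg[OF psd_s[OF F] F i] by simp
  have 1: "psd_on F (\<lambda>m n. g m n * ((1 - Q m n) * s m n))"
    by (rule psd_on_schur_product[OF F g]) (use Q in \<open>simp add: contractive_def\<close>)
  have 2: "psd_on F (\<lambda>m n. Q m n * (g m n * s m n - unit_entry i (of_real e * (g i i * s i i)) m n))"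
  proof (rule psd_on_support[OF _ F sub])
    have "psd_on (near F i) Q" using Q psd_on_subset[OF _ F sub] by (simp add: contractive_def)
    then show "psd_on (near F i) (\<lambda>m n. Q m n * (g m n * s m n - unit_entry i (of_real e * (g i i * s i i)) m n))"
      using finite_subset[OF sub F] sep by (intro psd_on_schur_product)
  qed (use Q0 in auto)
  have 3: "psd_on F (unit_entry i ((Q i i - of_real (exp (- 2 * C))) * (of_real e * (g i i * s i i))))"
  proof (rule psd_on_unit_entry[OF F], rule mult_nonneg_nonneg)
    show "0 \<le> Q i i - of_real (exp (- 2 * C))" using Qi by simp
    have "0 \<le> complex_of_real e" using e by (simp add: less_eq_complex_def)
    then show "0 \<le> of_real e * (g i i * s i i)"
      using l by (rule mult_nonneg_nonneg)
  qed
  show ?thesis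
    by (rule iffD1[OF psd_on_cong psd_on_add[OF psd_on_add[OF 1 2] 3]]) (auto simp: algebra_simps)
qed

text \<open>The same splitting with the sum of the \<open>W k\<close> in place of \<open>Q\<close>:
  each \<open>W k\<close> multiplies the separation matrix of its own point \<open>k\<close>, and
  \<open>W k k k\<close> is large enough to retain the share 1 / (4 C) of the entry there. All
  points are thus treated at once.\<close>

lemma riesz_lower_bound:
  assumes F: "finite F" and C: "C > 0"
    and carl: "psd_on F (\<lambda>i j. (if i = j then of_real C else 0) - H i j)"
    and g: "psd_on F g" and d: "0 \<le> d"
    and sep: "\<And>k. k \<in> F \<Longrightarrow> psd_on F (\<lambda>m n. g m n * s m n - unit_entry k (of_real d * (g k k * s k k)) m n)"
  shows "psd_on F (\<lambda>m n. g m n * s m n - (if m = n then of_real (d / (4 * C)) * (g m m * s m m) else 0))"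
proof -
  obtain W where W: "\<And>k. k \<in> F \<Longrightarrow> psd_on F (W k)" "\<And>k. k \<in> F \<Longrightarrow> 1 / (4 * C) \<le> Re (W k k k)"
    and W1: "psd_on F (\<lambda>i j. (1 - (\<Sum>k\<in>F. W k i j)) * s i j)"
    using carleson_rows[OF F C carl] by blast
  have l: "0 \<le> g k k * s k k" if "k \<in> F" for k
    using psd_on_diag_nonneg[OF g F that] psd_on_diag_nonneg[OF psd_s[OF F] F that] by simp
  have 1: "psd_on F (\<lambda>m n. g m n * ((1 - (\<Sum>k\<in>F. W k m n)) * s m n))"
    by (intro psd_on_schur_product F g W1)
  have 2: "psd_on F (\<lambda>m n. \<Sum>k\<in>F. W k m n * (g m n * s m n - unit_entry k (of_real d * (g k k * s k k)) m n))"
    by (intro psd_on_sum psd_on_schur_product F W sep)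
  have 3: "psd_on F (\<lambda>m n. if m = n then (W m m m - of_real (1 / (4 * C))) * (of_real d * (g m m * s m m)) else 0)"
  proof (intro psd_on_diag F)
    fix m assume m: "m \<in> F"
    have "0 \<le> W m m m" using psd_on_diag_nonneg[OF W(1)[OF m] F m] .
    then have "0 \<le> W m m m - of_real (1 / (4 * C))" using W(2)[OF m] by (simp add: less_eq_complex_def)
    moreover have "0 \<le> complex_of_real d" using d by (simp add: less_eq_complex_def)
    ultimately show "0 \<le> (W m m m - of_real (1 / (4 * C))) * (of_real d * (g m m * s m m))"
      using l[OF m] by (metis mult_nonneg_nonneg)
  qed
  show ?thesis
  proof (rule iffD1[OF psd_on_cong psd_on_add[OF psd_on_add[OF 1 2] 3]])
    fix m n assume mn: "m \<in> F" "n \<in> F"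
    let ?x = "\<lambda>k. of_real d * (g k k * s k k)"
    have "(\<Sum>k\<in>F. W k m n * (g m n * s m n - unit_entry k (?x k) m n))
      = (\<Sum>k\<in>F. W k m n) * (g m n * s m n) - (\<Sum>k\<in>F. W k m n * unit_entry k (?x k) m n)"
      by (simp add: right_diff_distrib sum_subtractf sum_distrib_right)
    also have "(\<Sum>k\<in>F. W k m n * unit_entry k (?x k) m n) = (\<Sum>k\<in>F. if k = m then (if m = n then W m m m * ?x m else 0) else 0)"
      by (intro sum.cong) auto
    also have "\<dots> = (if m = n then W m m m * ?x m else 0)" using F mn by simp
    finally have eq: "(\<Sum>k\<in>F. W k m n * (g m n * s m n - unit_entry k (?x k) m n))
      = (\<Sum>k\<in>F. W k m n) * (g m n * s m n) - (if m = n then W m m m * ?x m else 0)" .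
    show "g m n * ((1 - (\<Sum>k\<in>F. W k m n)) * s m n)
        + (\<Sum>k\<in>F. W k m n * (g m n * s m n - unit_entry k (?x k) m n))
        + (if m = n then (W m m m - of_real (1 / (4 * C))) * ?x m else 0)
      = g m n * s m n - (if m = n then of_real (d / (4 * C)) * (g m m * s m m) else 0)"
      unfolding eq by (simp add: algebra_simps)
  qed
qed

subsection \<open>Pick interpolation for a pair of kernels\<close>

text \<open>After rescaling \<open>s\<close> to be \<open>1\<close> on the row and column of the new point \<open>x\<close>, extending \<open>\<phi>\<close> to \<open>x\<close> means
  completing the one missing entry of a bordered matrix, where \<open>None\<close> indexes the border \<open>\<phi>\<close>.\<close>

lemma pick_step:
  assumes Y: "finite Y" "x \<notin> Y" and g: "psd_on (insert x Y) g"
    and P: "psd_on Y (\<lambda>i j. (g i j - \<phi> i * cnj (\<phi> j)) * s i j)"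
  shows "\<exists>z. psd_on (insert x Y) (\<lambda>i j. (g i j - (\<phi>(x := z)) i * cnj ((\<phi>(x := z)) j)) * s i j)"
proof -
  define \<rho> where "\<rho> i j = s i j * s x x / (s i x * s x j)" for i j
  have \<rho>x: "\<rho> x j = 1" "\<rho> j x = 1" for j using s_nonzero by (simp_all add: \<rho>_def)
  have \<rho>\<kappa>: "\<rho> i j * (1 - \<kappa> x i j) = 1" for i j using s_nonzero by (simp add: \<rho>_def \<kappa>_def)
  define A where "A i j = (g i j - \<phi> i * cnj (\<phi> j)) * \<rho> i j" for i j
  have A_eq: "g i j + A i j * \<kappa> x i j - \<phi> i * cnj (\<phi> j) = A i j" for i j
  proof -
    have "A i j * (1 - \<kappa> x i j) = (g i j - \<phi> i * cnj (\<phi> j)) * (\<rho> i j * (1 - \<kappa> x i j))"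
      by (simp only: A_def mult.assoc)
    then have "A i j - A i j * \<kappa> x i j = g i j - \<phi> i * cnj (\<phi> j)"
      unfolding \<rho>\<kappa> by (simp add: right_diff_distrib)
    then show ?thesis by (simp add: algebra_simps)
  qed
  have sxx: "0 \<le> s x x" "0 \<le> 1 / s x x"
    using s_diag_pos[of x] by (subst s_diag, simp add: less_eq_complex_def)+
  have PA: "psd_on Y A"
    by (rule iffD1[OF psd_on_cong psd_on_scale[OF sxx(1) psd_on_congruence[OF P, of "\<lambda>i. 1 / s i x"]]])
       (simp add: A_def \<rho>_def s_cnj)
  have "psd_on Y (\<lambda>i j. A i j * \<kappa> x i j)"
    by (intro psd_on_schur_product Y PA psd_\<kappa>)
  then have "psd_on (insert x Y) (\<lambda>i j. A i j * \<kappa> x i j)"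
    by (rule psd_on_support) (use Y in auto)
  then have PT: "psd_on (insert x Y) (\<lambda>i j. g i j + A i j * \<kappa> x i j)"
    by (rule psd_on_add[OF g])
  \<comment> \<open>On \<open>Y\<close> the entries are such that subtracting
    \<open>\<phi> i * cnj (\<phi> j)\<close> leaves \<open>A\<close>, so the Schur complement at the
    border is positive there. In the row and column of \<open>x\<close> the term with
    \<open>\<kappa>\<close> vanishes and only \<open>g\<close> remains.\<close>
  define K where "K u w = (case (u, w) of (None, None) \<Rightarrow> 1 | (None, Some j) \<Rightarrow> cnj (\<phi> j)
     | (Some i, None) \<Rightarrow> \<phi> i | (Some i, Some j) \<Rightarrow> g i j + A i j * \<kappa> x i j)" for u w
  have some: "psd_on (Some ` Z) L \<longleftrightarrow> psd_on Z (\<lambda>i j. L (Some i) (Some j))" for Z :: "'a set" and L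
  proof -
    have "qform (Some ` Z) L c = qform Z (\<lambda>i j. L (Some i) (Some j)) (c \<circ> Some)" for c
      by (rule qform_reindex) simp
    moreover have "\<exists>c'. c = c' \<circ> Some" for c :: "'a \<Rightarrow> complex"
      by (rule exI[of _ "\<lambda>u. c (the u)"]) auto
    ultimately show ?thesis unfolding psd_on_def by metis
  qed
  have A1: "psd_on (insert None (Some ` Y)) K"
  proof (rule psd_on_insertI)
    show "psd_on (Some ` Y) (\<lambda>i j. K i j - K i None * K None j / K None None)"
      unfolding some
    proof (rule iffD1[OF psd_on_cong PA])
      fix i j
      show "A i j = K (Some i) (Some j) - K (Some i) None * K None (Some j) / K None None"
        using A_eq[of i j] by (simp add: K_def)
    qed
  qed (use Y in \<open>auto simp: K_def less_complex_def\<close>)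
  have A2: "psd_on (insert (Some x) (Some ` Y)) K"
    using PT by (simp only: image_insert[symmetric] some) (simp add: K_def)
  obtain z where z: "psd_on (insert None (insert (Some x) (Some ` Y)))
      (\<lambda>i j. if i = None \<and> j = Some x then z else if i = Some x \<and> j = None then cnj z else K i j)"
    using psd_on_completion[OF _ _ _ _ A1 A2] Y by auto
  \<comment> \<open>The completed entry \<open>z\<close> lies in row \<open>None\<close>, which
    carries the conjugates of the values of \<open>\<phi>\<close>.\<close>
  let ?\<phi> = "\<phi>(x := cnj z)"
  have "psd_on (Some ` insert x Y) (\<lambda>i j. (\<lambda>i j. if i = None \<and> j = Some x then z else if i = Some x \<and> j = None then cnj z else K i j) i j
     - (\<lambda>i j. if i = None \<and> j = Some x then z else if i = Some x \<and> j = None then cnj z else K i j) i None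
     * (\<lambda>i j. if i = None \<and> j = Some x then z else if i = Some x \<and> j = None then cnj z else K i j) None j
     / (\<lambda>i j. if i = None \<and> j = Some x then z else if i = Some x \<and> j = None then cnj z else K i j) None None)"
    unfolding image_insert by (rule psd_on_schur_complement[OF _ _ z]) (use Y in \<open>auto simp: K_def\<close>)
  then have Q: "psd_on (insert x Y) (\<lambda>i j. (g i j - ?\<phi> i * cnj (?\<phi> j)) * \<rho> i j)"
    unfolding some
  proof (rule iffD1[OF psd_on_cong, rotated], goal_cases)
    case (1 i j)
    show ?case
    proof (cases "i = x \<or> j = x")
      case True
      then show ?thesis by (auto simp: K_def \<rho>x)
    next
      case False
      then show ?thesis using A_eq[of i j] by (simp add: K_def A_def)
    qed
  qed
  have "psd_on (insert x Y) (\<lambda>i j. (g i j - ?\<phi> i * cnj (?\<phi> j)) * s i j)"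
    by (rule iffD1[OF psd_on_cong psd_on_scale[OF sxx(2) psd_on_congruence[OF Q, of "\<lambda>i. s i x"]]])
       (use s_nonzero in \<open>simp add: \<rho>_def s_cnj\<close>)
  then show ?thesis by blast
qed

lemma pick_finite:
  assumes "finite Z" "finite Y" and g: "\<And>F. finite F \<Longrightarrow> psd_on F g"
    and P: "psd_on Y (\<lambda>i j. (g i j - \<phi> i * cnj (\<phi> j)) * s i j)"
  shows "\<exists>\<phi>'. (\<forall>i\<in>Y. \<phi>' i = \<phi> i) \<and> psd_on (Z \<union> Y) (\<lambda>i j. (g i j - \<phi>' i * cnj (\<phi>' j)) * s i j)"
  using assms(1)
proof (induction Z rule: finite_induct)
  case empty
  show ?case using P by auto
next
  case (insert x Z)
  then obtain \<phi>' where \<phi>': "\<forall>i\<in>Y. \<phi>' i = \<phi> i"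
    "psd_on (Z \<union> Y) (\<lambda>i j. (g i j - \<phi>' i * cnj (\<phi>' j)) * s i j)" by blast
  show ?case
  proof (cases "x \<in> Y")
    case True
    then show ?thesis using \<phi>' by (auto simp: insert_absorb)
  next
    case False
    obtain z where "psd_on (insert x (Z \<union> Y)) (\<lambda>i j. (g i j - (\<phi>'(x := z)) i * cnj ((\<phi>'(x := z)) j)) * s i j)"
      using pick_step[OF _ _ g \<phi>'(2), of x] insert.hyps assms(2) False by auto
    then show ?thesis using \<phi>'(1) False by (intro exI[of _ "\<phi>'(x := z)"]) auto
  qed
qed

text \<open>Compactness: positivity on the diagonal confines each value to a closed disc, the
  conditions on finite sets are closed in the product topology, and finitely many of them are met
  simultaneously by \<open>pick_finite\<close>.\<close>

lemma pick_extension: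
  assumes g: "\<And>F. finite F \<Longrightarrow> psd_on F g"
    and P: "\<And>Y. finite Y \<Longrightarrow> Y \<subseteq> \<Lambda> \<Longrightarrow> psd_on Y (\<lambda>i j. (g i j - \<phi>0 i * cnj (\<phi>0 j)) * s i j)"
  shows "\<exists>\<phi>. (\<forall>x\<in>\<Lambda>. \<phi> x = \<phi>0 x) \<and> (\<forall>F. finite F \<longrightarrow> psd_on F (\<lambda>i j. (g i j - \<phi> i * cnj (\<phi> j)) * s i j))"
proof -
  define B where "B = (PiE UNIV (\<lambda>x. cball (0::complex) (sqrt (Re (g x x)))))"
  define S where "S F = {\<phi>. (\<forall>x\<in>F \<inter> \<Lambda>. \<phi> x = \<phi>0 x) \<and> psd_on F (\<lambda>i j. (g i j - \<phi> i * cnj (\<phi> j)) * s i j)}" for F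
  have "compactin (product_topology (\<lambda>i::'a. euclidean) UNIV) B"
    unfolding B_def by (simp add: compactin_PiE)
  then have compact: "compact B"
    by (simp add: euclidean_product_topology)
  have cont: "continuous_on UNIV (\<lambda>\<phi>::'a \<Rightarrow> complex. \<phi> i)" for i
    by (rule continuous_on_product_coordinates)
  have closed: "closed (S F)" for F
  proof -
    have "S F = (\<Inter>x\<in>F \<inter> \<Lambda>. {\<phi>. \<phi> x = \<phi>0 x}) \<inter> (\<Inter>c. {\<phi>. 0 \<le> Re (qform F (\<lambda>i j. (g i j - \<phi> i * cnj (\<phi> j)) * s i j) c)} \<inter> {\<phi>. Im (qform F (\<lambda>i j. (g i j - \<phi> i * cnj (\<phi> j)) * s i j) c) = 0})"
      unfolding S_def psd_on_def less_eq_complex_def by auto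
    moreover have "closed {\<phi>. \<phi> x = \<phi>0 x}" for x
      by (intro closed_Collect_eq cont continuous_intros)
    moreover have "closed {\<phi>. 0 \<le> Re (qform F (\<lambda>i j. (g i j - \<phi> i * cnj (\<phi> j)) * s i j) c)}" for c
      unfolding qform_def by (intro closed_Collect_le cont continuous_intros)
    moreover have "closed {\<phi>. Im (qform F (\<lambda>i j. (g i j - \<phi> i * cnj (\<phi> j)) * s i j) c) = 0}" for c
      unfolding qform_def by (intro closed_Collect_eq cont continuous_intros)
    ultimately show ?thesis by (auto intro!: closed_INT closed_Int)
  qed
  have "B \<inter> (\<Inter>F\<in>{F. finite F}. S F) \<noteq> {}"
  proof (rule compact_imp_fip_image[OF compact])
    fix I assume I: "finite I" "I \<subseteq> {F. finite (F :: 'a set)}"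
    define Z where "Z = \<Union> I"
    have Z: "finite Z" using I by (auto simp: Z_def)
    obtain \<phi> where \<phi>: "\<forall>i\<in>Z \<inter> \<Lambda>. \<phi> i = \<phi>0 i"
      "psd_on (Z \<union> (Z \<inter> \<Lambda>)) (\<lambda>i j. (g i j - \<phi> i * cnj (\<phi> j)) * s i j)"
      using pick_finite[OF Z _ g P, of "Z \<inter> \<Lambda>"] Z by auto
    \<comment> \<open>The value 0 off \<open>Z\<close> keeps the function inside the product of
      discs.\<close>
    define \<psi> where "\<psi> x = (if x \<in> Z then \<phi> x else 0)" for x
    have \<psi>: "psd_on Z (\<lambda>i j. (g i j - \<psi> i * cnj (\<psi> j)) * s i j)"
      using \<phi>(2) by (subst psd_on_cong[where K' = "\<lambda>i j. (g i j - \<phi> i * cnj (\<phi> j)) * s i j"])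
        (auto simp: \<psi>_def Un_absorb2)
    have "\<psi> \<in> S F" if "F \<in> I" for F
    proof -
      have "F \<subseteq> Z" using that by (auto simp: Z_def)
      then show ?thesis using psd_on_subset[OF \<psi> Z, of F] \<phi>(1) by (auto simp: S_def \<psi>_def)
    qed
    moreover have "\<psi> \<in> B"
    proof -
      have "cmod (\<psi> x) \<le> sqrt (Re (g x x))" for x
      proof (cases "x \<in> Z")
        case True
        have "0 \<le> (g x x - \<psi> x * cnj (\<psi> x)) * s x x"
          using psd_on_diag_nonneg[OF \<psi> Z True] .
        also have "g x x = of_real (Re (g x x))"
          using psd_on_diag_nonneg[OF g[of "{x}"]] by (simp add: less_eq_complex_def complex_eq_iff)
        also have "\<psi> x * cnj (\<psi> x) = of_real ((cmod (\<psi> x))\<^sup>2)" by (simp only: complex_norm_square)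
        also have "s x x = of_real (Re (s x x))" by (rule s_diag)
        finally have "0 \<le> (Re (g x x) - (cmod (\<psi> x))\<^sup>2) * Re (s x x)"
          by (simp add: less_eq_complex_def)
        then have "(cmod (\<psi> x))\<^sup>2 \<le> Re (g x x)" using s_diag_pos[of x] by (simp add: zero_le_mult_iff)
        then show ?thesis by (rule real_le_rsqrt)
      next
        case False
        then show ?thesis using psd_on_diag_nonneg[OF g[of "{x}"]] by (simp add: \<psi>_def less_eq_complex_def)
      qed
      then show ?thesis by (simp add: B_def PiE_UNIV_domain)
    qed
    ultimately show "B \<inter> (\<Inter>F\<in>I. S F) \<noteq> {}" by blast
  qed (use closed in auto)
  then obtain \<phi> where \<phi>: "\<And>F. finite F \<Longrightarrow> \<phi> \<in> S F" by blast
  have "\<phi> x = \<phi>0 x" if "x \<in> \<Lambda>" for x using \<phi>[of "{x}"] that by (simp add: S_def)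
  moreover have "psd_on F (\<lambda>i j. (g i j - \<phi> i * cnj (\<phi> j)) * s i j)" if "finite F" for F
    using \<phi>[OF that] by (simp add: S_def)
  ultimately show ?thesis by blast
qed

end

section \<open>Reproducing kernel Hilbert spaces\<close>

lemma gram_form_eq_qform: "gram_form k n x a = qform {..<n} (\<lambda>i j. k (x i) (x j)) a"
  unfolding gram_form_def qform_def by (subst sum.swap) (simp add: mult_ac)

lemma finite_set_enumeration:
  assumes "finite (F :: 'a set)"
  obtains n and x :: "nat \<Rightarrow> 'a" where "inj_on x {..<n}" "x ` {..<n} = F"
  using ex_bij_betw_nat_finite[OF assms] by (auto simp: bij_betw_def atLeast0LessThan)

lemma psd_kernel_iff: "psd_kernel k \<longleftrightarrow> (\<forall>F. finite F \<longrightarrow> psd_on F k)"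
proof
  assume k: "psd_kernel k"
  show "\<forall>F. finite F \<longrightarrow> psd_on F k"
  proof (intro allI impI psd_onI)
    fix F :: "'a set" and c assume "finite F"
    then obtain n and x :: "nat \<Rightarrow> 'a" where x: "inj_on x {..<n}" "x ` {..<n} = F"
      by (rule finite_set_enumeration)
    have "qform F k c = gram_form k n x (c \<circ> x)"
      using qform_reindex[OF x(1), of k c] by (simp add: x(2) gram_form_eq_qform)
    then show "0 \<le> qform F k c" using k by (simp add: psd_kernel_def less_eq_complex_def)
  qed
next
  assume k: "\<forall>F. finite F \<longrightarrow> psd_on F k"
  have "0 \<le> gram_form k n x a" for n and x :: "nat \<Rightarrow> 'a" and a
    unfolding gram_form_eq_qform by (rule psd_onD, rule psd_on_pullback) (use k in auto)
  then show "psd_kernel k"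
    by (simp add: psd_kernel_def less_eq_complex_def)
qed

lemma psd_kernelD: "psd_kernel k \<Longrightarrow> finite F \<Longrightarrow> psd_on F k"
  by (simp add: psd_kernel_iff)

lemma psd_kernel_Re_qform: "psd_kernel k \<Longrightarrow> finite F \<Longrightarrow> 0 \<le> Re (qform F k c)"
  using psd_onD[OF psd_kernelD, of k F c] by (simp add: less_eq_complex_def)

text \<open>Passes from finite sequences, in which points may repeat, to finite sets; the
  coefficients at a repeated point are added.\<close>

lemma rkhs_bound_iff:
  "rkhs_bound k f C \<longleftrightarrow> 0 \<le> C \<and>
     (\<forall>F c. finite F \<longrightarrow> (cmod (\<Sum>y\<in>F. cnj (c y) * f y))\<^sup>2 \<le> C * Re (qform F k c))"
proof (intro iffI conjI allI impI)
  assume b: "rkhs_bound k f C"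
  then show "0 \<le> C" by (simp add: rkhs_bound_def)
  fix F :: "'a set" and c assume "finite F"
  then obtain n and x :: "nat \<Rightarrow> 'a" where x: "inj_on x {..<n}" "x ` {..<n} = F"
    by (rule finite_set_enumeration)
  have "qform F k c = gram_form k n x (c \<circ> x)"
    using qform_reindex[OF x(1), of k c] by (simp add: x(2) gram_form_eq_qform)
  moreover have "(\<Sum>y\<in>F. cnj (c y) * f y) = (\<Sum>j<n. cnj ((c \<circ> x) j) * f (x j))"
    by (simp add: sum.reindex[OF x(1)] flip: x(2))
  ultimately show "(cmod (\<Sum>y\<in>F. cnj (c y) * f y))\<^sup>2 \<le> C * Re (qform F k c)"
    using b unfolding rkhs_bound_def by metis
next
  assume b: "0 \<le> C \<and> (\<forall>F c. finite F \<longrightarrow> (cmod (\<Sum>y\<in>F. cnj (c y) * f y))\<^sup>2 \<le> C * Re (qform F k c))"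
  show "rkhs_bound k f C"
    unfolding rkhs_bound_def
  proof (intro conjI allI)
    fix n and x :: "nat \<Rightarrow> 'a" and a :: "nat \<Rightarrow> complex"
    let ?A = "\<lambda>y. \<Sum>i\<in>{i\<in>{..<n}. x i = y}. a i"
    have "(\<Sum>j<n. cnj (a j) * f (x j)) = (\<Sum>y\<in>x ` {..<n}. cnj (?A y) * f y)"
      by (subst sum_aggregate) (simp_all add: cnj_sum)
    moreover have "(cmod (\<Sum>y\<in>x ` {..<n}. cnj (?A y) * f y))\<^sup>2 \<le> C * Re (qform (x ` {..<n}) k ?A)"
      by (rule b[THEN conjunct2, rule_format]) simp
    ultimately show "(cmod (\<Sum>j<n. cnj (a j) * f (x j)))\<^sup>2 \<le> C * Re (gram_form k n x a)"
      by (simp only: gram_form_eq_qform qform_pullback[OF finite_lessThan])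
  qed (use b in simp)
qed

section \<open>Norms of functions and of kernel combinations\<close>

lemma rkhs_norm_square: "(rkhs_norm k f)\<^sup>2 = Inf {C. rkhs_bound k f C}" if "in_rkhs k f"
proof -
  have "0 \<le> Inf {C. rkhs_bound k f C}"
    using that by (intro cInf_greatest) (auto simp: in_rkhs_def rkhs_bound_def)
  then show ?thesis by (simp add: rkhs_norm_def)
qed

lemma bdd_below_rkhs_bound: "bdd_below {C. rkhs_bound k f C}"
  by (rule bdd_belowI[of _ 0]) (simp add: rkhs_bound_def)

lemma rkhs_norm_square_le: "rkhs_bound k f D \<Longrightarrow> (rkhs_norm k f)\<^sup>2 \<le> D"
  by (subst rkhs_norm_square) (auto simp: in_rkhs_def intro: cInf_lower bdd_below_rkhs_bound)

lemma rkhs_norm_nonneg: "in_rkhs k f \<Longrightarrow> 0 \<le> rkhs_norm k f"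
  unfolding rkhs_norm_def
  by (intro real_sqrt_ge_zero cInf_greatest) (auto simp: in_rkhs_def rkhs_bound_def)

text \<open>The infimum defining the norm is attained, since each single inequality is linear in the
  constant and passes to the infimum.\<close>

lemma rkhs_bound_norm:
  assumes k: "psd_kernel k" and f: "in_rkhs k f"
  shows "rkhs_bound k f ((rkhs_norm k f)\<^sup>2)"
  unfolding rkhs_bound_iff
proof (intro conjI allI impI)
  fix F :: "'a set" and c assume F: "finite F"
  define q where "q = Re (qform F k c)"
  have q: "0 \<le> q" unfolding q_def by (rule psd_kernel_Re_qform[OF k F])
  have b: "(cmod (\<Sum>y\<in>F. cnj (c y) * f y))\<^sup>2 \<le> D * q" if "rkhs_bound k f D" for D
    using that F by (simp add: rkhs_bound_iff q_def)
  obtain D0 where D0: "rkhs_bound k f D0" using f by (auto simp: in_rkhs_def)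
  have "(cmod (\<Sum>y\<in>F. cnj (c y) * f y))\<^sup>2 \<le> (rkhs_norm k f)\<^sup>2 * q"
  proof (cases "q = 0")
    case True
    then show ?thesis using b[OF D0] by simp
  next
    case False
    then have "(cmod (\<Sum>y\<in>F. cnj (c y) * f y))\<^sup>2 / q \<le> Inf {C. rkhs_bound k f C}"
      using D0 q b by (intro cInf_greatest) (auto simp: divide_le_eq)
    then show ?thesis using False q by (simp add: rkhs_norm_square[OF f] divide_le_eq)
  qed
  then show "(cmod (\<Sum>y\<in>F. cnj (c y) * f y))\<^sup>2 \<le> (rkhs_norm k f)\<^sup>2 * Re (qform F k c)"
    by (simp add: q_def)
qed simp

text \<open>Cauchy-Schwarz for \<open>k\<close> bounds the norm from above. Testing the function
  against its own coefficients gives q^2 <= norm^2 q and hence the bound from below.\<close>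

lemma rkhs_kernel_combination:
  fixes a :: "'a \<Rightarrow> complex"
  assumes k: "psd_kernel k" and G: "finite G"
  defines "f \<equiv> \<lambda>z. \<Sum>y\<in>G. a y * k z y"
  shows "rkhs_bound k f (Re (qform G k a))" and "(rkhs_norm k f)\<^sup>2 = Re (qform G k a)"
proof -
  define q where "q = Re (qform G k a)"
  have q: "0 \<le> q" unfolding q_def by (rule psd_kernel_Re_qform[OF k G])
  show b: "rkhs_bound k f (Re (qform G k a))"
    unfolding rkhs_bound_iff
  proof (intro conjI allI impI)
    show "0 \<le> Re (qform G k a)" using q by (simp add: q_def)
    fix F :: "'a set" and c :: "'a \<Rightarrow> complex" assume F: "finite F"
    define U where "U = F \<union> G"
    have U: "finite U" "F \<subseteq> U" "G \<subseteq> U" using F G by (auto simp: U_def)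
    let ?c = "\<lambda>i. if i \<in> F then c i else 0" and ?a = "\<lambda>i. if i \<in> G then a i else 0"
    have inner: "(\<Sum>j\<in>U. ?a j * k i j) = f i" for i
      unfolding f_def using U by (intro sum.mono_neutral_cong_right) auto
    have "(\<Sum>y\<in>F. cnj (c y) * f y) = (\<Sum>i\<in>U. cnj (?c i) * (\<Sum>j\<in>U. ?a j * k i j))"
      unfolding inner using U by (intro sum.mono_neutral_cong_left) auto
    also have "\<dots> = sform U k ?c ?a" by (simp only: sform_def sum_distrib_left mult.assoc)
    finally show "(cmod (\<Sum>y\<in>F. cnj (c y) * f y))\<^sup>2 \<le> Re (qform G k a) * Re (qform F k c)"
      using cauchy_schwarz_psd_on[OF U(1) psd_kernelD[OF k U(1)], of ?c ?a] U
      by (simp add: qform_extend_zero mult.commute)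
  qed
  have inr: "in_rkhs k f" using b by (auto simp: in_rkhs_def)
  have "qform G k a = (\<Sum>y\<in>G. cnj (a y) * f y)"
    unfolding qform_def f_def by (simp only: sum_distrib_left mult.assoc)
  then have "(cmod (qform G k a))\<^sup>2 \<le> (rkhs_norm k f)\<^sup>2 * q"
    using rkhs_bound_norm[OF k inr] G unfolding rkhs_bound_iff q_def by metis
  moreover have "q\<^sup>2 \<le> (cmod (qform G k a))\<^sup>2" by (simp add: q_def cmod_power2)
  ultimately have "q * q \<le> (rkhs_norm k f)\<^sup>2 * q" by (simp add: power2_eq_square)
  then have "q \<le> (rkhs_norm k f)\<^sup>2" using q by (cases "q = 0") auto
  then show "(rkhs_norm k f)\<^sup>2 = Re (qform G k a)"
    using rkhs_norm_square_le[OF b] by (simp add: q_def)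
qed

lemma rkhs_norm_combination:
  assumes k: "psd_kernel k" and I: "finite I"
  shows "rkhs_norm k (\<lambda>z. \<Sum>i\<in>I. a i * k z (x i)) = sqrt (Re (qform I (\<lambda>i j. k (x i) (x j)) a))"
proof -
  let ?A = "\<lambda>y. \<Sum>i\<in>{i\<in>I. x i = y}. a i" and ?f = "\<lambda>z. \<Sum>i\<in>I. a i * k z (x i)"
  have f: "?f = (\<lambda>z. \<Sum>y\<in>x ` I. ?A y * k z y)"
    using sum_aggregate[OF I] by (intro ext)
  have 1: "(rkhs_norm k ?f)\<^sup>2 = Re (qform I (\<lambda>i j. k (x i) (x j)) a)"
    unfolding f qform_pullback[OF I] by (rule rkhs_kernel_combination(2)[OF k]) (use I in simp)
  have "in_rkhs k ?f"
    unfolding f in_rkhs_def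
    by (rule exI, rule rkhs_kernel_combination(1)[OF k]) (use I in simp)
  from real_sqrt_unique[OF 1 rkhs_norm_nonneg[OF this]] show ?thesis by (rule sym)
qed

lemma kvec_norm_eq: "psd_kernel k \<Longrightarrow> kvec_norm k w = sqrt (Re (k w w))"
  using rkhs_norm_combination[of k "{w}" "\<lambda>_. 1" id] by (simp add: kvec_norm_def kvec_def qform_def)

lemma kvec_norm_pos:
  assumes k: "psd_kernel k" and "kvec k w \<noteq> (\<lambda>x. 0)"
  shows "0 < kvec_norm k w"
proof -
  have "0 \<le> k w w" using psd_on_diag_nonneg[OF psd_kernelD[OF k, of "{w}"]] by simp
  moreover have "k w w \<noteq> 0"
  proof
    assume 0: "k w w = 0"
    have "k x w = 0" for x
      by (rule psd_on_zero_diag[OF psd_kernelD[OF k, of "{x, w}"]]) (use 0 in auto)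
    then show False using assms(2) by (simp add: kvec_def)
  qed
  ultimately show ?thesis by (auto simp: kvec_norm_eq[OF k] less_eq_complex_def complex_eq_iff)
qed

lemma kvec_norm_square:
  assumes "psd_kernel k"
  shows "complex_of_real (kvec_norm k w) * of_real (kvec_norm k w) = k w w"
proof -
  have "0 \<le> k w w" using psd_on_diag_nonneg[OF psd_kernelD[OF assms, of "{w}"]] by simp
  then show ?thesis by (simp add: kvec_norm_eq[OF assms] less_eq_complex_def complex_eq_iff flip: of_real_mult)
qed

text \<open>Positivity says that the adjoint of multiplication, which sends the kernel function of
  \<open>l\<close> at y to \<open>cnj (\<phi> y)\<close> times that of \<open>k\<close>, has squared
  norm at most the constant on the right.\<close>

lemma is_mult_iff:
  assumes k: "psd_kernel k" and l: "psd_kernel l"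
  shows "is_mult k l \<phi> \<longleftrightarrow>
    (\<exists>M\<ge>0. \<forall>F. finite F \<longrightarrow> psd_on F (\<lambda>i j. of_real M * l i j - \<phi> i * cnj (\<phi> j) * k i j))"
proof
  assume "is_mult k l \<phi>"
  then obtain M where M: "\<And>f. in_rkhs k f \<Longrightarrow> in_rkhs l (\<lambda>z. \<phi> z * f z)"
     "\<And>f. in_rkhs k f \<Longrightarrow> rkhs_norm l (\<lambda>z. \<phi> z * f z) \<le> M * rkhs_norm k f"
    by (auto simp: is_mult_def)
  have "psd_on F (\<lambda>i j. of_real (M\<^sup>2) * l i j - \<phi> i * cnj (\<phi> j) * k i j)" if F: "finite F" for F
  proof (rule psd_onI)
    fix c
    \<comment> \<open>Coefficients of the image under the adjoint of the combination of kernel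
      functions of \<open>l\<close> with coefficients \<open>c\<close>.\<close>
    define a where "a y = cnj (\<phi> y) * c y" for y
    define f where "f z = (\<Sum>y\<in>F. a y * k z y)" for z
    define N where "N = Re (qform F k a)"
    define q where "q = Re (qform F l c)"
    have qs: "qform F k a = of_real N" "qform F l c = of_real q" "0 \<le> N" "0 \<le> q"
      using psd_onD[OF psd_kernelD[OF k F], of a] psd_onD[OF psd_kernelD[OF l F], of c]
      by (auto simp: N_def q_def less_eq_complex_def complex_eq_iff)
    have f: "in_rkhs k f" "(rkhs_norm k f)\<^sup>2 = N"
      using rkhs_kernel_combination[OF k F, of a] by (auto simp: in_rkhs_def f_def[abs_def] N_def)
    have "(rkhs_norm l (\<lambda>z. \<phi> z * f z))\<^sup>2 \<le> (M * rkhs_norm k f)\<^sup>2"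
      using M[OF f(1)] rkhs_norm_nonneg by (intro power_mono) auto
    then have n: "(rkhs_norm l (\<lambda>z. \<phi> z * f z))\<^sup>2 \<le> M\<^sup>2 * N" by (simp add: power_mult_distrib f(2))
    have "(\<Sum>y\<in>F. cnj (c y) * (\<phi> y * f y)) = (\<Sum>y\<in>F. cnj (a y) * f y)"
      by (simp add: a_def mult_ac)
    also have "\<dots> = qform F k a"
      unfolding qform_def f_def by (simp only: sum_distrib_left mult.assoc)
    finally have "N\<^sup>2 \<le> (rkhs_norm l (\<lambda>z. \<phi> z * f z))\<^sup>2 * q"
      using rkhs_bound_norm[OF l M(1)[OF f(1)]] F qs(3) unfolding rkhs_bound_iff q_def
      by (metis norm_of_real abs_of_nonneg qs(1))
    also have "\<dots> \<le> M\<^sup>2 * N * q" using n qs(4) by (rule mult_right_mono)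
    finally have "N * N \<le> N * (M\<^sup>2 * q)" by (simp add: power2_eq_square mult_ac)
    then have "N \<le> M\<^sup>2 * q" using qs(3,4) by (cases "N = 0") auto
    then show "0 \<le> qform F (\<lambda>i j. of_real (M\<^sup>2) * l i j - \<phi> i * cnj (\<phi> j) * k i j) c"
      unfolding qform_diff qform_scale qform_congruence a_def[symmetric] qs(1,2)
      by (simp add: less_eq_complex_def flip: of_real_mult of_real_diff of_real_power)
  qed
  then show "\<exists>M\<ge>0. \<forall>F. finite F \<longrightarrow> psd_on F (\<lambda>i j. of_real M * l i j - \<phi> i * cnj (\<phi> j) * k i j)"
    by (intro exI[of _ "M\<^sup>2"]) auto
next
  assume "\<exists>M\<ge>0. \<forall>F. finite F \<longrightarrow> psd_on F (\<lambda>i j. of_real M * l i j - \<phi> i * cnj (\<phi> j) * k i j)"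
  then obtain M where M: "0 \<le> M"
    "\<And>F. finite F \<Longrightarrow> psd_on F (\<lambda>i j. of_real M * l i j - \<phi> i * cnj (\<phi> j) * k i j)" by blast
  have b: "rkhs_bound l (\<lambda>z. \<phi> z * f z) (M * (rkhs_norm k f)\<^sup>2)" if f: "in_rkhs k f" for f
    unfolding rkhs_bound_iff
  proof (intro conjI allI impI)
    show "0 \<le> M * (rkhs_norm k f)\<^sup>2" using M(1) by simp
    fix F :: "'a set" and c assume F: "finite F"
    have "(\<Sum>y\<in>F. cnj (c y) * (\<phi> y * f y)) = (\<Sum>y\<in>F. cnj (cnj (\<phi> y) * c y) * f y)"
      by (simp add: mult_ac)
    then have "(cmod (\<Sum>y\<in>F. cnj (c y) * (\<phi> y * f y)))\<^sup>2 \<le> (rkhs_norm k f)\<^sup>2 * Re (qform F k (\<lambda>y. cnj (\<phi> y) * c y))"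
      using rkhs_bound_norm[OF k f] F unfolding rkhs_bound_iff by metis
    also have "\<dots> \<le> (rkhs_norm k f)\<^sup>2 * (M * Re (qform F l c))"
    proof (rule mult_left_mono)
      show "Re (qform F k (\<lambda>y. cnj (\<phi> y) * c y)) \<le> M * Re (qform F l c)"
      using psd_onD[OF M(2)[OF F], of c]
      by (simp add: qform_diff qform_scale qform_congruence less_eq_complex_def)
    qed simp
    finally show "(cmod (\<Sum>y\<in>F. cnj (c y) * (\<phi> y * f y)))\<^sup>2 \<le> M * (rkhs_norm k f)\<^sup>2 * Re (qform F l c)"
      by (simp only: mult_ac)
  qed
  show "is_mult k l \<phi>"
    unfolding is_mult_def
  proof (intro exI[of _ "sqrt M"] allI impI conjI)
    fix f assume f: "in_rkhs k f"
    show "in_rkhs l (\<lambda>z. \<phi> z * f z)" using b[OF f] by (auto simp: in_rkhs_def)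
    show "rkhs_norm l (\<lambda>z. \<phi> z * f z) \<le> sqrt M * rkhs_norm k f"
      using rkhs_norm_square_le[OF b[OF f]] M(1) rkhs_norm_nonneg[OF f]
      by (intro power2_le_imp_le[OF _ mult_nonneg_nonneg]) (auto simp: power_mult_distrib)
  qed
qed

section \<open>Normalized complete Pick kernels\<close>

lemma has_sum_finite_sum:
  fixes f :: "'i \<Rightarrow> 'm \<Rightarrow> 'b :: topological_comm_monoid_add"
  assumes "finite I" "\<And>i. i \<in> I \<Longrightarrow> (f i has_sum S i) A"
  shows "((\<lambda>m. \<Sum>i\<in>I. f i m) has_sum (\<Sum>i\<in>I. S i)) A"
  using assms by (induction I rule: finite_induct) (auto intro: has_sum_add)

lemma summable_l2_inner:
  assumes "is_l2 u" "is_l2 v"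
  shows "(\<lambda>m. u m * cnj (v m)) summable_on UNIV"
proof (rule abs_summable_summable)
  have "(\<lambda>m. (cmod (u m))\<^sup>2 + (cmod (v m))\<^sup>2) summable_on UNIV"
    using assms unfolding is_l2_def by (rule summable_on_add)
  then show "(\<lambda>m. norm (u m * cnj (v m))) summable_on UNIV"
  proof (rule summable_on_comparison_test)
    fix m
    have "2 * (cmod (u m) * cmod (v m)) \<le> (cmod (u m))\<^sup>2 + (cmod (v m))\<^sup>2"
      using sum_squares_bound[of "cmod (u m)" "cmod (v m)"] by (simp add: mult_ac)
    moreover have "0 \<le> cmod (u m) * cmod (v m)" by simp
    ultimately show "norm (u m * cnj (v m)) \<le> (cmod (u m))\<^sup>2 + (cmod (v m))\<^sup>2"
      unfolding norm_mult complex_mod_cnj by linarith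
  qed simp_all
qed

text \<open>Each coordinate contributes a rank-one kernel, so the form is a convergent sum of
  nonnegative numbers.\<close>

lemma psd_on_l2_inner:
  assumes b: "\<And>z. is_l2 (b z)" and F: "finite F"
  shows "psd_on F (\<lambda>z w. l2_inner (b z) (b w))"
proof (rule psd_onI)
  fix c
  have "((\<lambda>m. b i m * cnj (b j m)) has_sum l2_inner (b i) (b j)) UNIV" for i j
    unfolding l2_inner_def by (intro has_sum_infsum summable_l2_inner b)
  then have sm: "((\<lambda>m. qform F (\<lambda>i j. b i m * cnj (b j m)) c) has_sum
      qform F (\<lambda>z w. l2_inner (b z) (b w)) c) UNIV"
    unfolding qform_def by (intro has_sum_finite_sum has_sum_cmult_right F)
  have "0 \<le> infsum (\<lambda>m. qform F (\<lambda>i j. b i m * cnj (b j m)) c) UNIV"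
    by (rule infsum_nonneg_complex[OF has_sum_imp_summable[OF sm]]) (rule psd_onD[OF psd_on_rank1])
  then show "0 \<le> qform F (\<lambda>z w. l2_inner (b z) (b w)) c"
    by (simp only: infsumI[OF sm])
qed

lemma ncp_kernel_imp_pick_kernel:
  assumes "ncp_kernel b s"
  shows "pick_kernel (\<lambda>z w. l2_inner (b z) (b w)) s"
proof
  fix z w
  have b: "\<And>z. is_l2 (b z)" "l2_norm (b z) < 1" using assms by (auto simp: ncp_kernel_def)
  show "finite F \<Longrightarrow> psd_on F (\<lambda>z w. l2_inner (b z) (b w))" for F
    using psd_on_l2_inner b by blast
  show "s z w = 1 / (1 - l2_inner (b z) (b w))" using assms by (auto simp: ncp_kernel_def)
  have "l2_inner (b z) (b z) = infsum (\<lambda>i. of_real ((cmod (b z i))\<^sup>2)) UNIV"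
    unfolding l2_inner_def by (simp only: complex_norm_square)
  then have "Re (l2_inner (b z) (b z)) = infsum (\<lambda>i. (cmod (b z i))\<^sup>2) UNIV"
    using infsum_Re[OF summable_l2_inner[OF b(1) b(1)], of z z] unfolding complex_norm_square[symmetric] by simp
  moreover have "infsum (\<lambda>i. (cmod (b z i))\<^sup>2) UNIV < 1"
    using b(2) by (simp add: l2_norm_def)
  ultimately show "Re (l2_inner (b z) (b z)) < 1" by simp
qed

lemma psd_on_image:
  assumes "inj_on x I"
  shows "psd_on (x ` I) K \<longleftrightarrow> psd_on I (\<lambda>i j. K (x i) (x j))"
proof
  assume P: "psd_on (x ` I) K"
  show "psd_on I (\<lambda>i j. K (x i) (x j))"
  proof (rule psd_onI)
    fix c
    have "qform I (\<lambda>i j. K (x i) (x j)) c = qform I (\<lambda>i j. K (x i) (x j)) ((\<lambda>y. c (inv_into I x y)) \<circ> x)"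
      by (intro qform_cong) (simp_all add: assms)
    then show "0 \<le> qform I (\<lambda>i j. K (x i) (x j)) c"
      using psd_onD[OF P] by (simp add: qform_reindex[OF assms])
  qed
qed (simp add: psd_on_def qform_reindex[OF assms])

section \<open>Carleson sequences\<close>

context pick_kernel
begin

lemma psd_kernel_s: "psd_kernel s"
  by (simp add: psd_kernel_iff psd_s)

lemma kvec_norm_s: "kvec_norm s = nrm"
  by (simp add: kvec_norm_eq[OF psd_kernel_s] nrm_def fun_eq_iff)

lemma qform_H: "qform F H c = qform F s (\<lambda>y. c y / of_real (nrm y))"
  unfolding qform_def H_def by (intro sum.cong refl) simp

text \<open>Duality between the weighted evaluation map and its adjoint. For the combination
  \<open>f\<close> of normalized kernels with coefficients \<open>c\<close>, its squared norm
  \<open>q\<close> is also the pairing of \<open>c\<close> with the weighted values of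
  \<open>f\<close>; Cauchy-Schwarz and the Carleson bound give q^2 <= D C q.\<close>

lemma carleson_imp_psd:
  assumes inj: "inj lam" and C: "C > 0"
    and carl: "\<And>f. in_rkhs s f \<Longrightarrow> summable (\<lambda>i. (cmod (f (lam i)))\<^sup>2 / (kvec_norm s (lam i))\<^sup>2) \<and>
      (\<Sum>i. (cmod (f (lam i)))\<^sup>2 / (kvec_norm s (lam i))\<^sup>2) \<le> C * (rkhs_norm s f)\<^sup>2"
    and F: "finite F" "F \<subseteq> range lam"
  shows "psd_on F (\<lambda>i j. (if i = j then of_real C else 0) - H i j)"
proof (rule psd_onI)
  fix c :: "'a \<Rightarrow> complex"
  define a where "a y = c y / of_real (nrm y)" for y
  define f where "f z = (\<Sum>y\<in>F. a y * s z y)" for z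
  define q where "q = Re (qform F H c)"
  have q: "qform F H c = of_real q" "0 \<le> q"
    using psd_onD[OF psd_H[OF F(1)], of c] by (auto simp: q_def less_eq_complex_def complex_eq_iff)
  have f: "in_rkhs s f" "(rkhs_norm s f)\<^sup>2 = q"
    using rkhs_kernel_combination[OF psd_kernel_s F(1), of a]
    by (auto simp: in_rkhs_def f_def[abs_def] a_def[abs_def] q_def qform_H)
  define D where "D = (\<Sum>y\<in>F. (cmod (c y))\<^sup>2)"
  define T where "T = (\<Sum>y\<in>F. (cmod (f y) / nrm y)\<^sup>2)"
  obtain I where I: "F = lam ` I" "finite I" using F finite_subset_image by blast
  have injI: "inj_on lam I" using inj inj_on_subset by blast
  have "T = (\<Sum>i\<in>I. (cmod (f (lam i)))\<^sup>2 / (kvec_norm s (lam i))\<^sup>2)"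
    unfolding T_def I(1) by (simp add: sum.reindex[OF injI] kvec_norm_s power_divide)
  also have "\<dots> \<le> (\<Sum>i. (cmod (f (lam i)))\<^sup>2 / (kvec_norm s (lam i))\<^sup>2)"
    using carl[OF f(1)] I(2) by (intro sum_le_suminf) auto
  also have "\<dots> \<le> C * q" using carl[OF f(1)] f(2) by simp
  finally have T: "T \<le> C * q" .
  have "qform F H c = (\<Sum>y\<in>F. cnj (c y) * (f y / of_real (nrm y)))"
    unfolding qform_H unfolding qform_def f_def a_def
    by (intro sum.cong refl) (simp add: sum_distrib_left sum_divide_distrib mult_ac)
  then have "cmod (qform F H c) \<le> (\<Sum>y\<in>F. cmod (cnj (c y) * (f y / of_real (nrm y))))"
    using norm_sum by metis
  then have "q \<le> (\<Sum>y\<in>F. cmod (c y) * (cmod (f y) / nrm y))"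
    using q nrm_pos by (simp add: norm_mult norm_divide abs_of_pos)
  then have "q\<^sup>2 \<le> (\<Sum>y\<in>F. cmod (c y) * (cmod (f y) / nrm y))\<^sup>2"
    using q(2) by (rule power_mono)
  also have "\<dots> \<le> D * T" unfolding D_def T_def by (rule Cauchy_Schwarz_ineq_sum)
  also have "\<dots> \<le> D * (C * q)" using T by (intro mult_left_mono) (auto simp: D_def sum_nonneg)
  finally have "q * q \<le> q * (C * D)" by (simp add: power2_eq_square mult_ac)
  moreover have "0 \<le> C * D" using C by (simp add: D_def sum_nonneg)
  ultimately have "q \<le> C * D" using q(2) by (cases "q = 0") auto
  moreover have "(\<Sum>i\<in>F. of_real ((cmod (c i))\<^sup>2) * complex_of_real C) = of_real (C * D)"
    unfolding D_def by (simp add: sum_distrib_left mult.commute)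
  ultimately show "0 \<le> qform F (\<lambda>i j. (if i = j then of_real C else 0) - H i j) c"
    unfolding qform_diff qform_diag[OF F(1)] q(1) by (simp add: less_eq_complex_def)
qed

text \<open>The dual estimate: a partial sum \<open>T\<close> is the pairing of \<open>f\<close>
  with the kernel combination whose coefficients are \<open>f y\<close> over the squared kernel
  norm, and that combination has squared norm at most C T.\<close>

lemma psd_imp_carleson:
  assumes inj: "inj lam"
    and P: "\<And>F. finite F \<Longrightarrow> F \<subseteq> range lam \<Longrightarrow> psd_on F (\<lambda>i j. (if i = j then of_real C else 0) - H i j)"
    and f: "in_rkhs s f"
  shows "summable (\<lambda>i. (cmod (f (lam i)))\<^sup>2 / (kvec_norm s (lam i))\<^sup>2) \<and>
      (\<Sum>i. (cmod (f (lam i)))\<^sup>2 / (kvec_norm s (lam i))\<^sup>2) \<le> C * (rkhs_norm s f)\<^sup>2"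
proof -
  define N where "N = (rkhs_norm s f)\<^sup>2"
  have part: "(\<Sum>i<n. (cmod (f (lam i)))\<^sup>2 / (kvec_norm s (lam i))\<^sup>2) \<le> C * N" for n
  proof -
    define F where "F = lam ` {..<n}"
    have F: "finite F" "F \<subseteq> range lam" by (auto simp: F_def)
    define T where "T = (\<Sum>y\<in>F. (cmod (f y))\<^sup>2 / (nrm y)\<^sup>2)"
    have T0: "0 \<le> T" by (simp add: T_def sum_nonneg)
    define c where "c y = f y / of_real ((nrm y)\<^sup>2)" for y
    define d where "d y = f y / of_real (nrm y)" for y
    have dd: "(\<Sum>y\<in>F. (cmod (d y))\<^sup>2) = T"
      by (simp add: d_def T_def norm_divide power_divide)
    have "(\<Sum>y\<in>F. cnj (c y) * f y) = of_real T"
      unfolding T_def of_real_sum of_real_divide complex_norm_square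
      by (intro sum.cong refl) (simp add: c_def)
    then have "T\<^sup>2 \<le> N * Re (qform F s c)"
      using rkhs_bound_norm[OF psd_kernel_s f] F(1) T0 unfolding rkhs_bound_iff N_def
      by (metis norm_of_real abs_of_nonneg)
    also have "qform F s c = qform F H d"
      unfolding qform_H by (intro qform_cong) (auto simp: c_def d_def power2_eq_square)
    also have "N * Re (qform F H d) \<le> N * (C * T)"
    proof (rule mult_left_mono)
      have "0 \<le> (\<Sum>i\<in>F. of_real ((cmod (d i))\<^sup>2) * of_real C) - qform F H d"
        using psd_onD[OF P[OF F], of d] by (simp add: qform_diff qform_diag[OF F(1)])
      also have "(\<Sum>i\<in>F. of_real ((cmod (d i))\<^sup>2) * of_real C) = complex_of_real (C * T)"
        by (simp add: sum_distrib_left mult_ac flip: dd)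
      finally show "Re (qform F H d) \<le> C * T" by (simp add: less_eq_complex_def)
    qed (simp add: N_def)
    finally have "T * T \<le> T * (C * N)" by (simp add: power2_eq_square mult_ac)
    have C0: "0 \<le> C * N"
    proof -
      have "0 \<le> of_real C - H (lam 0) (lam 0)"
        using psd_on_diag_nonneg[OF P[of "{lam 0}"]] by simp
      then have "C \<ge> 0" by (simp add: H_diag less_eq_complex_def)
      then show ?thesis by (simp add: N_def)
    qed
    have "T \<le> C * N" using \<open>T * T \<le> T * (C * N)\<close> T0 C0 by (cases "T = 0") auto
    moreover have "inj_on lam {..<n}" using inj inj_on_subset by blast
    ultimately show ?thesis
      by (simp add: T_def F_def sum.reindex kvec_norm_s)
  qed
  have sm: "summable (\<lambda>i. (cmod (f (lam i)))\<^sup>2 / (kvec_norm s (lam i))\<^sup>2)"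
    by (rule summableI_nonneg_bounded[OF _ part]) simp
  then show ?thesis using suminf_le_const[OF sm part] by (simp add: N_def)
qed

lemma carleson_iff:
  assumes "inj lam"
  shows "carleson s lam \<longleftrightarrow> (\<exists>C>0. \<forall>F. finite F \<longrightarrow> F \<subseteq> range lam \<longrightarrow>
     psd_on F (\<lambda>i j. (if i = j then of_real C else 0) - H i j))"
  unfolding carleson_def
  using carleson_imp_psd[OF assms] psd_imp_carleson[OF assms] by meson

end

section \<open>Weakly separated sequences\<close>

lemma span_dist_combination:
  fixes n :: nat
  assumes l: "psd_kernel l" and n: "0 < n"
  shows "rkhs_norm l (\<lambda>z. khat l (\<mu> 0) z - (\<Sum>j\<in>{1..<n}. a j * khat l (\<mu> j) z))
    = sqrt (Re (qform {..<n} (\<lambda>i j. l (\<mu> i) (\<mu> j))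
        (\<lambda>j. (if j = 0 then 1 else - a j) / of_real (kvec_norm l (\<mu> j)))))"
proof -
  let ?d = "\<lambda>j. (if j = 0 then 1 else - a j) / of_real (kvec_norm l (\<mu> j))"
  have set: "{..<n} = insert 0 {1..<n}" using n by auto
  have "khat l (\<mu> 0) z - (\<Sum>j\<in>{1..<n}. a j * khat l (\<mu> j) z) = (\<Sum>j\<in>{..<n}. ?d j * l z (\<mu> j))" for z
    unfolding set by (subst sum.insert) (simp_all add: khat_def kvec_def sum_negf[symmetric])
  then show ?thesis by (simp only: rkhs_norm_combination[OF l finite_lessThan])
qed

text \<open>Dividing a vector by \<open>c i\<close> times the norm at \<open>i\<close> gives the
  normalized kernel at \<open>i\<close> the coefficient 1, so the form becomes a squared distance to
  an element of the span; scaling back yields the constant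
  \<open>\<epsilon>\<^sup>2\<close>.\<close>

lemma weakly_separated_imp_psd:
  assumes l: "psd_kernel l" and pos: "\<And>z. 0 < kvec_norm l z" and ws: "weakly_separated n l lam" and n: "0 < n"
  shows "\<exists>e>0. \<forall>F i. finite F \<longrightarrow> F \<subseteq> range lam \<longrightarrow> card F = n \<longrightarrow> i \<in> F \<longrightarrow>
      psd_on F (\<lambda>x y. l x y - unit_entry i (of_real e * l i i) x y)"
proof -
  obtain \<epsilon> where \<epsilon>: "\<epsilon> > 0" "\<And>\<mu> :: nat \<Rightarrow> 'a. inj_on \<mu> {..<n} \<Longrightarrow> \<mu> ` {..<n} \<subseteq> range lam \<Longrightarrow> \<epsilon> \<le> span_dist l n \<mu>"
    using ws by (auto simp: weakly_separated_def)
  have "psd_on F (\<lambda>x y. l x y - unit_entry i (of_real (\<epsilon>\<^sup>2) * l i i) x y)"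
    if F: "finite F" "F \<subseteq> range lam" "card F = n" "i \<in> F" for F i
  proof (rule psd_onI)
    fix c
    define q where "q = Re (qform F l c)"
    have q: "qform F l c = of_real q" "0 \<le> q"
      using psd_onD[OF psd_kernelD[OF l F(1)], of c] by (auto simp: q_def less_eq_complex_def complex_eq_iff)
    have u: "qform F (unit_entry i (of_real (\<epsilon>\<^sup>2) * l i i)) c
        = of_real ((cmod (c i))\<^sup>2 * (\<epsilon>\<^sup>2 * (kvec_norm l i)\<^sup>2))"
    proof -
      have "qform F (unit_entry i (of_real (\<epsilon>\<^sup>2) * l i i)) c
        = qform F (\<lambda>x y. if x = y then (if x = i then of_real (\<epsilon>\<^sup>2) * l i i else 0) else 0) c"
        by (intro qform_cong) auto
      also have "\<dots> = (\<Sum>x\<in>F. if x = i then of_real ((cmod (c i))\<^sup>2) * (of_real (\<epsilon>\<^sup>2) * l i i) else 0)"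
        unfolding qform_diag[OF F(1)] by (intro sum.cong) auto
      also have "\<dots> = of_real ((cmod (c i))\<^sup>2) * (of_real (\<epsilon>\<^sup>2) * l i i)" using F by simp
      finally show ?thesis by (simp add: power2_eq_square flip: kvec_norm_square[OF l])
    qed
    have "(cmod (c i))\<^sup>2 * (\<epsilon>\<^sup>2 * (kvec_norm l i)\<^sup>2) \<le> q"
    proof (cases "c i = 0")
      case False
      have "card (F - {i}) = n - 1" using F by simp
      then obtain h where h: "bij_betw h {0..<n - 1} (F - {i})"
        using ex_bij_betw_nat_finite[of "F - {i}"] F(1) by auto
      \<comment> \<open>The enumeration starts with \<open>i\<close>, because
        \<open>span_dist\<close> measures the distance from the point of index 0.\<close>
      define \<mu> where "\<mu> j = (if j = 0 then i else h (j - 1))" for j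
      have set: "{..<n} = insert 0 (Suc ` {0..<n - 1})" using n by (force simp: image_iff gr0_conv_Suc)
      have \<mu>S: "\<mu> ` Suc ` {0..<n - 1} = F - {i}"
        unfolding image_image using h by (simp add: \<mu>_def bij_betw_def)
      have im: "\<mu> ` {..<n} = F" unfolding set image_insert \<mu>S using F by (auto simp: \<mu>_def)
      have inj: "inj_on \<mu> {..<n}" using F(3) im by (intro eq_card_imp_inj_on) auto
      \<comment> \<open>Chosen so that the combination in \<open>span_dist\<close> is the one with
        coefficients \<open>c\<close>, divided by \<open>c i * kvec_norm l i\<close>.\<close>
      define a where "a j = - c (\<mu> j) * of_real (kvec_norm l (\<mu> j)) / (c i * of_real (kvec_norm l i))" for j
      have "\<epsilon> \<le> span_dist l n \<mu>" using \<epsilon>(2)[OF inj] im F by simp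
      also have "\<dots> \<le> rkhs_norm l (\<lambda>z. khat l (\<mu> 0) z - (\<Sum>j\<in>{1..<n}. a j * khat l (\<mu> j) z))"
        unfolding span_dist_def
      proof (rule cINF_lower)
        show "bdd_below (range (\<lambda>a. rkhs_norm l (\<lambda>z. khat l (\<mu> 0) z - (\<Sum>j\<in>{1..<n}. a j * khat l (\<mu> j) z))))"
          unfolding span_dist_combination[OF l n]
          using psd_kernel_Re_qform[OF l] by (intro bdd_belowI[of _ 0]) (auto simp: qform_pullback)
      qed simp
      also have "\<dots> = sqrt (Re (qform {..<n} (\<lambda>i j. l (\<mu> i) (\<mu> j)) (\<lambda>j. (1 / (c i * of_real (kvec_norm l i))) * c (\<mu> j))))"
        unfolding span_dist_combination[OF l n]
      proof (intro arg_cong[of _ _ sqrt] arg_cong[of _ _ Re] qform_cong)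
        fix j
        have "complex_of_real (kvec_norm l (\<mu> j)) \<noteq> 0" using pos[of "\<mu> j"] by simp
        moreover have "\<mu> 0 = i" by (simp add: \<mu>_def)
        ultimately show "(if j = 0 then 1 else - a j) / of_real (kvec_norm l (\<mu> j))
            = (1 / (c i * of_real (kvec_norm l i))) * c (\<mu> j)"
          using False by (simp add: a_def)
      qed simp
      also have "qform {..<n} (\<lambda>i j. l (\<mu> i) (\<mu> j)) (\<lambda>j. (1 / (c i * of_real (kvec_norm l i))) * c (\<mu> j))
        = qform F l (\<lambda>y. (1 / (c i * of_real (kvec_norm l i))) * c y)"
        using qform_reindex[OF inj, of l "\<lambda>y. (1 / (c i * of_real (kvec_norm l i))) * c y"] by (simp add: im comp_def)
      also have "\<dots> = of_real (q / ((cmod (c i))\<^sup>2 * (kvec_norm l i)\<^sup>2))"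
      proof -
        have sc: "qform F l (\<lambda>y. t * c y) = of_real ((cmod t)\<^sup>2) * qform F l c" for t
          unfolding qform_def complex_norm_square by (simp add: sum_distrib_left mult_ac)
        show ?thesis unfolding sc q(1) using pos[of i]
          by (simp add: norm_divide norm_mult power_divide power_mult_distrib flip: of_real_mult)
      qed
      finally have "\<epsilon> \<le> sqrt (q / ((cmod (c i))\<^sup>2 * (kvec_norm l i)\<^sup>2))" by simp
      then have "\<epsilon>\<^sup>2 \<le> q / ((cmod (c i))\<^sup>2 * (kvec_norm l i)\<^sup>2)"
        using \<epsilon>(1) q(2) by (metis real_le_rsqrt real_sqrt_le_iff real_sqrt_unique less_imp_le)
      then show ?thesis using False pos[of i] by (simp add: field_simps)
    qed (use q in simp)
    then show "0 \<le> qform F (\<lambda>x y. l x y - unit_entry i (of_real (\<epsilon>\<^sup>2) * l i i) x y) c"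
      unfolding qform_diff u q(1) by (simp add: less_eq_complex_def del: of_real_mult of_real_power)
  qed
  then show ?thesis using \<epsilon>(1) by (intro exI[of _ "\<epsilon>\<^sup>2"]) auto
qed

text \<open>In the lower bound only the diagonal term of index 0 is kept. Its normalized coefficient
  is 1, so the squared distance is at least \<open>d\<close> whatever the other coefficients
  are.\<close>

lemma psd_imp_weakly_separated:
  assumes l: "psd_kernel l" and pos: "\<And>z. 0 < kvec_norm l z" and d: "0 < d" and n: "0 < n"
    and P: "\<And>F. finite F \<Longrightarrow> F \<subseteq> range lam \<Longrightarrow> psd_on F (\<lambda>x y. l x y - (if x = y then of_real d * l x x else 0))"
  shows "weakly_separated n l lam"
  unfolding weakly_separated_def
proof (intro exI[of _ "sqrt d"] conjI allI impI)
  fix \<mu> :: "nat \<Rightarrow> 'a" assume \<mu>: "inj_on \<mu> {..<n} \<and> \<mu> ` {..<n} \<subseteq> range lam"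
  show "sqrt d \<le> span_dist l n \<mu>"
    unfolding span_dist_def span_dist_combination[OF l n]
  proof (rule cINF_greatest, simp, rule real_sqrt_le_mono)
    fix a :: "nat \<Rightarrow> complex"
    let ?e = "\<lambda>j. (if j = 0 then 1 else - a j) / of_real (kvec_norm l (\<mu> j))"
    have "psd_on {..<n} (\<lambda>i j. l (\<mu> i) (\<mu> j) - (if \<mu> i = \<mu> j then of_real d * l (\<mu> i) (\<mu> i) else 0))"
      by (rule psd_on_pullback) (use P \<mu> in auto)
    then have "psd_on {..<n} (\<lambda>i j. l (\<mu> i) (\<mu> j) - (if i = j then of_real d * l (\<mu> i) (\<mu> i) else 0))"
      by (rule iffD1[OF psd_on_cong, rotated]) (use \<mu> in \<open>auto dest: inj_onD\<close>)
    then have "0 \<le> qform {..<n} (\<lambda>i j. l (\<mu> i) (\<mu> j)) ?e - (\<Sum>i<n. of_real ((cmod (?e i))\<^sup>2) * (of_real d * l (\<mu> i) (\<mu> i)))"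
      unfolding qform_diff[symmetric] qform_diag[OF finite_lessThan, symmetric] by (rule psd_onD)
    also have "(\<Sum>i<n. of_real ((cmod (?e i))\<^sup>2) * (of_real d * l (\<mu> i) (\<mu> i)))
        = complex_of_real (\<Sum>i<n. (cmod (?e i))\<^sup>2 * (d * (kvec_norm l (\<mu> i) * kvec_norm l (\<mu> i))))"
      by (simp only: of_real_sum of_real_mult kvec_norm_square[OF l])
    finally have "(\<Sum>i<n. (cmod (?e i))\<^sup>2 * (d * (kvec_norm l (\<mu> i) * kvec_norm l (\<mu> i)))) \<le> Re (qform {..<n} (\<lambda>i j. l (\<mu> i) (\<mu> j)) ?e)"
      by (simp add: less_eq_complex_def)
    moreover have "(cmod (?e 0))\<^sup>2 * (d * (kvec_norm l (\<mu> 0) * kvec_norm l (\<mu> 0)))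
        \<le> (\<Sum>i<n. (cmod (?e i))\<^sup>2 * (d * (kvec_norm l (\<mu> i) * kvec_norm l (\<mu> i))))"
      using n d pos by (intro member_le_sum mult_nonneg_nonneg) (auto simp: less_imp_le)
    moreover have "(cmod (?e 0))\<^sup>2 * (d * (kvec_norm l (\<mu> 0) * kvec_norm l (\<mu> 0))) = d"
      using pos[of "\<mu> 0"] by (simp add: norm_divide power2_eq_square)
    ultimately show "d \<le> Re (qform {..<n} (\<lambda>i j. l (\<mu> i) (\<mu> j)) ?e)" by linarith
  qed
qed (use d in simp)

section \<open>Uniform boundedness and choice of signs\<close>

text \<open>The average of the form over all signs is its diagonal part. The signs are chosen one
  point at a time so that the new cross term \<open>2 * Re (t * X)\<close> is nonnegative.\<close>

lemma sign_choice:
  assumes "finite F" and "\<And>i j. i \<in> F \<Longrightarrow> j \<in> F \<Longrightarrow> K j i = cnj (K i j)"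
  shows "\<exists>e. (\<forall>i. e i = 1 \<or> e i = -1) \<and>
    (\<Sum>i\<in>F. (cmod (c i))\<^sup>2 * Re (K i i)) \<le> Re (qform F K (\<lambda>i. e i * c i))"
  using assms
proof (induction F rule: finite_induct)
  case empty
  show ?case by (intro exI[of _ "\<lambda>_. 1"]) (simp add: qform_def)
next
  case (insert y F)
  then obtain e where e: "\<forall>i. e i = 1 \<or> e i = -1"
    "(\<Sum>i\<in>F. (cmod (c i))\<^sup>2 * Re (K i i)) \<le> Re (qform F K (\<lambda>i. e i * c i))" by blast
  define X where "X = cnj (c y) * (\<Sum>j\<in>F. e j * c j * K y j)"
  define t :: complex where "t = (if Re X \<ge> 0 then 1 else -1)"
  define e' where "e' = e(y := t)"
  have t: "t = 1 \<or> t = -1" "cnj t = t" "t * t = 1" "0 \<le> Re (t * X)" by (auto simp: t_def)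
  have cnje: "cnj (e i) = e i" for i using e(1) by (metis complex_cnj_minus complex_cnj_one)
  have e'y: "e' y = t" by (simp add: e'_def)
  have eF: "e' i = e i" if "i \<in> F" for i using that insert.hyps by (auto simp: e'_def)
  have q: "qform F K (\<lambda>i. e' i * c i) = qform F K (\<lambda>i. e i * c i)"
    by (intro qform_cong) (auto simp: eF)
  have 1: "(\<Sum>j\<in>F. cnj (e' y * c y) * (e' j * c j) * K y j) = t * X"
    unfolding X_def sum_distrib_left by (intro sum.cong refl) (simp add: eF e'y t mult_ac)
  have 2: "(\<Sum>i\<in>F. cnj (e' i * c i) * (e' y * c y) * K i y) = cnj (t * X)"
    unfolding X_def complex_cnj_mult cnj_sum sum_distrib_left t(2)
    by (intro sum.cong refl) (simp add: eF e'y cnje insert.prems[of y] mult_ac)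
  have 3: "cnj (e' y * c y) * (e' y * c y) * K y y = of_real ((cmod (c y))\<^sup>2) * K y y"
  proof -
    have "cnj (e' y * c y) * (e' y * c y) * K y y = (t * t) * (c y * cnj (c y)) * K y y"
      by (simp add: e'_def t(2) mult_ac)
    then show ?thesis by (simp only: t(3) complex_norm_square mult_1)
  qed
  have "Re (qform (insert y F) K (\<lambda>i. e' i * c i))
      = (cmod (c y))\<^sup>2 * Re (K y y) + 2 * Re (t * X) + Re (qform F K (\<lambda>i. e i * c i))"
    unfolding qform_insert[OF insert.hyps] 1 2 3 q by simp
  then have "(\<Sum>i\<in>insert y F. (cmod (c i))\<^sup>2 * Re (K i i)) \<le> Re (qform (insert y F) K (\<lambda>i. e' i * c i))"
    using e(2) t(4) insert.hyps by simp
  moreover have "\<forall>i. e' i = 1 \<or> e' i = -1" using e(1) t(1) by (simp add: e'_def)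
  ultimately show ?case by blast
qed

text \<open>The parallelogram law with the form of the sum dropped.\<close>

lemma qform_diff_le:
  assumes "finite F" "psd_on F K"
  shows "Re (qform F K (\<lambda>i. x i - y i)) \<le> 2 * Re (qform F K x) + 2 * Re (qform F K y)"
proof -
  have "qform F K (\<lambda>i. x i - y i) + qform F K (\<lambda>i. x i + y i) = 2 * qform F K x + 2 * qform F K y"
    unfolding qform_def sum_distrib_left sum.distrib[symmetric]
    by (intro sum.cong refl) (simp add: algebra_simps)
  then have "Re (qform F K (\<lambda>i. x i - y i)) + Re (qform F K (\<lambda>i. x i + y i)) = 2 * Re (qform F K x) + 2 * Re (qform F K y)"
    by (metis Re_complex_of_real mult_2 plus_complex.simps(1))
  then show ?thesis using psd_onD[OF assms(2), of "\<lambda>i. x i + y i"] by (simp add: less_eq_complex_def)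
qed

text \<open>The type \<open>nat\<close> is not a metric space in the library, so the Baire category theorem is applied to bounded
  continuous functions on the real line instead of bounded sequences.\<close>

lemma bounded_sequence_extension:
  fixes w :: "nat \<Rightarrow> complex"
  assumes "\<And>i. cmod (w i) \<le> B"
  shows "\<exists>v :: real \<Rightarrow>\<^sub>C complex. (\<forall>i. apply_bcontfun v (real i) = w i) \<and> norm v \<le> B"
proof -
  let ?S = "real ` UNIV" and ?f = "\<lambda>x. w (nat \<lfloor>x\<rfloor>)"
  have "uniform_discrete ?S"
    unfolding uniform_discrete_def
    by (intro exI[of _ 1]) (auto simp: dist_real_def)
  then have c: "continuous_on ?S ?f"
    by (intro continuous_on_discrete uniform_discrete_imp_discrete)
  have B: "0 \<le> B" using assms[of 0] norm_ge_zero order_trans by blast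
  \<comment> \<open>The natural numbers form a closed discrete subset of the line, and Tietze
    extension from it preserves the bound \<open>B\<close>.\<close>
  obtain h where h: "continuous_on UNIV h" "\<And>x. x \<in> ?S \<Longrightarrow> h x = ?f x" "\<And>x. cmod (h x) \<le> B"
    by (rule Tietze[OF c, of UNIV B]) (use B assms closed_of_nat_image in auto)
  then have "h \<in> bcontfun" by (auto simp: bcontfun_def bounded_iff)
  then obtain v where v: "h = apply_bcontfun v" by (rule bcontfunE)
  show ?thesis
  proof (intro exI conjI allI)
    show "apply_bcontfun v (real i) = w i" for i using h(2)[of "real i"] by (simp add: v)
    show "norm v \<le> B" using h(3) by (intro norm_bound) (simp add: v)
  qed
qed

text \<open>The sets \<open>E m\<close> of targets with constant \<open>m\<close> are closed and
  cover the space, so one of them contains a ball about some \<open>w0\<close>. A target in the unit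
  ball times the radius is a difference of two members of that ball; as the form is quadratic in the
  target, the constant becomes 4 m / r^2.\<close>

lemma uniform_diagonal_bound:
  fixes H L :: "nat \<Rightarrow> nat \<Rightarrow> complex"
  assumes H: "\<And>F. finite F \<Longrightarrow> psd_on F H" and L: "\<And>F. finite F \<Longrightarrow> psd_on F L"
    and bd: "\<And>w. \<exists>B. \<forall>i. cmod (w i) \<le> B \<Longrightarrow>
      \<exists>M. \<forall>F c. finite F \<longrightarrow> Re (qform F H (\<lambda>i. cnj (w i) * c i)) \<le> M * Re (qform F L c)"
  shows "\<exists>M>0. \<forall>w F c. (\<forall>i. cmod (w i) \<le> 1) \<longrightarrow> finite F \<longrightarrow>
      Re (qform F H (\<lambda>i. cnj (w i) * c i)) \<le> M * Re (qform F L c)"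
proof -
  define E where "E m = {w :: real \<Rightarrow>\<^sub>C complex. \<forall>F c. finite F \<longrightarrow>
     Re (qform F H (\<lambda>i. cnj (apply_bcontfun w (real i)) * c i)) \<le> real m * Re (qform F L c)}" for m
  have Lnn: "0 \<le> Re (qform F L c)" if "finite F" for F c
    using psd_onD[OF L[OF that], of c] by (simp add: less_eq_complex_def)
  have cont: "continuous_on UNIV (\<lambda>w :: real \<Rightarrow>\<^sub>C complex. apply_bcontfun w (real i))" for i
    unfolding continuous_on_iff using dist_bounded by (metis le_less_trans)
  have closed: "closed (E m)" for m
  proof -
    have "closed {w. finite F \<longrightarrow> Re (qform F H (\<lambda>i. cnj (apply_bcontfun w (real i)) * c i)) \<le> real m * Re (qform F L c)}" for F c
      unfolding qform_def by (intro closed_Collect_imp closed_Collect_le cont continuous_intros) simp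
    moreover have "E m = (\<Inter>F. \<Inter>c. {w. finite F \<longrightarrow> Re (qform F H (\<lambda>i. cnj (apply_bcontfun w (real i)) * c i)) \<le> real m * Re (qform F L c)})"
      by (auto simp: E_def)
    ultimately show ?thesis by (auto intro!: closed_INT)
  qed
  have cover: "\<exists>m. w \<in> E m" for w
  proof -
    have "\<exists>B. \<forall>i. cmod (apply_bcontfun w (real i)) \<le> B" using norm_bounded by blast
    from bd[OF this] obtain M where M: "\<And>F c. finite F \<Longrightarrow> Re (qform F H (\<lambda>i. cnj (apply_bcontfun w (real i)) * c i)) \<le> M * Re (qform F L c)"
      by blast
    obtain m where m: "M \<le> real m" using real_arch_simple by blast
    have "Re (qform F H (\<lambda>i. cnj (apply_bcontfun w (real i)) * c i)) \<le> real m * Re (qform F L c)" if "finite F" for F c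
      using M[OF that, of c] mult_right_mono[OF m Lnn[OF that, of c]] by linarith
    then show ?thesis by (auto simp: E_def)
  qed
  have "\<exists>m. interior (E m) \<noteq> {}"
  proof (rule ccontr)
    assume "\<nexists>m. interior (E m) \<noteq> {}"
    then have "Met_TC.mtopology interior_of \<Union>(range E) = {}"
    proof (intro Met_TC.metric_Baire_category_alt)
      have "complete (UNIV :: (real \<Rightarrow>\<^sub>C complex) set)" by (rule complete_UNIV)
      then show "Met_TC.mcomplete TYPE(real \<Rightarrow>\<^sub>C complex)" by simp
    qed (use closed \<open>\<nexists>m. interior (E m) \<noteq> {}\<close> in auto)
    moreover have "\<Union>(range E) = UNIV" using cover by blast
    ultimately show False by simp
  qed
  then obtain m w0 where "w0 \<in> interior (E m)" by blast
  then obtain r where r: "r > 0" "cball w0 r \<subseteq> E m" using mem_interior_cball by blast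
  have main: "Re (qform F H (\<lambda>i. cnj (w i) * c i)) \<le> (4 * real m / r\<^sup>2) * Re (qform F L c)"
    if w: "\<forall>i. cmod (w i) \<le> 1" and F: "finite F" for w F c
  proof -
    have "cmod (of_real r * w i) \<le> r" for i
      using w r(1) by (simp add: norm_mult mult_left_le)
    then obtain v :: "real \<Rightarrow>\<^sub>C complex" where
      v: "\<And>i. apply_bcontfun v (real i) = of_real r * w i" "norm v \<le> r"
      using bounded_sequence_extension[of "\<lambda>i. of_real r * w i" r] by blast
    have in1: "w0 + v \<in> E m" and in2: "w0 \<in> E m"
      using r v(2) by (auto intro!: subsetD[OF r(2)] simp: dist_norm)
    let ?x = "\<lambda>i. cnj (apply_bcontfun (w0 + v) (real i)) * c i" and ?y = "\<lambda>i. cnj (apply_bcontfun w0 (real i)) * c i"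
    have "r\<^sup>2 * Re (qform F H (\<lambda>i. cnj (w i) * c i)) = Re (qform F H (\<lambda>i. ?x i - ?y i))"
    proof -
      have "(\<lambda>i. ?x i - ?y i) = (\<lambda>i. of_real r * (cnj (w i) * c i))"
        by (auto simp: plus_bcontfun.rep_eq v(1) algebra_simps)
      moreover have "qform F H (\<lambda>i. of_real r * d i) = of_real (r\<^sup>2) * qform F H d" for d
        by (simp add: qform_def sum_distrib_left power2_eq_square mult_ac)
      ultimately show ?thesis by simp
    qed
    also have "\<dots> \<le> 2 * Re (qform F H ?x) + 2 * Re (qform F H ?y)"
      by (rule qform_diff_le[OF F H[OF F]])
    also have "\<dots> \<le> 4 * real m * Re (qform F L c)"
    proof -
      have "Re (qform F H ?x) \<le> real m * Re (qform F L c)" "Re (qform F H ?y) \<le> real m * Re (qform F L c)"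
        using in1 in2 F unfolding E_def by blast+
      then show ?thesis by linarith
    qed
    finally show ?thesis using r(1) by (simp add: field_simps)
  qed
  \<comment> \<open>The summand 1 makes the constant strictly positive even if \<open>m\<close> is
    0.\<close>
  have "Re (qform F H (\<lambda>i. cnj (w i) * c i)) \<le> (4 * real m / r\<^sup>2 + 1) * Re (qform F L c)"
    if "\<forall>i. cmod (w i) \<le> 1" "finite F" for w F c
    using main[OF that, of c] Lnn[OF that(2), of c] by (simp add: algebra_simps)
  moreover have "0 < 4 * real m / r\<^sup>2 + 1" by (simp add: add_nonneg_pos)
  ultimately show ?thesis by blast
qed

section \<open>Interpolating sequences\<close>

context pick_kernel
begin

section \<open>Necessity: matrix bounds from interpolation\<close>

lemma psd_kernel_mult: "psd_kernel g \<Longrightarrow> psd_kernel (\<lambda>z w. g z w * s z w)"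
  by (simp add: psd_kernel_iff psd_on_schur_product psd_s)

lemma interpolating_imp_psd:
  assumes l: "psd_kernel l" and pos: "\<And>z. 0 < kvec_norm l z" and inj: "inj lam"
    and int: "interpolating s l lam"
  shows "\<exists>M>0. \<forall>F. finite F \<longrightarrow> F \<subseteq> range lam \<longrightarrow>
      psd_on F (\<lambda>x y. l x y - (if x = y then of_real (1 / M) * l x x else 0)) \<and>
      psd_on F (\<lambda>x y. (if x = y then of_real M else 0) - H x y)"
proof -
  define n where "n i = kvec_norm l (lam i)" for i
  have n: "n i > 0" "complex_of_real (n i) \<noteq> 0" for i using pos[of "lam i"] by (auto simp: n_def)
  define Hn where "Hn i j = H (lam i) (lam j)" for i j
  define Ln where "Ln i j = 1 / of_real (n i) * cnj (1 / of_real (n j)) * l (lam i) (lam j)" for i j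
  have pl: "psd_on I (\<lambda>i j. l (lam i) (lam j))" if "finite I" for I
    by (rule psd_on_pullback[OF that psd_kernelD[OF l]]) (use that in simp)
  have pH: "psd_on I Hn" if "finite I" for I
    unfolding Hn_def[abs_def] by (rule psd_on_pullback[OF that psd_H]) (use that in simp)
  have pL: "psd_on I Ln" if "finite I" for I
    unfolding Ln_def[abs_def] by (intro psd_on_congruence pl that)
  have Hd: "Hn i i = 1" for i by (simp add: Hn_def H_diag)
  have Ld: "Ln i i = 1" for i
    unfolding Ln_def kvec_norm_square[OF l, symmetric] using n(2)[of i] by (simp add: n_def)
  have bd: "\<exists>M. \<forall>I c. finite I \<longrightarrow> Re (qform I Hn (\<lambda>i. cnj (w i) * c i)) \<le> M * Re (qform I Ln c)"
    if "\<exists>B. \<forall>i. cmod (w i) \<le> B" for w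
  proof -
    have "\<exists>\<phi>. is_mult s l \<phi> \<and> (\<forall>i. \<phi> (lam i) = w i * complex_of_real (n i / nrm (lam i)))"
      using int[unfolded interpolating_def, rule_format, OF that] by (simp add: kvec_norm_s n_def)
    then obtain \<phi> where \<phi>: "is_mult s l \<phi>"
      "\<And>i. \<phi> (lam i) = w i * complex_of_real (n i / nrm (lam i))"
      by auto
    obtain M where M: "\<And>F. finite F \<Longrightarrow> psd_on F (\<lambda>i j. of_real M * l i j - \<phi> i * cnj (\<phi> j) * s i j)"
      using \<phi>(1) unfolding is_mult_iff[OF psd_kernel_s l] by blast
    have "Re (qform I Hn (\<lambda>i. cnj (w i) * c i)) \<le> M * Re (qform I Ln c)" if I: "finite I" for I c
    proof -
      have P: "psd_on I (\<lambda>i j. of_real M * l (lam i) (lam j) - \<phi> (lam i) * cnj (\<phi> (lam j)) * s (lam i) (lam j))"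
        by (rule psd_on_pullback[OF I M]) (use I in simp)
      \<comment> \<open>Dividing by the norms for \<open>l\<close> turns the prescribed values into
        the bare targets \<open>w\<close>, with both Gram matrices normalized.\<close>
      have "psd_on I (\<lambda>i j. of_real M * Ln i j - w i * cnj (w j) * Hn i j)"
        by (rule iffD1[OF psd_on_cong psd_on_congruence[OF P, of "\<lambda>i. 1 / of_real (n i)"]])
           (use n(2) nrm_pos in \<open>simp add: \<phi>(2) Ln_def Hn_def H_def field_simps\<close>)
      then show ?thesis
        using psd_onD[of I _ c] by (fastforce simp: qform_diff qform_scale qform_congruence less_eq_complex_def)
    qed
    then show ?thesis by blast
  qed
  obtain M where M: "M > 0" "\<And>w I c. (\<And>i. cmod (w i) \<le> 1) \<Longrightarrow> finite I \<Longrightarrow>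
      Re (qform I Hn (\<lambda>i. cnj (w i) * c i)) \<le> M * Re (qform I Ln c)"
    using uniform_diagonal_bound[OF pH pL bd] by blast
  have sgn: "cmod (e i) \<le> 1" "cnj (e i) = e i" "e i * (e i * z) = z"
    if "\<forall>i. e i = 1 \<or> e i = -1" for e :: "nat \<Rightarrow> complex" and i z
    using that[rule_format, of i] by auto
  have lower: "psd_on I (\<lambda>i j. Ln i j - (if i = j then of_real (1 / M) else 0))" if I: "finite I" for I
  proof (rule psd_onI)
    fix c
    \<comment> \<open>With these signs as target, the form of \<open>Hn\<close> is at least its
      diagonal part, which gives the lower bound for \<open>Ln\<close>.\<close>
    have "\<exists>e. (\<forall>i. e i = 1 \<or> e i = -1) \<and>
      (\<Sum>i\<in>I. (cmod (c i))\<^sup>2 * Re (Hn i i)) \<le> Re (qform I Hn (\<lambda>i. e i * c i))"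
      by (rule sign_choice[OF I]) (rule psd_on_hermitian[OF pH[OF I] I])
    then obtain e where e: "\<forall>i. e i = 1 \<or> e i = -1"
      "(\<Sum>i\<in>I. (cmod (c i))\<^sup>2 * Re (Hn i i)) \<le> Re (qform I Hn (\<lambda>i. e i * c i))"
      by (elim exE conjE)
    have "Re (qform I Hn (\<lambda>i. cnj (e i) * c i)) \<le> M * Re (qform I Ln c)"
      by (rule M(2)[OF sgn(1)[OF e(1)] I])
    then have "(\<Sum>i\<in>I. (cmod (c i))\<^sup>2) \<le> M * Re (qform I Ln c)"
      using e(2) by (simp add: sgn(2)[OF e(1)] Hd)
    then have "(\<Sum>i\<in>I. (cmod (c i))\<^sup>2) / M \<le> Re (qform I Ln c)" using M(1) by (simp add: field_simps)
    moreover have "Im (qform I Ln c) = 0" using psd_onD[OF pL[OF I], of c] by (simp add: less_eq_complex_def)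
    moreover have "qform I (\<lambda>i j. if i = j then of_real (1 / M) else 0) c = of_real ((\<Sum>i\<in>I. (cmod (c i))\<^sup>2) / M)"
      unfolding qform_diag[OF I] by (simp add: sum_divide_distrib)
    ultimately show "0 \<le> qform I (\<lambda>i j. Ln i j - (if i = j then of_real (1 / M) else 0)) c"
      unfolding qform_diff by (simp add: less_eq_complex_def del: of_real_divide)
  qed
  have upper: "psd_on I (\<lambda>i j. (if i = j then of_real M else 0) - Hn i j)" if I: "finite I" for I
  proof (rule psd_onI)
    fix c
    have neg: "qform I (\<lambda>i j. - Ln i j) d = - qform I Ln d" for d
      using qform_scale[of I "-1" Ln d] by simp
    \<comment> \<open>For the negated matrix the signs make the form of \<open>Ln\<close> at the
      signed vector at most its diagonal part. Using the same signs as target undoes them in the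
      form of \<open>Hn\<close>, because their squares are 1.\<close>
    have "- Ln j i = cnj (- Ln i j)" if "i \<in> I" "j \<in> I" for i j
      unfolding psd_on_hermitian[OF pL[OF I] I that] by simp
    then have "\<exists>e. (\<forall>i. e i = 1 \<or> e i = -1) \<and>
      (\<Sum>i\<in>I. (cmod (c i))\<^sup>2 * Re (- Ln i i)) \<le> Re (qform I (\<lambda>i j. - Ln i j) (\<lambda>i. e i * c i))"
      by (rule sign_choice[OF I])
    then obtain e where e: "\<forall>i. e i = 1 \<or> e i = -1"
      "(\<Sum>i\<in>I. (cmod (c i))\<^sup>2 * Re (- Ln i i)) \<le> Re (qform I (\<lambda>i j. - Ln i j) (\<lambda>i. e i * c i))"
      by (elim exE conjE)
    have "Re (qform I Hn (\<lambda>i. cnj (e i) * (e i * c i))) \<le> M * Re (qform I Ln (\<lambda>i. e i * c i))"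
      by (rule M(2)[OF sgn(1)[OF e(1)] I])
    moreover have "Re (qform I Ln (\<lambda>i. e i * c i)) \<le> (\<Sum>i\<in>I. (cmod (c i))\<^sup>2)"
      using e(2) by (simp add: neg Ld sum_negf)
    then have "M * Re (qform I Ln (\<lambda>i. e i * c i)) \<le> M * (\<Sum>i\<in>I. (cmod (c i))\<^sup>2)"
      using M(1) by simp
    ultimately have "Re (qform I Hn c) \<le> M * (\<Sum>i\<in>I. (cmod (c i))\<^sup>2)"
      unfolding sgn(2,3)[OF e(1)] by (rule order_trans)
    moreover have "Im (qform I Hn c) = 0" using psd_onD[OF pH[OF I], of c] by (simp add: less_eq_complex_def)
    moreover have "qform I (\<lambda>i j. if i = j then of_real M else 0) c = of_real (M * (\<Sum>i\<in>I. (cmod (c i))\<^sup>2))"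
      unfolding qform_diag[OF I] by (simp add: sum_distrib_left mult.commute)
    ultimately show "0 \<le> qform I (\<lambda>i j. (if i = j then of_real M else 0) - Hn i j) c"
      unfolding qform_diff by (simp add: less_eq_complex_def del: of_real_mult of_real_sum)
  qed
  have "psd_on F (\<lambda>x y. l x y - (if x = y then of_real (1 / M) * l x x else 0)) \<and>
      psd_on F (\<lambda>x y. (if x = y then of_real M else 0) - H x y)"
    if fin: "finite F" "F \<subseteq> range lam" for F
  proof -
    obtain I where I: "finite I" and F: "F = lam ` I"
      using finite_subset_image[OF fin] by auto
    have injI: "inj_on lam I" using inj inj_on_subset by blast
    have "psd_on I (\<lambda>i j. l (lam i) (lam j) - (if lam i = lam j then of_real (1 / M) * l (lam i) (lam i) else 0))"
    proof (rule iffD1[OF psd_on_cong psd_on_congruence[OF lower[OF I], of "\<lambda>i. of_real (n i)"]])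
      fix i j
      have "l (lam i) (lam i) = of_real (n i) * of_real (n i)" for i
        using kvec_norm_square[OF l, of "lam i"] by (simp add: n_def)
      then show "of_real (n i) * cnj (of_real (n j)) * (Ln i j - (if i = j then of_real (1 / M) else 0))
        = l (lam i) (lam j) - (if lam i = lam j then of_real (1 / M) * l (lam i) (lam i) else 0)"
        using n(2)[of i] n(2)[of j] inj by (auto simp: Ln_def inj_eq right_diff_distrib)
    qed
    moreover have "psd_on I (\<lambda>i j. (if lam i = lam j then of_real M else 0) - H (lam i) (lam j))"
      by (rule iffD1[OF psd_on_cong upper[OF I]]) (use inj in \<open>simp add: Hn_def inj_eq\<close>)
    ultimately show ?thesis unfolding F psd_on_image[OF injI] by simp
  qed
  then show ?thesis using M(1) by blast
qed

section \<open>Sufficiency: from Carleson and weak separation to interpolation\<close>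

lemma psd_on_unit_entry_mono:
  assumes "psd_on F (\<lambda>x y. K x y - unit_entry i (of_real e * k) x y)" "e' \<le> e" "finite F" "0 \<le> k"
  shows "psd_on F (\<lambda>x y. K x y - unit_entry i (of_real e' * k) x y)"
proof -
  have "0 \<le> complex_of_real (e - e')" using assms(2) by (simp add: less_eq_complex_def)
  then have "0 \<le> complex_of_real (e - e') * k" using assms(4) by (rule mult_nonneg_nonneg)
  from psd_on_add[OF assms(1) psd_on_unit_entry[OF assms(3) this, of i]] show ?thesis
    by (rule iffD1[OF psd_on_cong, rotated]) (simp add: algebra_simps)
qed

text \<open>The separation constants for the finitely many cardinalities up to \<open>m\<close> have
  a positive minimum. Sets with one point, which weak separation does not cover, admit the constant
  1.\<close>

lemma weakly_separated_small_sets: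
  assumes l: "psd_kernel l" and pos: "\<And>z. 0 < kvec_norm l z"
    and ws: "\<And>n. n \<ge> 2 \<Longrightarrow> weakly_separated n l lam"
  shows "\<exists>e>0. \<forall>F i. finite F \<longrightarrow> F \<subseteq> range lam \<longrightarrow> card F \<le> m \<longrightarrow> i \<in> F \<longrightarrow>
      psd_on F (\<lambda>x y. l x y - unit_entry i (of_real e * l i i) x y)"
proof (induction m)
  case 0
  show ?case by (rule exI[of _ 1]) auto
next
  case (Suc m)
  have ld: "0 \<le> l i i" for i using psd_on_diag_nonneg[OF psd_kernelD[OF l, of "{i}"]] by simp
  obtain e1 where e1: "e1 > 0" "\<And>F i. finite F \<Longrightarrow> F \<subseteq> range lam \<Longrightarrow> card F \<le> m \<Longrightarrow> i \<in> F \<Longrightarrow>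
      psd_on F (\<lambda>x y. l x y - unit_entry i (of_real e1 * l i i) x y)"
    using Suc by blast
  obtain e2 where e2: "e2 > 0" "\<And>F i. finite F \<Longrightarrow> F \<subseteq> range lam \<Longrightarrow> card F = Suc m \<Longrightarrow> i \<in> F \<Longrightarrow>
      psd_on F (\<lambda>x y. l x y - unit_entry i (of_real e2 * l i i) x y)"
  proof (cases "m = 0")
    case True
    have "psd_on F (\<lambda>x y. l x y - unit_entry i (of_real 1 * l i i) x y)"
      if "card F = Suc m" "i \<in> F" for F i
    proof -
      have "F = {i}" using that True by (auto simp: card_Suc_eq)
      then show ?thesis using psd_on_zero[of F]
        by (subst psd_on_cong[where K' = "\<lambda>x y. 0"]) auto
    qed
    then show ?thesis using that[of 1] by auto
  next
    case False
    then show ?thesis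
      using weakly_separated_imp_psd[OF l pos ws, of "Suc m"] that by auto
  qed
  have "psd_on F (\<lambda>x y. l x y - unit_entry i (of_real (min e1 e2) * l i i) x y)"
    if F: "finite F" "F \<subseteq> range lam" "card F \<le> Suc m" "i \<in> F" for F i
  proof (cases "card F = Suc m")
    case True
    show ?thesis
      by (rule psd_on_unit_entry_mono[OF e2(2)[OF F(1,2) True F(4)] _ F(1) ld]) simp
  next
    case False
    then show ?thesis using F(3)
      by (intro psd_on_unit_entry_mono[OF e1(2)[OF F(1,2) _ F(4)] _ F(1) ld]) auto
  qed
  then show ?case using e1(1) e2(1) by (intro exI[of _ "min e1 e2"]) auto
qed

text \<open>Only the sets of near points need weak separation, and \<open>card_near\<close> bounds
  their size by 2 C, so one constant \<open>e\<close> serves every point and every finite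
  set.\<close>

lemma riesz_lower_bound_weakly_separated:
  assumes g: "psd_kernel g" and l_def: "l = (\<lambda>z w. g z w * s z w)"
    and pos: "\<And>z. 0 < kvec_norm l z"
    and C: "C > 0" "\<And>F. finite F \<Longrightarrow> F \<subseteq> range lam \<Longrightarrow> psd_on F (\<lambda>x y. (if x = y then of_real C else 0) - H x y)"
    and ws: "\<And>n. n \<ge> 2 \<Longrightarrow> weakly_separated n l lam"
  shows "\<exists>d>0. \<forall>F. finite F \<longrightarrow> F \<subseteq> range lam \<longrightarrow>
     psd_on F (\<lambda>x y. l x y - (if x = y then of_real d * l x x else 0))"
proof -
  have l: "psd_kernel l" unfolding l_def by (rule psd_kernel_mult[OF g])
  obtain e where e: "e > 0" "\<And>F i. finite F \<Longrightarrow> F \<subseteq> range lam \<Longrightarrow> card F \<le> nat \<lceil>2 * C\<rceil> \<Longrightarrow> i \<in> F \<Longrightarrow>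
      psd_on F (\<lambda>x y. l x y - unit_entry i (of_real e * l i i) x y)"
    using weakly_separated_small_sets[OF l pos ws, of "nat \<lceil>2 * C\<rceil>"] by blast
  have "psd_on F (\<lambda>x y. l x y - (if x = y then of_real (exp (- 2 * C) * e / (4 * C)) * l x x else 0))"
    if F: "finite F" "F \<subseteq> range lam" for F
    unfolding l_def
  proof (rule riesz_lower_bound[OF F(1) C(1) C(2)[OF F] psd_kernelD[OF g F(1)]])
    show "0 \<le> exp (- 2 * C) * e" using e(1) by simp
    fix i assume i: "i \<in> F"
    have sub: "near F i \<subseteq> F" by (auto simp: near_def)
    have "real (card (near F i)) \<le> 2 * C" by (rule card_near[OF F(1) C(2)[OF F] i])
    also have "\<dots> \<le> real (nat \<lceil>2 * C\<rceil>)" by (rule real_nat_ceiling_ge)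
    finally have "card (near F i) \<le> nat \<lceil>2 * C\<rceil>" by simp
    from e(2)[OF finite_subset[OF sub F(1)] order_trans[OF sub F(2)] this self_in_near[OF i]]
    show "psd_on F (\<lambda>m n. g m n * s m n - unit_entry i (of_real (exp (- 2 * C) * e) * (g i i * s i i)) m n)"
      unfolding l_def
      by (intro strongly_separated F(1) C(2)[OF F] i psd_kernelD[OF g F(1)]) (use e(1) in auto)
  qed
  then show ?thesis using e(1) C(1) by (intro exI[of _ "exp (- 2 * C) * e / (4 * C)"]) auto
qed

lemma psd_imp_interpolating:
  assumes g: "psd_kernel g" and l_def: "l = (\<lambda>z w. g z w * s z w)" and inj: "inj lam"
    and C: "C > 0" "\<And>F. finite F \<Longrightarrow> F \<subseteq> range lam \<Longrightarrow> psd_on F (\<lambda>x y. (if x = y then of_real C else 0) - H x y)"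
    and d: "d > 0" "\<And>F. finite F \<Longrightarrow> F \<subseteq> range lam \<Longrightarrow> psd_on F (\<lambda>x y. l x y - (if x = y then of_real d * l x x else 0))"
  shows "interpolating s l lam"
  unfolding interpolating_def
proof (intro allI impI)
  fix w :: "nat \<Rightarrow> complex" assume "\<exists>B. \<forall>i. cmod (w i) \<le> B"
  then obtain B where B: "\<And>i. cmod (w i) \<le> B" by blast
  have l: "psd_kernel l" unfolding l_def by (rule psd_kernel_mult[OF g])
  \<comment> \<open>Replacing \<open>H\<close> by its upper bound \<open>C\<close> costs at most C
    B^2 times the diagonal of \<open>l\<close>; this \<open>M\<close> makes the lower bound
    \<open>d\<close> pay for it exactly.\<close>
  define M where "M = C * B\<^sup>2 / d"
  have M: "M \<ge> 0" "M * d = C * B\<^sup>2" using C(1) d(1) by (auto simp: M_def)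
  define u where "u x = w (inv lam x) * of_real (kvec_norm l x)" for x
  define \<phi>0 where "\<phi>0 x = u x / of_real (nrm x)" for x
  have P: "psd_on Y (\<lambda>i j. (of_real M * g i j - \<phi>0 i * cnj (\<phi>0 j)) * s i j)"
    if Y: "finite Y" "Y \<subseteq> range lam" for Y
  proof -
    have 1: "psd_on Y (\<lambda>i j. of_real M * (l i j - (if i = j then of_real d * l i i else 0)))"
      using M(1) by (intro psd_on_scale d(2) Y) (simp add: less_eq_complex_def)
    have 2: "psd_on Y (\<lambda>i j. u i * cnj (u j) * ((if i = j then of_real C else 0) - H i j))"
      by (intro psd_on_congruence C(2) Y)
    have 3: "psd_on Y (\<lambda>i j. if i = j then of_real (C * B\<^sup>2) * l i i - of_real C * (u i * cnj (u i)) else 0)"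
    proof (intro psd_on_diag Y(1))
      fix i
      have "(cmod (u i))\<^sup>2 \<le> B\<^sup>2 * (kvec_norm l i)\<^sup>2"
        using power_mono[OF B[of "inv lam i"], of 2] by (simp add: u_def norm_mult power_mult_distrib mult_right_mono)
      then have "0 \<le> C * (B\<^sup>2 * (kvec_norm l i)\<^sup>2 - (cmod (u i))\<^sup>2)" using C(1) by simp
      moreover have "of_real (C * B\<^sup>2) * l i i - of_real C * (u i * cnj (u i))
          = of_real (C * (B\<^sup>2 * (kvec_norm l i)\<^sup>2 - (cmod (u i))\<^sup>2))"
        unfolding complex_norm_square[symmetric] kvec_norm_square[OF l, symmetric]
        by (simp add: power2_eq_square algebra_simps)
      ultimately show "0 \<le> of_real (C * B\<^sup>2) * l i i - of_real C * (u i * cnj (u i))"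
        by (simp only: less_eq_complex_def Re_complex_of_real Im_complex_of_real zero_complex.sel)
    qed
    have Md: "complex_of_real M * of_real d = of_real (C * B\<^sup>2)" using M(2) by (simp flip: of_real_mult)
    \<comment> \<open>The Pick matrix is the sum of \<open>M\<close> times the Riesz defect of
      \<open>l\<close>, a congruence of C - H, and the nonnegative diagonal remainder.\<close>
    show ?thesis
    proof (rule iffD1[OF psd_on_cong psd_on_add[OF psd_on_add[OF 1 2] 3]])
      fix i j
      have "\<phi>0 i * cnj (\<phi>0 j) * s i j = u i * cnj (u j) * H i j"
        by (simp add: \<phi>0_def H_def)
      then have rhs: "(of_real M * g i j - \<phi>0 i * cnj (\<phi>0 j)) * s i j = of_real M * l i j - u i * cnj (u j) * H i j"
        by (simp add: left_diff_distrib l_def mult.assoc)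
      have eq: "of_real M * (of_real d * l i i) = of_real (C * B\<^sup>2) * l i i"
        by (simp only: Md[symmetric] mult.assoc)
      have identity: "a * (x - y) + b * (c - h) + (z - c * b) = a * x - b * h" if "a * y = z" for a b c h x y z :: complex
        using that by (simp add: right_diff_distrib mult.commute)
      show "of_real M * (l i j - (if i = j then of_real d * l i i else 0))
          + u i * cnj (u j) * ((if i = j then of_real C else 0) - H i j)
          + (if i = j then of_real (C * B\<^sup>2) * l i i - of_real C * (u i * cnj (u i)) else 0)
        = (of_real M * g i j - \<phi>0 i * cnj (\<phi>0 j)) * s i j" (is "?lhs = _")
        unfolding rhs
      proof (cases "i = j")
        case True
        show "?lhs = of_real M * l i j - u i * cnj (u j) * H i j"
          unfolding True[symmetric] if_P[OF refl] by (rule identity[OF eq])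
      next
        case False
        then show "?lhs = of_real M * l i j - u i * cnj (u j) * H i j"
          by simp
      qed
    qed
  qed
  have gM: "psd_on F (\<lambda>i j. of_real M * g i j)" if "finite F" for F
    using M(1) by (intro psd_on_scale psd_kernelD[OF g that]) (simp add: less_eq_complex_def)
  have "\<exists>\<phi>. (\<forall>x\<in>range lam. \<phi> x = \<phi>0 x) \<and>
      (\<forall>F. finite F \<longrightarrow> psd_on F (\<lambda>i j. (of_real M * g i j - \<phi> i * cnj (\<phi> j)) * s i j))"
    by (rule pick_extension[OF gM P])
  then obtain \<phi> where \<phi>: "\<forall>x\<in>range lam. \<phi> x = \<phi>0 x"
    "\<forall>F. finite F \<longrightarrow> psd_on F (\<lambda>i j. (of_real M * g i j - \<phi> i * cnj (\<phi> j)) * s i j)"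
    by (elim exE conjE)
  have "is_mult s l \<phi>"
    unfolding is_mult_iff[OF psd_kernel_s l]
    using M(1) \<phi>(2) by (intro exI[of _ M]) (simp add: l_def left_diff_distrib mult.assoc)
  moreover have "\<phi> (lam i) = w i * complex_of_real (kvec_norm l (lam i) / kvec_norm s (lam i))" for i
    using inj by (simp add: \<phi>(1) \<phi>0_def u_def kvec_norm_s)
  ultimately show "\<exists>\<phi>. is_mult s l \<phi> \<and>
      (\<forall>i. \<phi> (lam i) = w i * complex_of_real (kvec_norm l (lam i) / kvec_norm s (lam i)))" by blast
qed

theorem interpolating_iff:
  assumes g: "psd_kernel g" and l_def: "l = (\<lambda>z w. g z w * s z w)"
    and nz: "\<And>z. kvec l z \<noteq> (\<lambda>x. 0)" and inj: "inj lam"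
  shows "interpolating s l lam \<longleftrightarrow> carleson s lam \<and> (\<forall>n\<ge>2. weakly_separated n l lam)"
proof -
  have l: "psd_kernel l" unfolding l_def by (rule psd_kernel_mult[OF g])
  have pos: "0 < kvec_norm l z" for z by (rule kvec_norm_pos[OF l nz])
  show ?thesis
  proof
    assume "interpolating s l lam"
    then obtain M where M: "M > 0" "\<And>F. finite F \<Longrightarrow> F \<subseteq> range lam \<Longrightarrow>
        psd_on F (\<lambda>x y. l x y - (if x = y then of_real (1 / M) * l x x else 0))"
        "\<And>F. finite F \<Longrightarrow> F \<subseteq> range lam \<Longrightarrow> psd_on F (\<lambda>x y. (if x = y then of_real M else 0) - H x y)"
      using interpolating_imp_psd[OF l pos inj] by blast
    have "carleson s lam" unfolding carleson_iff[OF inj] using M(1,3) by blast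
    moreover have "weakly_separated n l lam" if "n \<ge> 2" for n
      by (rule psd_imp_weakly_separated[OF l pos _ _ M(2)]) (use M(1) that in auto)
    ultimately show "carleson s lam \<and> (\<forall>n\<ge>2. weakly_separated n l lam)" by blast
  next
    assume A: "carleson s lam \<and> (\<forall>n\<ge>2. weakly_separated n l lam)"
    then obtain C where C: "C > 0"
      "\<And>F. finite F \<Longrightarrow> F \<subseteq> range lam \<Longrightarrow> psd_on F (\<lambda>x y. (if x = y then of_real C else 0) - H x y)"
      unfolding carleson_iff[OF inj] by blast
    obtain d where d: "d > 0"
      "\<And>F. finite F \<Longrightarrow> F \<subseteq> range lam \<Longrightarrow> psd_on F (\<lambda>x y. l x y - (if x = y then of_real d * l x x else 0))"
      using riesz_lower_bound_weakly_separated[OF g l_def pos C] A by blast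
    show "interpolating s l lam" by (intro psd_imp_interpolating[OF g l_def inj C d])
  qed
qed

end

theorem theorem1p4:
  fixes b :: "'a \<Rightarrow> 'k \<Rightarrow> complex"
    and s g l :: "'a \<Rightarrow> 'a \<Rightarrow> complex"
    and lam :: "nat \<Rightarrow> 'a"
  assumes "ncp_kernel b s"
    and "psd_kernel g"
    and "l = (\<lambda>z w. g z w * s z w)"
    and "\<forall>z. kvec l z \<noteq> (\<lambda>x. 0)"
    and "inj lam"
  shows "interpolating s l lam \<longleftrightarrow>
           carleson s lam \<and> (\<forall>n\<ge>2. weakly_separated n l lam)"
proof -
  interpret pick_kernel "\<lambda>z w. l2_inner (b z) (b w)" s
    by (rule ncp_kernel_imp_pick_kernel[OF assms(1)])
  show ?thesis
    by (rule interpolating_iff) (use assms in auto)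
qed

end
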